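(* Let $\mu$ be a measure of $n$-polynomial growth on $\mathbb{R}^d$, let $\alpha=480\sqrt d$, $\alpha_0=6\sqrt d\,\alpha$, $C_0>(6\sqrt d\,\alpha)^d$, and let $\{\Sigma^j\}_{1\le j\le N}$, $N=N(d)$, be the family of doubling David--Mattila filtrations of $\mathrm{supp}(\mu)$ produced, for these $\alpha$, $\alpha_0$, $C_0$, by the covering theorem for doubling cubes recalled in the context (that is, the specific filtrations constructed there). We have $$\mathrm{RBMO}=\bigcap_{j=1}^N\mathrm{RBMO}_{\Sigma^j}^*,$$ with equivalent norms, i.e. $\|f\|_{\mathrm{RBMO}}\sim\max_{1\le j\le N}\|f\|_{\mathrm{RBMO}_{\Sigma^j}^*}$. Moreover, for all doubling David--Mattila filtrations $\Sigma$ we have $\mathrm{RBMO}_\Sigma^*\subset\mathrm{RBMO}_\Sigma$.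
   Context: **Measure and notation.** A measure $\mu$ on $\mathbb{R}^d$ has $n$-polynomial growth if it is a Radon measure with $\mu(B(x,r))\le C_\mu r^n$ for $\mu$-a.e. $x$ and all $r>0$; one normalizes $C_\mu=1$. Cubes are Euclidean cubes; $\ell(Q)$ is the side length, $r(B)$ the radius of a ball $B$, $x_Q$ the center of a cube or ball $Q$, and $\lambda Q$ the concentric dilate. For $a>1$, $b>0$, a cube or ball $Q$ is $(a,b)$-doubling if $\mu(aQ)\le b\,\mu(Q)$; doubling cubes are understood to have positive measure. Functions $f$ are locally $\mu$-integrable and $\langle f\rangle_Q=\frac1{\mu(Q)}\int_Q f\,d\mu$. Each space below consists of the functions for which the indicated quantity is finite (norms modulo constants). **RBMO (Tolsa).** For cubes or balls $Q,R$ put $\delta(Q,R)=1+\int_{2R\setminus 2Q}\frac{d\mu(y)}{|x_Q-y|^n}$. Fix $a>1$, $b>a^d$. Then $$\|f\|_{\mathrm{RBMO}}=\max\Big\{\sup_Q\frac1{\mu(Q)}\int_Q|f-\langle f\rangle_Q|\,d\mu,\ \sup_{Q\subset R}\frac{|\langle f\rangle_Q-\langle f\rangle_R|}{\delta(Q,R)}\Big\},$$ with suprema over $(a,b)$-doubling cubes $Q$, respectively pairs of $(a,b)$-doubling cubes $Q\subset R$. Different choices of $a,b$ give equivalent norms. **Doubling David--Mattila filtrations.** A David--Mattila lattice with parameters $\alpha$, $C_0$, $A_0>5000\,C_0$ and $1\le\tilde C_0<C_0$ is a sequence of nested partitions $\mathcal{L}_k$ of $\mathrm{supp}(\mu)$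 into Borel sets (David--Mattila cubes), obtained by the construction of David and Mattila, in which each $Q\in\mathcal{L}_k$ has an associated ball $B_Q$, with center $x_{B_Q}$ and radius $r(B_Q)$, such that: - $C_0^{-1}\tilde C_0A_0^{-k}\le r(B_Q)\le\tilde C_0A_0^{-k}$ and $B_Q\cap\mathrm{supp}(\mu)\subset Q\subset 30B_Q\cap\mathrm{supp}(\mu)$; the balls $5B_Q$, $Q\in\mathcal{L}_k$, are disjoint; $\frac12B_Q$ and $\frac12B_{Q'}$ are disjoint for $Q\ne Q'$ unless one of $Q,Q'$ contains the other; - small boundaries: for each integer $\ell\ge0$, let $N_\ell(Q)$ be the union of $\{x\in\mathrm{supp}(\mu)\setminus Q:\mathrm{dist}(x,Q)<A_0^{-k-\ell}\}$ and $\{x\in Q:\mathrm{dist}(x,\mathrm{supp}(\mu)\setminus Q)<A_0^{-k-\ell}\}$; then $\mu(N_\ell(Q))\le(C^{-1}C_0^{-3d-1}A_0)^{-\ell}\mu(90B_Q)$ for a constant $C$; - if $Q$ is not $(\alpha,C_0)$-doubling, meaning that $\mu(\alpha B_Q)\le C_0\mu(B_Q)$ fails, then $r(B_Q)$ is the smallest radius allowed in its generation and $\mu(\alpha B_Q)\le C_0^{-\ell}\mu(\alpha^{\ell+1}B_Q)$ for all $\ell\ge1$ with $\alpha^\ell\le C_0$. In the version of Conde-Alonso and Parcet the lattice is constructed so that side lengths are not uniformly bounded above and its $(\alpha,C_0)$-doubling cubes form a two-sided filtration $\Sigma=\{\Sigma_k\}_{k\in\mathbb{Z}}$ of nested partitions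 of $\mathrm{supp}(\mu)$. A doubling David--Mattila filtration is a filtration $\Sigma$ obtained in this way. By construction, besides the properties above (including small boundaries) for its cubes, it satisfies: $\lim_{Q\to x,\,Q\in\Sigma}\frac1{\mu(Q)}\int_Qf\,d\mu=f(x)$ for $\mu$-a.e. $x$ (the union of the spaces $L^\infty(\mathbb{R}^d,\sigma(\Sigma_k),\mu)$ is weak-$*$ dense in $L^\infty(\mu)$); every $Q\in\Sigma$ has $\mu(\alpha B_Q)\le C_0\mu(B_Q)$; and $\int_{\alpha B_{\widehat Q}\setminus\alpha B_Q}\frac{d\mu(y)}{|x_{B_Q}-y|^n}\lesssim_{\alpha,A_0}1$, where $\widehat Q$ is the father of $Q$ in $\Sigma$ (the atom of $\Sigma_{k-1}$ properly containing $Q\in\Sigma_k$). **Covering theorem for doubling cubes.** Fix $\alpha>60$, $C_0>(6\sqrt d\,\alpha)^d$ and $\alpha_0=6\sqrt d\,\alpha$. There exist $N=N(d)$ atomic filtrations $\Sigma^1,\dots,\Sigma^N$ of $\mathrm{supp}(\mu)$ such that: (1) each atom $T\in\Sigma^k$ has a ball $B_T$ with $B_T\cap\mathrm{supp}(\mu)\subset T\subset30B_T\cap\mathrm{supp}(\mu)$ and $\mu(\alpha B_T)\le C_0\mu(B_T)$; (2) for each $(\alpha_0,C_0)$-doubling cube $Q$ in $\mathbb{R}^d$ there are $1\le k\le N$ and $T\in\Sigma^k$ with $Q\cap\mathrm{supp}(\mu)\subset T$, $\ell(Q)\sim r(B_T)$ and $\mu(Q)\sim\mu(T)$. The filtrations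 are the following doubling David--Mattila filtrations ($C_0$ and $A_0$ are taken to be powers of $2$ with positive integer exponents). Take $3^d$ dyadic systems $\mathcal{D}^1,\dots,\mathcal{D}^{3^d}$ of $\mathbb{R}^d$ such that for any two cubes $Q_1,Q_2$ there are $m$ and $T_1,T_2\in\mathcal{D}^m$ with $Q_i\subset T_i\subset6Q_i$. For each $\mathcal{D}=\mathcal{D}^m$, split its $(\alpha_0/6,C_0)$-doubling cubes into finitely many families $\mathcal{F}_1,\dots,\mathcal{F}_{N_0}$ such that different cubes of the same side length $2^{-k}$ in one family are at distance at least $5\cdot2^{-k}\sqrt d$, and the ratio of different side lengths (larger to smaller) in one family is $A_0^p$ for a positive integer $p$. For $Q\in\mathcal{F}_j$ let $B(Q)$ be the ball with the center of $Q$ and radius $\sqrt d\,\ell(Q)/2$. For each $k$ such that $\mathcal{F}_j$ contains cubes of side length $2^{-k}$, let $\mathcal{B}_0(k)$ be the family of the balls $5B(Q)$, $Q\in\mathcal{F}_j$, $\ell(Q)=2^{-k}$. For $x\in\mathrm{supp}(\mu)$ outside the balls of $\mathcal{B}_0(k)$, let $B_x$ be the $5$-fold dilate of the largest $(\alpha,C_0)$-doubling ball centered at $x$ with radius $r(x)$ satisfying $C_0^{-1}2^{-k-1}\sqrt d\le r(x)\le2^{-k-1}\sqrt d$, or of the ball of radius $r(x)=C_0^{-1}2^{-k-1}\sqrt d$ if there is none. Choose countably many of the $B_x$ so that, together with $\mathcal{B}_0(k)$, they are pairwise disjoint and their $5$-fold dilates cover $\mathrm{supp}(\mu)$. The corresponding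 undilated balls serve as the balls $B_T$ of one generation of a David--Mattila lattice; the rest of the David--Mattila construction, in the version of Conde-Alonso and Parcet, then gives a doubling David--Mattila filtration $\Sigma^{j,\mathcal{D}}$ in which every $B(Q)$, $Q\in\mathcal{F}_j$, is the ball $B_T$ of some cube $T$. The family $\{\Sigma^j\}_{1\le j\le N}$, $N=3^dN_0$, consists of all $\Sigma^{j,\mathcal{D}^m}$. **Martingale spaces.** For a doubling David--Mattila filtration $\Sigma$, with $\mathsf{E}_{\Sigma_k}$ the conditional expectation with respect to the $\sigma$-algebra generated by $\Sigma_k$, $$\|f\|_{\mathrm{RBMO}_\Sigma}=\sup_k\big\|\mathsf{E}_{\Sigma_k}|f-\mathsf{E}_{\Sigma_{k-1}}f|\big\|_\infty\sim\sup_{Q\in\Sigma}\Big[\frac1{\mu(Q)}\int_Q|f-\langle f\rangle_Q|\,d\mu+|\langle f\rangle_Q-\langle f\rangle_{\widehat Q}|\Big].$$ For $Q\subset R$ in $\Sigma$ redefine $\delta(Q,R)=1+\int_{\alpha B_R\setminus\alpha B_Q}\frac{d\mu(y)}{|x_{B_Q}-y|^n}$, and for $Q\in\Sigma_k$ let $Q^{(j)}$ be the only element of $\Sigma_{k-j}$ containing $Q$. Then $$\|f\|_{\mathrm{RBMO}_\Sigma^*}=\sup_{Q\in\Sigma}\frac1{\mu(Q)}\int_Q|f-\langle f\rangle_Q|\,d\mu+\sup_{Q\in\Sigma,\,j>0}\frac{|\langle f\rangle_Q-\langle f\rangle_{Q^{(j)}}|}{\delta(Q,Q^{(j)})}.$$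 *)

theory Defs
  imports "HOL-Probability.Probability"
begin

section \<open>Measures of polynomial growth\<close>

text \<open>The ambient space is \<open>real ^ 'd\<close>, so the dimension is \<open>CARD('d)\<close>. The growth constant is
  kept as a parameter; the normalised case is \<open>C = 1\<close>.\<close>

definition radon_measure :: "(real ^ 'd) measure \<Rightarrow> bool" where
  "radon_measure \<mu> \<longleftrightarrow> sets \<mu> = sets borel \<and> (\<forall>K. compact K \<longrightarrow> emeasure \<mu> K < \<infinity>)"

definition poly_growth :: "real \<Rightarrow> real \<Rightarrow> (real ^ 'd) measure \<Rightarrow> bool" where
  "poly_growth n C \<mu> \<longleftrightarrow> radon_measure \<mu> \<and>
     (AE x in \<mu>. \<forall>r>0. emeasure \<mu> (ball x r) \<le> ennreal (C * r powr n))"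

definition msupp :: "(real ^ 'd) measure \<Rightarrow> (real ^ 'd) set" where
  "msupp \<mu> = {x. \<forall>r>0. emeasure \<mu> (ball x r) > 0}"

definition loc_integrable :: "(real ^ 'd) measure \<Rightarrow> (real ^ 'd \<Rightarrow> real) \<Rightarrow> bool" where
  "loc_integrable \<mu> f \<longleftrightarrow> (\<forall>K. compact K \<longrightarrow> set_integrable \<mu> K f)"

definition avg :: "(real ^ 'd) measure \<Rightarrow> (real ^ 'd) set \<Rightarrow> (real ^ 'd \<Rightarrow> real) \<Rightarrow> real" where
  "avg \<mu> S f = (LINT x:S|\<mu>. f x) / measure \<mu> S"

definition osc :: "(real ^ 'd) measure \<Rightarrow> (real ^ 'd) set \<Rightarrow> (real ^ 'd \<Rightarrow> real) \<Rightarrow> real" where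
  "osc \<mu> S f = avg \<mu> S (\<lambda>x. \<bar>f x - avg \<mu> S f\<bar>)"

text \<open>\<open>aS\<close> stands for the dilate of \<open>S\<close>.\<close>

definition doubling :: "(real ^ 'd) measure \<Rightarrow> real \<Rightarrow> (real ^ 'd) set \<Rightarrow> (real ^ 'd) set \<Rightarrow> bool" where
  "doubling \<mu> b S aS \<longleftrightarrow> 0 < emeasure \<mu> S \<and> emeasure \<mu> aS \<le> ennreal b * emeasure \<mu> S"

definition riesz_mass :: "real \<Rightarrow> (real ^ 'd) measure \<Rightarrow> real ^ 'd \<Rightarrow> (real ^ 'd) set \<Rightarrow> ennreal" where
  "riesz_mass n \<mu> x S = (\<integral>\<^sup>+y\<in>S. ennreal (1 / dist x y powr n) \<partial>\<mu>)"


section \<open>RBMO\<close>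

definition cube :: "real ^ 'd \<Rightarrow> real \<Rightarrow> (real ^ 'd) set" where
  "cube x l = {y. \<forall>i. \<bar>y $ i - x $ i\<bar> \<le> l / 2}"

definition doubling_cube :: "(real ^ 'd) measure \<Rightarrow> real \<Rightarrow> real \<Rightarrow> real ^ 'd \<Rightarrow> real \<Rightarrow> bool" where
  "doubling_cube \<mu> a b x l \<longleftrightarrow> 0 < l \<and> doubling \<mu> b (cube x l) (cube x (a * l))"

definition cube_delta ::
  "real \<Rightarrow> (real ^ 'd) measure \<Rightarrow> real ^ 'd \<Rightarrow> real \<Rightarrow> real ^ 'd \<Rightarrow> real \<Rightarrow> ennreal" where
  "cube_delta n \<mu> x l y m = 1 + riesz_mass n \<mu> x (cube y (2 * m) - cube x (2 * l))"

definition RBMO_norm ::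
  "real \<Rightarrow> real \<Rightarrow> real \<Rightarrow> (real ^ 'd) measure \<Rightarrow> (real ^ 'd \<Rightarrow> real) \<Rightarrow> ennreal" where
  "RBMO_norm n a b \<mu> f = max
     (SUP (x, l) \<in> {(x, l). doubling_cube \<mu> a b x l}. ennreal (osc \<mu> (cube x l) f))
     (SUP (x, l, y, m) \<in> {(x, l, y, m). doubling_cube \<mu> a b x l \<and> doubling_cube \<mu> a b y m
                                       \<and> cube x l \<subseteq> cube y m}.
        ennreal \<bar>avg \<mu> (cube x l) f - avg \<mu> (cube y m) f\<bar> / cube_delta n \<mu> x l y m)"

definition RBMO ::
  "real \<Rightarrow> real \<Rightarrow> real \<Rightarrow> (real ^ 'd) measure \<Rightarrow> (real ^ 'd \<Rightarrow> real) set" where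
  "RBMO n a b \<mu> = {f. loc_integrable \<mu> f \<and> RBMO_norm n a b \<mu> f < \<infinity>}"


section \<open>David--Mattila lattices\<close>

text \<open>A cube carries its generation and its ball. The same point set may occur in several
  generations (with different balls), for instance at large scales when the support is compact,
  and then gives different cubes.\<close>

record 'd dm_cube =
  gen :: int
  pts :: "(real ^ 'd) set"
  ctr :: "real ^ 'd"
  rad :: real

definition dball :: "real \<Rightarrow> 'd::finite dm_cube \<Rightarrow> (real ^ 'd) set" where
  "dball t Q = ball (ctr Q) (t * rad Q)"

text \<open>The distances to a set being smaller than \<open>e\<close> are written out with a witness, so that they
  are infinite for the empty set.\<close>

definition collar :: "(real ^ 'd) set \<Rightarrow> (real ^ 'd) set \<Rightarrow> real \<Rightarrow> (real ^ 'd) set" where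
  "collar E Q e = {x \<in> E - Q. \<exists>y\<in>Q. dist x y < e} \<union> {x \<in> Q. \<exists>y\<in>E - Q. dist x y < e}"

text \<open>The scale \<open>Ct\<close> ranges over a full period of the scales \<open>A0 powi (- k)\<close>. In particular all
  \<open>1 \<le> Ct < C0\<close> are covered.\<close>

definition dm_lattice ::
  "(real ^ 'd) measure \<Rightarrow> real \<Rightarrow> real \<Rightarrow> real \<Rightarrow> real \<Rightarrow> 'd::finite dm_cube set \<Rightarrow> bool" where
  "dm_lattice \<mu> \<alpha> C0 A0 Ct L \<longleftrightarrow>
     1 < \<alpha> \<and> 1 < C0 \<and> 5000 * C0 < A0 \<and> 1 \<le> Ct \<and> Ct < A0
   \<and> \<comment> \<open>nested Borel partitions of the support\<close>
     (\<forall>Q\<in>L. pts Q \<in> sets borel \<and> pts Q \<noteq> {})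
   \<and> (\<forall>k. (\<Union>Q\<in>{Q\<in>L. gen Q = k}. pts Q) = msupp \<mu>)
   \<and> (\<forall>Q\<in>L. \<forall>R\<in>L. gen Q = gen R \<longrightarrow> Q \<noteq> R \<longrightarrow> pts Q \<inter> pts R = {})
   \<and> (\<forall>Q\<in>L. \<forall>R\<in>L. gen R < gen Q \<longrightarrow> pts Q \<inter> pts R = {} \<or> pts Q \<subseteq> pts R)
   \<and> \<comment> \<open>associated balls\<close>
     (\<forall>Q\<in>L. Ct / C0 * A0 powi (- gen Q) \<le> rad Q \<and> rad Q \<le> Ct * A0 powi (- gen Q))
   \<and> (\<forall>Q\<in>L. dball 1 Q \<inter> msupp \<mu> \<subseteq> pts Q \<and> pts Q \<subseteq> dball 30 Q \<inter> msupp \<mu>)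
   \<and> (\<forall>Q\<in>L. \<forall>R\<in>L. gen Q = gen R \<longrightarrow> Q \<noteq> R \<longrightarrow> dball 5 Q \<inter> dball 5 R = {})
   \<and> (\<forall>Q\<in>L. \<forall>R\<in>L. Q \<noteq> R \<longrightarrow>
        dball (1/2) Q \<inter> dball (1/2) R = {} \<or> pts Q \<subseteq> pts R \<or> pts R \<subseteq> pts Q)
   \<and> \<comment> \<open>small boundaries\<close>
     (\<exists>C>0. \<forall>Q\<in>L. \<forall>l::nat.
        emeasure \<mu> (collar (msupp \<mu>) (pts Q) (A0 powi (- gen Q - int l)))
          \<le> ennreal (inverse ((A0 / (C * C0 ^ (3 * CARD('d) + 1))) ^ l)) * emeasure \<mu> (dball 90 Q))
   \<and> \<comment> \<open>non-doubling cubes\<close>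
     (\<forall>Q\<in>L. \<not> emeasure \<mu> (dball \<alpha> Q) \<le> ennreal C0 * emeasure \<mu> (dball 1 Q) \<longrightarrow>
        rad Q = Ct / C0 * A0 powi (- gen Q) \<and>
        (\<forall>l::nat. 1 \<le> l \<longrightarrow> \<alpha> ^ l \<le> C0 \<longrightarrow>
           emeasure \<mu> (dball \<alpha> Q) \<le> ennreal (inverse (C0 ^ l)) * emeasure \<mu> (dball (\<alpha> ^ (l + 1)) Q)))"

text \<open>The doubling cubes of the lattice are arranged into levels \<open>S k\<close> (\<open>k\<close> any integer). Points
  around which all small cubes fail to be doubling form a null set, so a level is only required to
  partition the support up to a null set. A father is a cube of a strictly larger scale; its point
  set need not be strictly larger. The last conjunct bounds the integral between a cube and its
  father by the constant \<open>c\<close>.\<close>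

definition dm_filtration ::
  "real \<Rightarrow> (real ^ 'd) measure \<Rightarrow> real \<Rightarrow> real \<Rightarrow> real \<Rightarrow> real \<Rightarrow> real \<Rightarrow>
     'd::finite dm_cube set \<Rightarrow> (int \<Rightarrow> 'd::finite dm_cube set) \<Rightarrow> bool" where
  "dm_filtration n \<mu> \<alpha> C0 A0 Ct c L S \<longleftrightarrow>
     dm_lattice \<mu> \<alpha> C0 A0 Ct L
   \<and> (\<Union>k. S k) = {Q\<in>L. doubling \<mu> C0 (dball 1 Q) (dball \<alpha> Q)}
   \<and> (\<forall>k. \<forall>Q\<in>S k. \<forall>R\<in>S k. Q \<noteq> R \<longrightarrow> pts Q \<inter> pts R = {})
   \<and> (\<forall>k. AE x in \<mu>. \<exists>Q\<in>S k. x \<in> pts Q)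
   \<and> (\<forall>k. \<forall>Q\<in>S k. \<exists>P\<in>S (k - 1). gen P < gen Q \<and> pts Q \<subseteq> pts P)
   \<and> (\<forall>f. loc_integrable \<mu> f \<longrightarrow>
        (AE x in \<mu>. \<forall>e>0. \<exists>r>0. \<forall>Q\<in>(\<Union>k. S k).
           x \<in> pts Q \<and> rad Q < r \<longrightarrow> \<bar>avg \<mu> (pts Q) f - f x\<bar> < e))
   \<and> (\<forall>k. \<forall>Q\<in>S k. \<forall>P\<in>S (k - 1). pts Q \<subseteq> pts P \<longrightarrow>
        riesz_mass n \<mu> (ctr Q) (dball \<alpha> P - dball \<alpha> Q) \<le> ennreal c)"


section \<open>Martingale spaces\<close>

definition level_algebra :: "(int \<Rightarrow> 'd::finite dm_cube set) \<Rightarrow> int \<Rightarrow> (real ^ 'd) measure" where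
  "level_algebra S k = sigma UNIV (pts ` S k)"

definition RBMO_mart_norm ::
  "(real ^ 'd) measure \<Rightarrow> (int \<Rightarrow> 'd::finite dm_cube set) \<Rightarrow> (real ^ 'd \<Rightarrow> real) \<Rightarrow> ennreal" where
  "RBMO_mart_norm \<mu> S f = (SUP k. esssup \<mu> (nn_cond_exp \<mu> (level_algebra S k)
     (\<lambda>x. ennreal \<bar>f x - real_cond_exp \<mu> (level_algebra S (k - 1)) f x\<bar>)))"

definition RBMO_mart ::
  "(real ^ 'd) measure \<Rightarrow> (int \<Rightarrow> 'd::finite dm_cube set) \<Rightarrow> (real ^ 'd \<Rightarrow> real) set" where
  "RBMO_mart \<mu> S = {f. loc_integrable \<mu> f \<and> RBMO_mart_norm \<mu> S f < \<infinity>}"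

definition dm_delta ::
  "real \<Rightarrow> (real ^ 'd) measure \<Rightarrow> real \<Rightarrow> 'd::finite dm_cube \<Rightarrow> 'd::finite dm_cube \<Rightarrow> ennreal" where
  "dm_delta n \<mu> \<alpha> Q R = 1 + riesz_mass n \<mu> (ctr Q) (dball \<alpha> R - dball \<alpha> Q)"

text \<open>In the second supremum \<open>R\<close> is the ancestor of \<open>Q\<close> that lies \<open>j\<close> levels up.\<close>

definition RBMO_star_norm ::
  "real \<Rightarrow> (real ^ 'd) measure \<Rightarrow> real \<Rightarrow> (int \<Rightarrow> 'd::finite dm_cube set) \<Rightarrow> (real ^ 'd \<Rightarrow> real) \<Rightarrow> ennreal" where
  "RBMO_star_norm n \<mu> \<alpha> S f =
     (SUP Q\<in>(\<Union>k. S k). ennreal (osc \<mu> (pts Q) f))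
   + (SUP (Q, R) \<in> {(Q, R). \<exists>k. \<exists>j::nat. 0 < j \<and> Q \<in> S k \<and> R \<in> S (k - int j) \<and> pts Q \<subseteq> pts R}.
        ennreal \<bar>avg \<mu> (pts Q) f - avg \<mu> (pts R) f\<bar> / dm_delta n \<mu> \<alpha> Q R)"

definition RBMO_star ::
  "real \<Rightarrow> (real ^ 'd) measure \<Rightarrow> real \<Rightarrow> (int \<Rightarrow> 'd::finite dm_cube set) \<Rightarrow> (real ^ 'd \<Rightarrow> real) set" where
  "RBMO_star n \<mu> \<alpha> S = {f. loc_integrable \<mu> f \<and> RBMO_star_norm n \<mu> \<alpha> S f < \<infinity>}"


section \<open>The filtrations of the covering theorem\<close>

text \<open>Dyadic cubes are half-open. A dyadic system is the set of the pairs (center, side length) of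
  its cubes; the cubes of side length \<open>2 powi (- k)\<close> form a translated grid.\<close>

definition hcube :: "real ^ 'd \<Rightarrow> real \<Rightarrow> (real ^ 'd) set" where
  "hcube x l = {y. \<forall>i. x $ i - l / 2 \<le> y $ i \<and> y $ i < x $ i + l / 2}"

definition dyadic_system :: "((real ^ 'd) \<times> real) set \<Rightarrow> bool" where
  "dyadic_system D \<longleftrightarrow>
     (\<exists>v :: int \<Rightarrow> real ^ 'd.
        D = {(v k + (2 powi (- k)) *\<^sub>R m, 2 powi (- k)) | k m. \<forall>i. m $ i \<in> \<int>})
   \<and> (\<forall>(x, l)\<in>D. \<forall>(y, m)\<in>D.
        hcube x l \<inter> hcube y m = {} \<or> hcube x l \<subseteq> hcube y m \<or> hcube y m \<subseteq> hcube x l)"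

text \<open>\<open>M\<close> dyadic systems that contain any two cubes simultaneously.\<close>

definition covering_systems :: "nat \<Rightarrow> (nat \<Rightarrow> ((real ^ 'd) \<times> real) set) \<Rightarrow> bool" where
  "covering_systems M D \<longleftrightarrow>
     (\<forall>m<M. dyadic_system (D m))
   \<and> (\<forall>x1 l1 x2 l2. 0 < l1 \<longrightarrow> 0 < l2 \<longrightarrow>
        (\<exists>m<M. \<exists>(y1, t1)\<in>D m. \<exists>(y2, t2)\<in>D m.
           cube x1 l1 \<subseteq> hcube y1 t1 \<and> hcube y1 t1 \<subseteq> cube x1 (6 * l1) \<and>
           cube x2 l2 \<subseteq> hcube y2 t2 \<and> hcube y2 t2 \<subseteq> cube x2 (6 * l2)))"

definition splitting ::
  "(real ^ 'd) measure \<Rightarrow> real \<Rightarrow> real \<Rightarrow> real \<Rightarrow> ((real ^ 'd) \<times> real) set \<Rightarrow>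
     nat \<Rightarrow> (nat \<Rightarrow> ((real ^ 'd) \<times> real) set) \<Rightarrow> bool" where
  "splitting \<mu> a C0 A0 D N F \<longleftrightarrow>
     (\<Union>j<N. F j) = {(x, l)\<in>D. doubling \<mu> C0 (hcube x l) (hcube x (a * l))}
   \<and> (\<forall>i<N. \<forall>j<N. i \<noteq> j \<longrightarrow> F i \<inter> F j = {})
   \<and> (\<forall>j<N. \<forall>(x, l)\<in>F j. \<forall>(y, m)\<in>F j. x \<noteq> y \<longrightarrow> l = m \<longrightarrow>
        5 * l * sqrt (CARD('d)) \<le> setdist (hcube x l) (hcube y m))
   \<and> (\<forall>j<N. \<forall>(x, l)\<in>F j. \<forall>(y, m)\<in>F j. m < l \<longrightarrow> (\<exists>p::nat. 0 < p \<and> l / m = A0 ^ p))"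

text \<open>\<open>r\<close> is the largest radius of a doubling ball centered at \<open>x\<close> in the range from \<open>s / C0\<close> to
  \<open>s\<close>, or \<open>s / C0\<close> if there is none. For open balls a largest radius exists as soon as there is an
  admissible one.\<close>

definition selected_radius ::
  "(real ^ 'd) measure \<Rightarrow> real \<Rightarrow> real \<Rightarrow> real \<Rightarrow> real ^ 'd \<Rightarrow> real \<Rightarrow> bool" where
  "selected_radius \<mu> \<alpha> C0 s x r \<longleftrightarrow>
     (let A = {r. s / C0 \<le> r \<and> r \<le> s \<and> doubling \<mu> C0 (ball x r) (ball x (\<alpha> * r))}
      in (r \<in> A \<and> (\<forall>t\<in>A. t \<le> r)) \<or> (A = {} \<and> r = s / C0))"

text \<open>The undilated balls of one generation, as pairs (center, radius): those of the dyadic cubes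
  with centers in \<open>X\<close> and common side length, and those with centers in a countable set \<open>Y\<close>. Here
  \<open>s\<close> is the half diameter of the dyadic cubes.\<close>

definition generation_balls ::
  "(real ^ 'd) measure \<Rightarrow> real \<Rightarrow> real \<Rightarrow> (real ^ 'd) set \<Rightarrow> real \<Rightarrow> ((real ^ 'd) \<times> real) set \<Rightarrow> bool" where
  "generation_balls \<mu> \<alpha> C0 X s G \<longleftrightarrow>
     (\<exists>Y r. countable Y \<and> Y \<subseteq> msupp \<mu> - (\<Union>x\<in>X. ball x (5 * s))
        \<and> (\<forall>y\<in>Y. selected_radius \<mu> \<alpha> C0 s y (r y))
        \<and> G = (\<lambda>x. (x, s)) ` X \<union> (\<lambda>y. (y, r y)) ` Y)
   \<and> (\<forall>(x, r)\<in>G. \<forall>(y, t)\<in>G. (x, r) \<noteq> (y, t) \<longrightarrow> ball x (5 * r) \<inter> ball y (5 * t) = {})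
   \<and> msupp \<mu> \<subseteq> (\<Union>(x, r)\<in>G. ball x (25 * r))"

text \<open>\<open>S m j\<close> is the filtration built from the family \<open>F m j\<close> of cubes of the system \<open>D m\<close>.\<close>

definition covering_family ::
  "real \<Rightarrow> (real ^ 'd) measure \<Rightarrow> real \<Rightarrow> real \<Rightarrow> real \<Rightarrow> real \<Rightarrow> real \<Rightarrow>
     nat \<Rightarrow> nat \<Rightarrow> (nat \<Rightarrow> nat \<Rightarrow> int \<Rightarrow> 'd::finite dm_cube set) \<Rightarrow> bool" where
  "covering_family n \<mu> \<alpha> \<alpha>0 C0 A0 c M N S \<longleftrightarrow>
     0 < N \<and>
     (\<exists>D F. covering_systems M D \<and>
       (\<forall>m<M. splitting \<mu> (\<alpha>0 / 6) C0 A0 (D m) N (F m) \<and>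
         (\<forall>j<N. \<exists>Ct L. dm_filtration n \<mu> \<alpha> C0 A0 Ct c L (S m j) \<and>
            (\<forall>l \<in> snd ` F m j. \<exists>g.
               Ct * A0 powi (- g) = sqrt (CARD('d)) * l / 2 \<and>
               generation_balls \<mu> \<alpha> C0 {x. (x, l) \<in> F m j} (sqrt (CARD('d)) * l / 2)
                 {(ctr Q, rad Q) | Q. Q \<in> L \<and> gen Q = g}))))"

end

theory Submission
  imports Defs
begin

text \<open>
  Both inequalities between the norms rest on the same argument. To bound the mean deviation of \<open>f\<close>
  over a cube (an atom), cover it by small doubling atoms (cubes), with bounded overlap and inside a
  dilate of comparable measure. The average of \<open>f\<close> over each of them is compared with the average over
  one fixed large atom (cube), at the cost of a Riesz integral over the region in between. The Riesz
  integrals are controlled because along non-doubling scales the density \<open>\<mu> (cube y l) / l powr n\<close>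
  grows geometrically while being bounded.

  For the bound of the RBMO norm the covering sets are the maximal small atoms of the very filtration
  that contains an atom around the large cube, so different filtrations need not be compared. For
  the converse bound they are cubes selected by a Besicovitch argument.
\<close>

section \<open>Cubes and growth\<close>

text \<open>Each comparison is reduced to one inequality: for a large set \<open>R\<close> there is
  a number \<open>F\<close>, chosen before \<open>Q\<close>, such that the integral of |f - F| over
  every admissible \<open>Q\<close> inside \<open>R\<close> is at most a constant times delta(Q,R)
  mu(Q). The choice Q = R, where delta is 1, gives the mean deviation; a general pair gives the
  difference of the averages, both being compared with \<open>F\<close>.

  The obstacle is that the two spaces use different kinds of doubling. An (a,b)-doubling cube need
  not be (\<alpha>0,C0)-doubling, so the covering theorem applies only to a dilate of it, and
  similarly an atom has to be enlarged to reach an (a,b)-doubling cube. Hence \<open>F\<close>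
  belongs to a set larger than \<open>R\<close>, and the scales in between are paid for because they
  are exactly the non-doubling ones. The assumptions on a^d and \<alpha>0^d enter here, since n is
  at most d as soon as some cube has mass.

  An atom may be far smaller than its father, because generations without doubling cubes are
  skipped. That jump costs only \<open>c\<close>. All constants depend on n, the growth constant, d,
  \<open>c\<close> and the doubling parameters alone, so they are uniform in the measure and in the
  filtrations.\<close>

lemma mem_cube: "y \<in> cube x l \<longleftrightarrow> infnorm (y - x) \<le> l / 2"
proof -
  have "infnorm (y - x) \<le> l / 2 \<longleftrightarrow> (\<forall>i. \<bar>(y - x) $ i\<bar> \<le> l / 2)"
  proof
    assume "\<forall>i. \<bar>(y - x) $ i\<bar> \<le> l / 2"
    then show "infnorm (y - x) \<le> l / 2"
      unfolding infnorm_cart by (intro cSup_least) auto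
  qed (use component_le_infnorm_cart[of "y - x"] order_trans in blast)
  then show ?thesis by (simp add: cube_def)
qed

lemma infnorm_le_dist: "infnorm (x - y) \<le> dist x y"
  by (simp add: dist_norm infnorm_le_norm)

lemma dist_le_infnorm:
  "dist x y \<le> sqrt CARD('d) * infnorm (x - y)" for x y :: "real ^ 'd::finite"
  using norm_le_infnorm[of "x - y"] by (simp add: dist_norm)

lemma infnorm_diff_triangle: "infnorm (x - z) \<le> infnorm (x - y) + infnorm (y - z)"
  using infnorm_triangle[of "x - y" "y - z"] by simp

lemma cube_subset:
  assumes "infnorm (x - y) + l / 2 \<le> m / 2"
  shows "cube x l \<subseteq> cube y m"
proof
  fix w assume "w \<in> cube x l"
  then show "w \<in> cube y m"
    using assms infnorm_diff_triangle[of w y x] by (simp add: mem_cube)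
qed

lemma cube_mono: "l \<le> m \<Longrightarrow> cube x l \<subseteq> cube x m"
  by (auto simp: mem_cube)

lemma cube_subset_side:
  fixes x y :: "real ^ 'd::finite"
  assumes "cube x l \<subseteq> cube y m" "0 \<le> l"
  shows "l \<le> m"
proof -
  have "x + (\<chi> i. l / 2) \<in> cube x l" "x - (\<chi> i. l / 2) \<in> cube x l"
    using assms(2) by (auto simp: cube_def)
  then have "x + (\<chi> i. l / 2) \<in> cube y m" "x - (\<chi> i. l / 2) \<in> cube y m"
    using assms(1) by auto
  then have "\<And>i. \<bar>x $ i + l / 2 - y $ i\<bar> \<le> m / 2" "\<And>i. \<bar>x $ i - l / 2 - y $ i\<bar> \<le> m / 2"
    by (auto simp: cube_def)
  from this[of undefined] show ?thesis by linarith
qed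

lemma closed_cube: "closed (cube x l)"
proof -
  have "cube x l = (\<lambda>y. infnorm (y - x)) -` {..l / 2}" by (auto simp: mem_cube)
  then show ?thesis
    by (simp add: closed_vimage continuous_intros)
qed

lemma cube_borel [measurable]: "cube x l \<in> sets borel"
  by (simp add: closed_cube borel_closed)

lemma ball_subset_cube: "ball x r \<subseteq> cube x (2 * r)"
proof
  fix y assume "y \<in> ball x r"
  then show "y \<in> cube x (2 * r)" using infnorm_le_dist[of y x] by (simp add: mem_cube dist_commute)
qed

lemma cube_subset_cball:
  "cube x l \<subseteq> cball x (sqrt CARD('d) * l / 2)" for x :: "real ^ 'd::finite"
proof
  fix y assume "y \<in> cube x l"
  then have "sqrt CARD('d) * infnorm (y - x) \<le> sqrt CARD('d) * (l / 2)"
    by (intro mult_left_mono) (auto simp: mem_cube)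
  then show "y \<in> cball x (sqrt CARD('d) * l / 2)"
    using dist_le_infnorm[of y x] unfolding mem_cball dist_commute[of x y] by linarith
qed

lemma compact_cube: "compact (cube x l)" for x :: "real ^ 'd::finite"
  using bounded_subset[OF bounded_cball cube_subset_cball] closed_cube
  unfolding compact_eq_bounded_closed by blast

lemma bounded_subset_cube:
  fixes E :: "(real ^ 'd::finite) set"
  assumes "bounded E"
  obtains l where "0 < l" "E \<subseteq> cube 0 l"
proof -
  obtain r where r: "r > 0" "E \<subseteq> ball 0 r" using bounded_subset_ballD[OF assms, of 0] by auto
  show ?thesis using that[of "2 * r"] r ball_subset_cube[of 0 r] by auto
qed

lemma cube_subdivision:
  fixes x :: "real ^ 'd::finite"
  shows "\<exists>Y. finite Y \<and> card Y \<le> (2 ^ j) ^ CARD('d) \<and> cube x l \<subseteq> (\<Union>y\<in>Y. cube y (l / 2 ^ j))"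
proof (induction j)
  case 0
  show ?case by (rule exI[of _ "{x}"]) auto
next
  case (Suc j)
  then obtain Y where Y: "finite Y" "card Y \<le> (2 ^ j) ^ CARD('d)"
    "cube x l \<subseteq> (\<Union>y\<in>Y. cube y (l / 2 ^ j))" by blast
  define h where "h = l / 2 ^ j"
  \<comment> \<open>\<open>v I\<close> leads from the center of a cube to the center of one of its
    2^d children; \<open>I\<close> is the set of coordinates moved upwards.\<close>
  define v :: "'d set \<Rightarrow> real ^ 'd" where "v I = (\<chi> i. if i \<in> I then h / 4 else - h / 4)" for I
  define Z where "Z = (\<lambda>(y, I). y + v I) ` (Y \<times> UNIV)"
  have "card Z \<le> card (Y \<times> (UNIV :: 'd set set))"
    unfolding Z_def by (intro card_image_le) (use Y in auto)
  also have "\<dots> = card Y * 2 ^ CARD('d)"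
    by (simp add: card_cartesian_product card_Pow flip: Pow_UNIV)
  also have "\<dots> \<le> (2 ^ j) ^ CARD('d) * 2 ^ CARD('d)" using Y by simp
  also have "\<dots> = (2 ^ Suc j) ^ CARD('d)" by (simp add: power_mult_distrib mult.commute)
  finally have "card Z \<le> (2 ^ Suc j) ^ CARD('d)" .
  moreover have "finite Z" using Y by (simp add: Z_def)
  moreover have "cube x l \<subseteq> (\<Union>y\<in>Z. cube y (l / 2 ^ Suc j))"
  proof
    fix w assume "w \<in> cube x l"
    then obtain y where y: "y \<in> Y" "w \<in> cube y h" using Y unfolding h_def by auto
    define I where "I = {i. w $ i \<ge> y $ i}"
    have "w \<in> cube (y + v I) (h / 2)"
      unfolding cube_def
    proof safe
      fix i
      have "\<bar>w $ i - y $ i\<bar> \<le> h / 2" using y(2) by (simp add: cube_def)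
      then show "\<bar>w $ i - (y + v I) $ i\<bar> \<le> h / 2 / 2"
        unfolding v_def I_def by (cases "y $ i \<le> w $ i") (simp_all add: abs_if split: if_splits)
    qed
    moreover have "h / 2 = l / 2 ^ Suc j" by (simp add: h_def)
    ultimately show "w \<in> (\<Union>y\<in>Z. cube y (l / 2 ^ Suc j))" using y(1) by (auto simp: Z_def)
  qed
  ultimately show ?case by blast
qed

text \<open>Along non-doubling cubes the densities \<open>\<mu> (cube y l) / l powr n\<close> increase geometrically, so
  their sum is controlled by the last one, which is at most \<open>G\<close>.\<close>

definition chain_const :: "real \<Rightarrow> real \<Rightarrow> real \<Rightarrow> real \<Rightarrow> real \<Rightarrow> real" where
  "chain_const n G \<eta> t B = (2 / \<eta>) powr n * (G * t powr n) * (1 + 1 / (1 - t powr n / B))"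

locale growth_measure =
  fixes \<mu> :: "(real ^ 'd::finite) measure" and n G :: real
  assumes n_pos: "0 < n" and G_pos: "0 < G"
    and sets_mu [measurable_cong, simp]: "sets \<mu> = sets borel"
    and cube_growth: "0 < l \<Longrightarrow> emeasure \<mu> (cube x l) \<le> ennreal (G * l powr n)"
begin

lemma space_mu [simp]: "space \<mu> = UNIV"
  using sets_eq_imp_space_eq[OF sets_mu] by simp

lemma emeasure_bounded_finite:
  assumes "bounded E"
  shows "emeasure \<mu> E < \<infinity>"
proof -
  obtain l where l: "0 < l" "E \<subseteq> cube 0 l" using bounded_subset_cube[OF assms] by blast
  have "emeasure \<mu> E \<le> emeasure \<mu> (cube 0 l)" by (intro emeasure_mono l) simp
  also have "\<dots> \<le> ennreal (G * l powr n)" by (rule cube_growth) fact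
  finally show ?thesis by (simp add: le_less_trans)
qed

lemma emeasure_cube_finite: "emeasure \<mu> (cube x l) < \<infinity>"
  by (intro emeasure_bounded_finite compact_imp_bounded compact_cube)

lemma emeasure_cube_eq: "emeasure \<mu> (cube x l) = ennreal (measure \<mu> (cube x l))"
  using emeasure_cube_finite[of x l] by (intro emeasure_eq_ennreal_measure) auto

lemma measure_cube_le: "0 < l \<Longrightarrow> measure \<mu> (cube x l) \<le> G * l powr n"
  using cube_growth[of l x] G_pos by (simp add: emeasure_cube_eq ennreal_le_iff)

text \<open>The growth exponent is positive, so small cubes around a point have arbitrarily small
  mass. Later this makes harmless the corner of a half-open dyadic cube that its open circumscribed
  ball misses.\<close>

lemma emeasure_singleton: "emeasure \<mu> {x} = 0"
proof -
  have "emeasure \<mu> {x} \<le> ennreal e" if "e > 0" for e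
  proof -
    define l where "l = (e / G) powr (1 / n)"
    have l: "l > 0" "G * l powr n = e"
      using that G_pos n_pos by (auto simp: l_def powr_powr)
    have "emeasure \<mu> {x} \<le> emeasure \<mu> (cube x l)"
      using l(1) by (intro emeasure_mono) (auto simp: mem_cube infnorm_0)
    then show ?thesis using cube_growth[OF l(1), of x] l(2) by (auto intro: order_trans)
  qed
  from this[of "measure \<mu> {x} / 2"] show ?thesis
    using emeasure_bounded_finite[of "{x}"] zero_less_measure_iff[of \<mu> "{x}"]
    by (cases "emeasure \<mu> {x}") (auto simp: measure_def ennreal_le_iff split: if_splits)
qed

text \<open>Splitting into 2^(jd) cubes of side l/2^j bounds the mass by G l^n 2^(j(d-n)), which
  would tend to 0 if n > d. It lets assumptions on a^d control a^n, the ratio that governs chains of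
  scales.\<close>

lemma growth_exponent_le_dim:
  assumes "0 < emeasure \<mu> (cube x l)" "0 < l"
  shows "n \<le> CARD('d)"
proof (rule ccontr)
  assume nd: "\<not> n \<le> CARD('d)"
  have bound: "measure \<mu> (cube x l) \<le> G * l powr n * (2 powr (CARD('d) - n)) ^ j" for j :: nat
  proof -
    obtain Y where Y: "finite Y" "card Y \<le> (2 ^ j) ^ CARD('d)"
      "cube x l \<subseteq> (\<Union>y\<in>Y. cube y (l / 2 ^ j))" using cube_subdivision[of j x l] by blast
    have "emeasure \<mu> (cube x l) \<le> emeasure \<mu> (\<Union>y\<in>Y. cube y (l / 2 ^ j))"
      by (intro emeasure_mono Y) (use Y in auto)
    also have "\<dots> \<le> (\<Sum>y\<in>Y. emeasure \<mu> (cube y (l / 2 ^ j)))"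
      by (intro emeasure_subadditive_finite Y) auto
    also have "\<dots> \<le> (\<Sum>y\<in>Y. ennreal (G * (l / 2 ^ j) powr n))"
      by (intro sum_mono cube_growth) (use assms in auto)
    also have "\<dots> = ennreal (card Y * (G * (l / 2 ^ j) powr n))"
      using G_pos by (simp add: ennreal_mult ennreal_of_nat_eq_real_of_nat)
    also have "\<dots> \<le> ennreal ((2 ^ j) ^ CARD('d) * (G * (l / 2 ^ j) powr n))"
      using Y(2) G_pos of_nat_mono[OF Y(2), where 'a = real] by (intro ennreal_leI mult_right_mono) auto
    also have "(2 ^ j) ^ CARD('d) * (G * (l / 2 ^ j) powr n)
        = G * l powr n * (2 powr (CARD('d) - n)) ^ j"
    proof -
      have "(2 ^ j) ^ CARD('d) = (2::real) powr (j * CARD('d))"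
        by (simp add: powr_realpow flip: power_mult of_nat_mult)
      moreover have "(l / 2 ^ j) powr n = l powr n / 2 powr (j * n)"
        using assms by (simp add: powr_divide powr_powr flip: powr_realpow)
      moreover have "(2 powr (CARD('d) - n)) ^ j = (2::real) powr (j * CARD('d)) / 2 powr (j * n)"
        by (simp add: powr_power powr_diff[symmetric] algebra_simps)
      ultimately show ?thesis by simp
    qed
    finally show ?thesis using G_pos by (simp add: emeasure_cube_eq ennreal_le_iff)
  qed
  have "(\<lambda>j. G * l powr n * (2 powr (CARD('d) - n)) ^ j) \<longlonglongrightarrow> G * l powr n * 0"
    using nd by (intro tendsto_mult tendsto_const LIMSEQ_power_zero)
      (simp add: powr_less_one)
  then have "measure \<mu> (cube x l) \<le> 0"
    using bound by (intro LIMSEQ_le_const) auto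
  then show False using assms(1) by (simp add: emeasure_cube_eq ennreal_eq_0_iff)
qed

section \<open>Riesz masses\<close>

text \<open>As a measure with a density, the Riesz mass inherits monotonicity and
  subadditivity.\<close>

lemma riesz_mass_density:
  assumes "E \<in> sets borel"
  shows "riesz_mass n \<mu> z E = emeasure (density \<mu> (\<lambda>y. ennreal (1 / dist z y powr n))) E"
  using assms unfolding riesz_mass_def by (subst emeasure_density) auto

lemma riesz_mass_mono:
  assumes "E \<subseteq> F" "F \<in> sets borel" "E \<in> sets borel"
  shows "riesz_mass n \<mu> z E \<le> riesz_mass n \<mu> z F"
  using assms by (auto simp: riesz_mass_density intro!: emeasure_mono)

lemma riesz_mass_Un:
  assumes "E \<subseteq> A \<union> B" "A \<in> sets borel" "B \<in> sets borel" "E \<in> sets borel"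
  shows "riesz_mass n \<mu> z E \<le> riesz_mass n \<mu> z A + riesz_mass n \<mu> z B"
proof -
  have "riesz_mass n \<mu> z E \<le> riesz_mass n \<mu> z (A \<union> B)"
    using assms by (intro riesz_mass_mono) auto
  also have "\<dots> \<le> riesz_mass n \<mu> z A + riesz_mass n \<mu> z B"
    using assms by (auto simp: riesz_mass_density intro!: emeasure_subadditive)
  finally show ?thesis .
qed

lemma riesz_mass_le_emeasure:
  assumes "E \<subseteq> A" "A \<in> sets borel" "0 < \<rho>" "\<And>w. w \<in> E \<Longrightarrow> \<rho> \<le> dist z w"
  shows "riesz_mass n \<mu> z E \<le> ennreal (1 / \<rho> powr n) * emeasure \<mu> A"
proof -
  have "riesz_mass n \<mu> z E \<le> (\<integral>\<^sup>+ y. ennreal (1 / \<rho> powr n) * indicator A y \<partial>\<mu>)"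
    unfolding riesz_mass_def
  proof (intro nn_integral_mono)
    fix y
    show "ennreal (1 / dist z y powr n) * indicator E y \<le> ennreal (1 / \<rho> powr n) * indicator A y"
    proof (cases "y \<in> E")
      case True
      then have "\<rho> powr n \<le> dist z y powr n"
        using assms(3,4) n_pos by (intro powr_mono2) auto
      then have "1 / dist z y powr n \<le> 1 / \<rho> powr n"
        using assms(3) by (intro divide_left_mono) (auto simp: zero_less_mult_iff intro: less_le_trans)
      then show ?thesis using True assms(1) by (auto simp: ennreal_leI)
    qed simp
  qed
  also have "\<dots> = ennreal (1 / \<rho> powr n) * emeasure \<mu> A"
    using assms(2) by (simp add: nn_integral_cmult_indicator)
  finally show ?thesis .
qed

lemma riesz_mass_le_cube:
  assumes "E \<subseteq> cube y l" "0 < l" "0 < \<rho>" "\<And>w. w \<in> E \<Longrightarrow> \<rho> \<le> dist z w"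
  shows "riesz_mass n \<mu> z E \<le> ennreal (G * (l / \<rho>) powr n)"
proof -
  have "riesz_mass n \<mu> z E \<le> ennreal (1 / \<rho> powr n) * emeasure \<mu> (cube y l)"
    using assms by (intro riesz_mass_le_emeasure) auto
  also have "\<dots> \<le> ennreal (1 / \<rho> powr n) * ennreal (G * l powr n)"
    by (intro mult_left_mono cube_growth assms) auto
  also have "\<dots> = ennreal (G * (l / \<rho>) powr n)"
    using assms G_pos by (simp add: powr_divide field_simps flip: ennreal_mult)
  finally show ?thesis .
qed

text \<open>The kernel has the value 0 at its own pole, because 1 / 0 = 0. The first condition on
  \<open>E\<close> therefore keeps \<open>x\<close> out of \<open>E\<close>: there the right-hand
  kernel would vanish while the left-hand one need not.\<close>

lemma riesz_mass_center_change:
  assumes "E \<in> sets borel" "0 < K" "\<And>w. w \<in> E \<Longrightarrow> 0 < dist x w" "\<And>w. w \<in> E \<Longrightarrow> dist x w \<le> K * dist z w"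
  shows "riesz_mass n \<mu> z E \<le> ennreal (K powr n) * riesz_mass n \<mu> x E"
proof -
  have "riesz_mass n \<mu> z E \<le>
      (\<integral>\<^sup>+ y. ennreal (K powr n) * (ennreal (1 / dist x y powr n) * indicator E y) \<partial>\<mu>)"
    unfolding riesz_mass_def
  proof (intro nn_integral_mono)
    fix y
    show "ennreal (1 / dist z y powr n) * indicator E y
        \<le> ennreal (K powr n) * (ennreal (1 / dist x y powr n) * indicator E y)"
    proof (cases "y \<in> E")
      case True
      have d: "0 < dist x y" "dist x y \<le> K * dist z y" using assms True by auto
      then have z: "0 < dist z y" using assms(2) zero_less_mult_pos[of K "dist z y"] by linarith
      have "dist x y powr n \<le> (K * dist z y) powr n" using d n_pos by (intro powr_mono2) auto
      then have "dist x y powr n \<le> K powr n * dist z y powr n"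
        using assms(2) by (simp add: powr_mult)
      then have "1 / dist z y powr n \<le> K powr n * (1 / dist x y powr n)"
        using d z by (simp add: field_simps)
      then show ?thesis using True by (auto simp: ennreal_leI simp flip: ennreal_mult)
    qed simp
  qed
  also have "\<dots> = ennreal (K powr n) * riesz_mass n \<mu> x E"
    unfolding riesz_mass_def using assms(1) by (subst nn_integral_cmult) auto
  finally show ?thesis .
qed

text \<open>The pole \<open>z\<close> may differ from the center \<open>y\<close>;
  \<open>\<eta>\<close> records how far distances to \<open>z\<close> can fall below those to
  \<open>y\<close>. Growth is asked for only between the sides t m and t^k m: the innermost annulus
  is charged with the mass at the next scale, and the outermost one with the growth bound alone. So
  the smallest cube may be doubling, and so may the one of side t^k m.\<close>

lemma riesz_mass_chain:
  assumes t: "1 < t" "t powr n < B" and m: "0 < m" and \<eta>: "0 < \<eta>"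
    and E: "E \<in> sets borel" "E \<subseteq> cube y (t ^ (k + 1) * m) - cube y m"
    and dist: "\<And>w. w \<in> E \<Longrightarrow> \<eta> * infnorm (w - y) \<le> dist z w"
    and grow: "\<And>i. 1 \<le> i \<Longrightarrow> i < k \<Longrightarrow>
      ennreal B * emeasure \<mu> (cube y (t ^ i * m)) \<le> emeasure \<mu> (cube y (t ^ (i + 1) * m))"
  shows "riesz_mass n \<mu> z E \<le> ennreal (chain_const n G \<eta> t B)"
proof -
  define u where "u i = measure \<mu> (cube y (t ^ i * m))" for i
  define q where "q = t powr n / B"
  define c where "c = (2 / \<eta>) powr n * (G * t powr n)"
  have B: "0 < B" using t by (smt (verit) powr_ge_zero)
  have q: "0 < q" "q < 1" using t B by (auto simp: q_def)
  have c: "0 \<le> c" using G_pos by (simp add: c_def)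
  have growu: "B * u i \<le> u (i + 1)" if "1 \<le> i" "i < k" for i
    using grow[OF that] B unfolding u_def
    by (simp add: emeasure_cube_eq measure_nonneg flip: ennreal_mult)
  have up: "B ^ j * u i \<le> u (i + j)" if "1 \<le> i" "i + j \<le> k" for i j
    using that
  proof (induction j)
    case (Suc j)
    have "B ^ Suc j * u i = B * (B ^ j * u i)" by simp
    also have "\<dots> \<le> B * u (i + j)" using Suc B by (intro mult_left_mono) auto
    also have "\<dots> \<le> u (i + Suc j)" using growu[of "i + j"] Suc by simp
    finally show ?case .
  qed simp
  define P where "P i = E \<inter> (cube y (t ^ (i + 1) * m) - cube y (t ^ i * m))" for i
  have P[measurable]: "P i \<in> sets borel" for i using E(1) by (simp add: P_def)
  have cover: "E \<subseteq> (\<Union>i\<le>k. P i)"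
  proof
    fix w assume w: "w \<in> E"
    define i where "i = (LEAST i. w \<in> cube y (t ^ (i + 1) * m))"
    have wk: "w \<in> cube y (t ^ (k + 1) * m)" and w0: "w \<notin> cube y m" using w E by auto
    have "w \<in> cube y (t ^ (i + 1) * m)" unfolding i_def by (rule LeastI) (rule wk)
    moreover have "i \<le> k" unfolding i_def by (rule Least_le) (rule wk)
    moreover have "w \<notin> cube y (t ^ i * m)"
    proof (cases i)
      case (Suc i')
      then show ?thesis using not_less_Least[of i' "\<lambda>i. w \<in> cube y (t ^ (i + 1) * m)"]
        unfolding i_def[symmetric] by simp
    qed (use w0 in simp)
    ultimately show "w \<in> (\<Union>i\<le>k. P i)" using w by (auto simp: P_def)
  qed
  have piece: "riesz_mass n \<mu> z (P i) \<le> ennreal ((2 / \<eta>) powr n / (t ^ i * m) powr n * u (i + 1))" for i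
  proof -
    have "riesz_mass n \<mu> z (P i)
        \<le> ennreal (1 / (\<eta> * (t ^ i * m) / 2) powr n) * emeasure \<mu> (cube y (t ^ (i + 1) * m))"
    proof (rule riesz_mass_le_emeasure)
      fix w assume w: "w \<in> P i"
      then have "t ^ i * m / 2 < infnorm (w - y)" by (simp add: P_def mem_cube)
      then have "\<eta> * (t ^ i * m / 2) \<le> \<eta> * infnorm (w - y)" using \<eta> by simp
      then show "\<eta> * (t ^ i * m) / 2 \<le> dist z w" using dist[of w] w by (simp add: P_def)
    qed (use \<eta> m t in \<open>auto simp: P_def\<close>)
    also have "\<dots> = ennreal (1 / (\<eta> * (t ^ i * m) / 2) powr n * u (i + 1))"
      unfolding emeasure_cube_eq u_def by (rule ennreal_mult[symmetric]) auto
    also have "1 / (\<eta> * (t ^ i * m) / 2) powr n = (2 / \<eta>) powr n / (t ^ i * m) powr n"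
      using \<eta> m t by (simp add: powr_divide powr_mult field_simps)
    finally show ?thesis .
  qed
  have uG: "u i \<le> G * (t ^ i * m) powr n" for i
    unfolding u_def by (intro measure_cube_le) (use m t in auto)
  have tm: "(t ^ (i + j) * m) powr n = (t powr n) ^ j * (t ^ i * m) powr n" for i j
    using t m by (simp add: powr_mult powr_power power_add powr_realpow[symmetric] powr_powr powr_add mult.commute)
  have bound: "(2 / \<eta>) powr n / (t ^ i * m) powr n * u (i + 1) \<le> c * (if i = k then 1 else q ^ (k - i - 1))"
    if "i \<le> k" for i
  proof (cases "i = k")
    case True
    have "(2 / \<eta>) powr n / (t ^ i * m) powr n * u (i + 1)
        \<le> (2 / \<eta>) powr n / (t ^ i * m) powr n * (G * (t ^ (i + 1) * m) powr n)"
      by (intro mult_left_mono uG) auto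
    also have "\<dots> = c" unfolding tm[of i 1] c_def using t m by simp
    finally show ?thesis using True by simp
  next
    case False
    define j where "j = k - i - 1"
    have k: "k = i + 1 + j" using False that by (simp add: j_def)
    \<comment> \<open>The mass at scale i + 1 is at most B^(-j) times the mass at scale k, which the
      growth bound controls. Division by (t^i m)^n leaves the geometric term q^j.\<close>
    have "B ^ j * u (i + 1) \<le> u k" using up[of "i + 1" j] k by simp
    also have "\<dots> \<le> G * (t ^ k * m) powr n" by (rule uG)
    finally have "u (i + 1) \<le> G * (t ^ k * m) powr n / B ^ j" using B by (simp add: field_simps)
    then have "(2 / \<eta>) powr n / (t ^ i * m) powr n * u (i + 1)
        \<le> (2 / \<eta>) powr n / (t ^ i * m) powr n * (G * (t ^ k * m) powr n / B ^ j)"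
      by (intro mult_left_mono) auto
    also have "(t ^ k * m) powr n = (t powr n) ^ (1 + j) * (t ^ i * m) powr n"
      using tm[of i "1 + j"] k by (simp add: add.assoc)
    also have "(2 / \<eta>) powr n / (t ^ i * m) powr n * (G * ((t powr n) ^ (1 + j) * (t ^ i * m) powr n) / B ^ j)
        = c * q ^ j"
      unfolding c_def q_def using t m by (simp add: power_divide)
    finally show ?thesis using False by (simp add: j_def)
  qed
  have geo: "(\<Sum>j<k. q ^ j) \<le> 1 / (1 - q)"
    using q by (subst sum_gp_strict) (auto simp: divide_right_mono)
  have "(\<Sum>i\<le>k. if i = k then 1 else q ^ (k - i - 1)) = 1 + (\<Sum>i<k. q ^ (k - i - 1))"
    by (simp add: lessThan_Suc_atMost[symmetric])
  also have "(\<Sum>i<k. q ^ (k - i - 1)) = (\<Sum>j<k. q ^ j)"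
    by (subst sum.nat_diff_reindex[symmetric]) (simp add: diff_diff_add)
  finally have total: "(\<Sum>i\<le>k. if i = k then 1 else q ^ (k - i - 1)) \<le> 1 + 1 / (1 - q)"
    using geo by simp
  have "riesz_mass n \<mu> z E \<le> riesz_mass n \<mu> z (\<Union>i\<le>k. P i)"
    using cover E by (intro riesz_mass_mono) auto
  also have "\<dots> \<le> (\<Sum>i\<le>k. riesz_mass n \<mu> z (P i))"
    by (subst (1 2) riesz_mass_density) (auto intro!: emeasure_subadditive_finite)
  also have "\<dots> \<le> (\<Sum>i\<le>k. ennreal (c * (if i = k then 1 else q ^ (k - i - 1))))"
    by (intro sum_mono order_trans[OF piece] ennreal_leI bound) auto
  also have "\<dots> = ennreal (\<Sum>i\<le>k. c * (if i = k then 1 else q ^ (k - i - 1)))"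
    using c q by (intro sum_ennreal) auto
  also have "\<dots> \<le> ennreal (c * (1 + 1 / (1 - q)))"
    unfolding sum_distrib_left[symmetric] using total c by (intro ennreal_leI mult_left_mono)
  also have "c * (1 + 1 / (1 - q)) = chain_const n G \<eta> t B"
    by (simp add: chain_const_def c_def q_def)
  finally show ?thesis .
qed

end

text \<open>The ball bound is known only at almost every center. If the cube contains one good
  center, a ball around it contains the cube; the factor 2 in its radius makes up for the ball being
  open. If it contains none, the cube is null.\<close>

lemma poly_growth_imp_growth_measure:
  fixes \<mu> :: "(real ^ 'd::finite) measure"
  assumes "poly_growth n C \<mu>" "0 < n" "0 < C"
  shows "growth_measure \<mu> n (C * (2 * sqrt CARD('d)) powr n)"
proof
  show "sets \<mu> = sets borel" using assms by (simp add: poly_growth_def radon_measure_def)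
  show "0 < C * (2 * sqrt CARD('d)) powr n" using assms by simp
next
  fix x :: "real ^ 'd" and l :: real
  assume l: "0 < l"
  have AE: "AE x in \<mu>. \<forall>r>0. emeasure \<mu> (ball x r) \<le> ennreal (C * r powr n)"
    using assms by (simp add: poly_growth_def)
  have sets[measurable_cong]: "sets \<mu> = sets borel"
    using assms by (simp add: poly_growth_def radon_measure_def)
  show "emeasure \<mu> (cube x l) \<le> ennreal (C * (2 * sqrt CARD('d)) powr n * l powr n)"
  proof (cases "\<exists>y\<in>cube x l. \<forall>r>0. emeasure \<mu> (ball y r) \<le> ennreal (C * r powr n)")
    case True
    then obtain y where y: "y \<in> cube x l" "\<And>r. r > 0 \<Longrightarrow> emeasure \<mu> (ball y r) \<le> ennreal (C * r powr n)"
      by blast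
    define r where "r = 2 * sqrt CARD('d) * l"
    have r: "r > 0" using l by (simp add: r_def)
    have "cube x l \<subseteq> ball y r"
    proof
      fix w assume w: "w \<in> cube x l"
      have "infnorm (w - y) \<le> l"
        using w y(1) infnorm_diff_triangle[of w y x] by (simp add: mem_cube infnorm_sub[of x y])
      then have "sqrt CARD('d) * infnorm (w - y) \<le> sqrt CARD('d) * l" by (intro mult_left_mono) auto
      then have "dist w y \<le> sqrt CARD('d) * l" using dist_le_infnorm[of w y] by linarith
      also have "\<dots> < r" using l by (simp add: r_def)
      finally show "w \<in> ball y r" by (simp add: dist_commute)
    qed
    then have "emeasure \<mu> (cube x l) \<le> emeasure \<mu> (ball y r)" by (intro emeasure_mono) (auto simp: sets)
    also have "\<dots> \<le> ennreal (C * r powr n)" by (rule y(2)) fact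
    also have "C * r powr n = C * (2 * sqrt CARD('d)) powr n * l powr n"
      using l by (simp add: r_def powr_mult)
    finally show ?thesis .
  next
    case False
    then have "AE y in \<mu>. y \<notin> cube x l" using AE by (auto elim!: eventually_mono)
    then have "emeasure \<mu> (cube x l) = 0"
      by (subst (asm) AE_iff_measurable[OF _ refl]) (auto simp: sets_eq_imp_space_eq[OF sets])
    then show ?thesis by simp
  qed
qed (use assms in auto)

section \<open>Doubling cubes\<close>

context growth_measure
begin

lemma power_lt_imp_powr_lt:
  assumes "1 < a" "a ^ CARD('d) < b" "0 < emeasure \<mu> (cube x l)" "0 < l"
  shows "a powr n < b"
proof -
  have "a powr n \<le> a powr CARD('d)"
    using assms growth_exponent_le_dim[OF assms(3,4)] by (intro powr_mono) auto
  then show ?thesis using assms by (simp add: powr_realpow)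
qed

text \<open>If every dilation by \<open>t\<close> multiplied the mass by more than \<open>B\<close>,
  the growth bound would make the initial mass at most a multiple of (t^n/B)^k for all k, hence 0.
  Taking the first doubling dilate also records that all earlier ones are non-doubling, as
  \<open>riesz_mass_chain\<close> requires.\<close>

lemma ex_doubling_cube_above:
  assumes t: "1 < t" "t powr n < B" and m: "0 < m" and pos: "0 < emeasure \<mu> (cube y m)"
  obtains k where "doubling_cube \<mu> t B y (t ^ k * m)"
    "\<And>i. i < k \<Longrightarrow> ennreal B * emeasure \<mu> (cube y (t ^ i * m)) \<le> emeasure \<mu> (cube y (t ^ (i + 1) * m))"
proof -
  define u where "u i = measure \<mu> (cube y (t ^ i * m))" for i
  have B: "0 < B" using t by (smt (verit) powr_ge_zero)
  have u0: "0 < u 0" using pos by (simp add: u_def emeasure_cube_eq)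
  have "\<exists>k. u (k + 1) \<le> B * u k"
  proof (rule ccontr)
    assume "\<nexists>k. u (k + 1) \<le> B * u k"
    then have grow: "B * u k \<le> u (k + 1)" for k by (simp add: not_le less_imp_le)
    have up: "B ^ k * u 0 \<le> u k" for k
    proof (induction k)
      case (Suc k)
      have "B ^ Suc k * u 0 = B * (B ^ k * u 0)" by simp
      also have "\<dots> \<le> B * u k" using Suc B by (intro mult_left_mono) auto
      finally show ?case using grow[of k] by simp
    qed simp
    have "u 0 \<le> G * m powr n * (t powr n / B) ^ k" for k
    proof -
      have "B ^ k * u 0 \<le> G * (t ^ k * m) powr n"
        using up[of k] measure_cube_le[of "t ^ k * m" y] m t by (simp add: u_def)
      also have "(t ^ k * m) powr n = (t powr n) ^ k * m powr n"
        using m t by (simp add: powr_mult powr_power powr_realpow[symmetric] powr_powr mult.commute)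
      finally show ?thesis using B by (simp add: power_divide field_simps)
    qed
    moreover have "(\<lambda>k. G * m powr n * (t powr n / B) ^ k) \<longlonglongrightarrow> G * m powr n * 0"
      using t B by (intro tendsto_mult tendsto_const LIMSEQ_power_zero) simp
    ultimately have "u 0 \<le> G * m powr n * 0" by (intro LIMSEQ_le_const) auto
    then show False using u0 by simp
  qed
  define k where "k = (LEAST k. u (k + 1) \<le> B * u k)"
  have k: "u (k + 1) \<le> B * u k"
    unfolding k_def by (rule LeastI_ex) fact
  have k': "\<not> u (i + 1) \<le> B * u i" if "i < k" for i
    using not_less_Least[OF that[unfolded k_def]] by simp
  have posk: "0 < emeasure \<mu> (cube y (t ^ k * m))"
    using pos m t by (intro less_le_trans[OF pos] emeasure_mono cube_mono) auto
  show thesis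
  proof (rule that)
    show "doubling_cube \<mu> t B y (t ^ k * m)"
      using k posk m t B unfolding doubling_cube_def doubling_def u_def
      by (simp add: emeasure_cube_eq mult.assoc flip: ennreal_mult)
    show "ennreal B * emeasure \<mu> (cube y (t ^ i * m)) \<le> emeasure \<mu> (cube y (t ^ (i + 1) * m))"
      if "i < k" for i
      using k'[OF that] B unfolding u_def
      by (simp add: emeasure_cube_eq flip: ennreal_mult)
  qed
qed

lemma emeasure_cube_pos:
  assumes "x \<in> msupp \<mu>" "0 < l"
  shows "0 < emeasure \<mu> (cube x l)"
proof -
  have "0 < emeasure \<mu> (ball x (l / 2))" using assms by (simp add: msupp_def)
  also have "\<dots> \<le> emeasure \<mu> (cube x l)"
    using ball_subset_cube[of x "l / 2"] by (intro emeasure_mono) auto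
  finally show ?thesis .
qed

text \<open>At a point without small doubling cubes the mass of the cube of side l0/a^k decays like
  b^(-k), while a bounded region is covered by a multiple of a^(kd) cubes of that size. The bad
  points thus have mass at most a multiple of (a^d/b)^k, which is why \<open>b\<close> is compared
  with a^d.\<close>

lemma AE_ex_doubling_cube_below:
  assumes a: "1 < a" "a ^ CARD('d) < b" and l0: "0 < l0" and supp: "AE x in \<mu>. x \<in> msupp \<mu>"
  shows "AE x in \<mu>. \<exists>k. doubling_cube \<mu> a b x (l0 / a ^ k)"
proof -
  define bad where "bad = {x \<in> msupp \<mu>. \<forall>k. \<not> doubling_cube \<mu> a b x (l0 / a ^ k)}"
  have b: "0 < b" using a by (smt (verit) zero_less_power)
  have small: "measure \<mu> (cube x (l0 / a ^ k)) \<le> G * l0 powr n / b ^ k" if "x \<in> bad" for x k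
  proof -
    have step: "b * measure \<mu> (cube x (l0 / a ^ Suc k)) \<le> measure \<mu> (cube x (l0 / a ^ k))" for k
    proof -
      have x: "x \<in> msupp \<mu>" using that by (simp add: bad_def)
      have "0 < emeasure \<mu> (cube x (l0 / a ^ Suc k))" using a l0 x by (intro emeasure_cube_pos) auto
      moreover have "\<not> doubling_cube \<mu> a b x (l0 / a ^ Suc k)" using that unfolding bad_def by blast
      moreover have "a * (l0 / a ^ Suc k) = l0 / a ^ k" using a by simp
      ultimately have "\<not> emeasure \<mu> (cube x (l0 / a ^ k)) \<le> ennreal b * emeasure \<mu> (cube x (l0 / a ^ Suc k))"
        using a l0 unfolding doubling_cube_def doubling_def by auto
      then show ?thesis using b by (simp add: emeasure_cube_eq flip: ennreal_mult)
    qed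
    have "b ^ k * measure \<mu> (cube x (l0 / a ^ k)) \<le> measure \<mu> (cube x l0)"
    proof (induction k)
      case (Suc k)
      have "b ^ Suc k * measure \<mu> (cube x (l0 / a ^ Suc k))
          = b ^ k * (b * measure \<mu> (cube x (l0 / a ^ Suc k)))" by simp
      also have "\<dots> \<le> b ^ k * measure \<mu> (cube x (l0 / a ^ k))"
        using step b by (intro mult_left_mono) auto
      finally show ?case using Suc by simp
    qed simp
    then show ?thesis using measure_cube_le[OF l0, of x] b by (simp add: field_simps)
  qed
  have null: "AE x in \<mu>. x \<notin> bad \<inter> cube 0 N" if N: "0 < N" for N :: real
  proof -
    \<comment> \<open>Chosen so that c a^k = 2 rho + a^k for the \<open>\<rho>\<close> below, which
      dominates 2 max(1, rho) as a^k is at least 1.\<close>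
    define c where "c = 4 * N / l0 + 1"
    define \<epsilon> where "\<epsilon> k = (2 * c) ^ CARD('d) * (G * l0 powr n) * (a ^ CARD('d) / b) ^ k" for k :: nat
    have "\<exists>U\<in>sets borel. bad \<inter> cube 0 N \<subseteq> U \<and> emeasure \<mu> U \<le> ennreal (\<epsilon> k)" for k
    proof -
      \<comment> \<open>Since 2^j is at least \<open>\<rho>\<close>, the pieces have side at most
        half of l0/a^k. A piece that meets \<open>bad\<close> then lies in the cube of side l0/a^k
        around the bad point it contains, and that cube has small mass.\<close>
      define \<rho> where "\<rho> = 2 * N * a ^ k / l0"
      define j where "j = nat \<lceil>log 2 (max 1 \<rho>)\<rceil>"
      have \<rho>: "0 < \<rho>" using N a l0 by (simp add: \<rho>_def)
      have lg: "log 2 (max 1 \<rho>) \<le> j" "j < log 2 (max 1 \<rho>) + 1"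
        unfolding j_def using zero_le_log_cancel_iff[of 2 "max 1 \<rho>"] by linarith+
      have "max 1 \<rho> \<le> 2 powr real j" using lg(1) by (subst (asm) log_le_iff) auto
      moreover have "2 powr (real j - 1) \<le> max 1 \<rho>" using lg(2) by (subst powr_le_iff) auto
      ultimately have j: "max 1 \<rho> \<le> 2 ^ j" "2 ^ j \<le> 2 * max 1 \<rho>"
        by (simp_all add: powr_diff powr_realpow)
      obtain Y where Y: "finite Y" "card Y \<le> (2 ^ j) ^ CARD('d)"
        "cube 0 N \<subseteq> (\<Union>y\<in>Y. cube (y :: real ^ 'd) (N / 2 ^ j))"
        using cube_subdivision[of j 0 N] by blast
      define Z where "Z = {y \<in> Y. cube y (N / 2 ^ j) \<inter> bad \<noteq> {}}"
      have Z: "finite Z" "card Z \<le> card Y" using Y by (auto simp: Z_def intro: card_mono)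
      have "real (card Z) \<le> (2 ^ j) ^ CARD('d)"
        using Z(2) Y(2) of_nat_mono[where 'a = real, of "card Z" "(2 ^ j) ^ CARD('d)"] by simp
      also have "\<dots> \<le> (2 * c * a ^ k) ^ CARD('d)"
      proof (rule power_mono)
        have "1 \<le> a ^ k" using a by simp
        moreover have "c * a ^ k = 2 * \<rho> + a ^ k" by (simp add: c_def \<rho>_def field_simps)
        ultimately have "2 * max 1 \<rho> \<le> 2 * c * a ^ k" using \<rho> by (simp add: max_def)
        then show "2 ^ j \<le> 2 * c * a ^ k" using j by linarith
      qed simp
      finally have cardZ: "real (card Z) \<le> (2 * c * a ^ k) ^ CARD('d)" .
      have meas: "emeasure \<mu> (cube y (N / 2 ^ j)) \<le> ennreal (G * l0 powr n / b ^ k)" if y: "y \<in> Z" for y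
      proof -
        obtain x where x: "x \<in> cube y (N / 2 ^ j)" "x \<in> bad" using y unfolding Z_def by blast
        have "2 * N * a ^ k / l0 \<le> 2 ^ j" using j by (simp add: \<rho>_def)
        then have "N / 2 ^ j \<le> l0 / a ^ k / 2" using a l0 by (simp add: field_simps)
        then have "cube y (N / 2 ^ j) \<subseteq> cube x (l0 / a ^ k)"
          using x(1) by (intro cube_subset) (simp add: mem_cube infnorm_sub[of x y])
        then have "emeasure \<mu> (cube y (N / 2 ^ j)) \<le> emeasure \<mu> (cube x (l0 / a ^ k))"
          by (intro emeasure_mono) auto
        also have "\<dots> \<le> ennreal (G * l0 powr n / b ^ k)"
          using small[OF x(2), of k] by (simp add: emeasure_cube_eq ennreal_leI)
        finally show ?thesis .
      qed
      define U where "U = (\<Union>y\<in>Z. cube y (N / 2 ^ j))"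
      have "emeasure \<mu> U \<le> (\<Sum>y\<in>Z. emeasure \<mu> (cube y (N / 2 ^ j)))"
        unfolding U_def using Z by (intro emeasure_subadditive_finite) auto
      also have "\<dots> \<le> (\<Sum>y\<in>Z. ennreal (G * l0 powr n / b ^ k))" by (intro sum_mono meas)
      also have "\<dots> = ennreal (card Z * (G * l0 powr n / b ^ k))"
        using G_pos b by (simp add: ennreal_of_nat_eq_real_of_nat flip: ennreal_mult)
      also have "\<dots> \<le> ennreal ((2 * c * a ^ k) ^ CARD('d) * (G * l0 powr n / b ^ k))"
        using cardZ G_pos b by (intro ennreal_leI mult_right_mono) auto
      also have "(2 * c * a ^ k) ^ CARD('d) * (G * l0 powr n / b ^ k) = \<epsilon> k"
      proof -
        have "(a ^ k) ^ CARD('d) = (a ^ CARD('d)) ^ k" by (metis power_mult mult.commute)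
        then show ?thesis unfolding \<epsilon>_def power_mult_distrib[of "2 * c"] power_divide by simp
      qed
      finally have "emeasure \<mu> U \<le> ennreal (\<epsilon> k)" .
      moreover have "bad \<inter> cube 0 N \<subseteq> U" using Y(3) by (fastforce simp: U_def Z_def)
      moreover have "U \<in> sets borel" unfolding U_def using Z by (intro sets.finite_UN) auto
      ultimately show ?thesis by blast
    qed
    then obtain U where U: "\<And>k. U k \<in> sets borel" "\<And>k. bad \<inter> cube 0 N \<subseteq> U k"
      "\<And>k. emeasure \<mu> (U k) \<le> ennreal (\<epsilon> k)" by metis
    have "(\<lambda>k. ennreal (\<epsilon> k)) \<longlonglongrightarrow> ennreal ((2 * c) ^ CARD('d) * (G * l0 powr n) * 0)"
      unfolding \<epsilon>_def using a b
      by (intro tendsto_ennrealI tendsto_mult tendsto_const LIMSEQ_power_zero) simp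
    moreover have "emeasure \<mu> (\<Inter>k. U k) \<le> ennreal (\<epsilon> k)" for k
      using U by (intro order_trans[OF emeasure_mono U(3)]) auto
    ultimately have "emeasure \<mu> (\<Inter>k. U k) \<le> ennreal ((2 * c) ^ CARD('d) * (G * l0 powr n) * 0)"
      by (intro LIMSEQ_le_const) auto
    then have "emeasure \<mu> (\<Inter>k. U k) = 0" by simp
    then show ?thesis using U by (intro AE_I[of _ _ "\<Inter>k. U k"]) auto
  qed
  have "AE x in \<mu>. \<forall>N::nat. x \<notin> bad \<inter> cube 0 (Suc N)"
    using null by (subst AE_all_countable) auto
  then show ?thesis
    using supp
  proof eventually_elim
    case (elim x)
    obtain N where N: "2 * infnorm x \<le> real N" using real_arch_simple by blast
    then have "x \<in> cube 0 (Suc N)" by (simp add: mem_cube)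
    then show ?case using elim by (auto simp: bad_def)
  qed
qed

end

section \<open>Besicovitch coverings by cubes\<close>

lemma ex_maximal_separated:
  fixes A :: "(real ^ 'd::finite) set"
  assumes "0 \<le> r"
  shows "\<exists>X\<subseteq>A. (\<forall>x\<in>X. \<forall>y\<in>X. x \<noteq> y \<longrightarrow> r < infnorm (x - y)) \<and> (\<forall>y\<in>A. \<exists>x\<in>X. infnorm (y - x) \<le> r)"
proof -
  define P where "P = {X. X \<subseteq> A \<and> (\<forall>x\<in>X. \<forall>y\<in>X. x \<noteq> y \<longrightarrow> r < infnorm (x - y))}"
  have "\<exists>M\<in>P. \<forall>X\<in>P. M \<subseteq> X \<longrightarrow> X = M"
  proof (rule subset_Zorn_nonempty)
    show "P \<noteq> {}" by (auto simp: P_def)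
    fix C assume C: "C \<noteq> {}" "subset.chain P C"
    show "\<Union>C \<in> P"
      unfolding P_def
    proof (safe)
      fix x X assume "x \<in> X" "X \<in> C"
      then show "x \<in> A" using C by (auto simp: subset.chain_def P_def)
    next
      fix x X y Y assume xy: "x \<in> X" "X \<in> C" "y \<in> Y" "Y \<in> C" "x \<noteq> y"
      then have "X \<subseteq> Y \<or> Y \<subseteq> X" using C by (meson subset_chain_def)
      moreover have "X \<in> P" "Y \<in> P" using xy C by (auto simp: subset_chain_def)
      ultimately show "r < infnorm (x - y)" using xy unfolding P_def by blast
    qed
  qed
  then obtain M where M: "M \<in> P" "\<And>X. X \<in> P \<Longrightarrow> M \<subseteq> X \<Longrightarrow> X = M" by blast
  have "\<exists>x\<in>M. infnorm (y - x) \<le> r" if y: "y \<in> A" for y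
  proof (rule ccontr)
    assume no: "\<not> (\<exists>x\<in>M. infnorm (y - x) \<le> r)"
    then have "insert y M \<in> P"
      using M(1) y by (auto simp: P_def not_le infnorm_sub[of _ y])
    then have "y \<in> M" using M(2)[of "insert y M"] by blast
    then show False using no assms by (auto simp: infnorm_0)
  qed
  then show ?thesis using M(1) by (auto simp: P_def)
qed

text \<open>The sides are discrete, so the selection runs through them from the largest down. Each
  step keeps a maximal separated set of the centers not yet covered. Around a given point, two
  selected cubes cannot have their centers in the same orthant, whence the bound 2^d.\<close>

lemma besicovitch_cubes:
  fixes A :: "(real ^ 'd::finite) set" and \<kappa> :: "real ^ 'd \<Rightarrow> nat"
  assumes l0: "0 < l0" and a: "1 < a"
  defines "s x \<equiv> l0 / a ^ \<kappa> x"
  obtains X where "X \<subseteq> A" "countable X" "A \<subseteq> (\<Union>x\<in>X. cube x (s x))"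
    "\<And>y. finite {x \<in> X. y \<in> cube x (s x)} \<and> card {x \<in> X. y \<in> cube x (s x)} \<le> 2 ^ CARD('d)"
proof -
  define sep :: "(real ^ 'd) set \<Rightarrow> real \<Rightarrow> (real ^ 'd) set \<Rightarrow> bool" where
    "sep Z r X \<longleftrightarrow> X \<subseteq> Z \<and> (\<forall>x\<in>X. \<forall>y\<in>X. x \<noteq> y \<longrightarrow> r < infnorm (x - y)) \<and>
      (\<forall>y\<in>Z. \<exists>x\<in>X. infnorm (y - x) \<le> r)" for Z r X
  define M where "M Z r = (SOME X. sep Z r X)" for Z r
  have M: "sep Z r (M Z r)" if "0 \<le> r" for Z r
    unfolding M_def sep_def by (rule someI_ex) (use ex_maximal_separated[OF that, of Z] in blast)
  define V where "V U k = M {x \<in> A. \<kappa> x = k \<and> x \<notin> (\<Union>z\<in>U. cube z (s z))} (l0 / a ^ k / 2)" for U k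
  \<comment> \<open>\<open>U k\<close> collects the centers chosen at the sides with exponent less
    than k, that is, at the strictly larger sides.\<close>
  define U where "U = rec_nat {} (\<lambda>k U. U \<union> V U k)"
  have U_simps: "U 0 = {}" "U (Suc k) = U k \<union> V (U k) k" for k by (simp_all add: U_def)
  have V: "sep {x \<in> A. \<kappa> x = k \<and> x \<notin> (\<Union>z\<in>U k. cube z (s z))} (l0 / a ^ k / 2) (V (U k) k)" for k
    unfolding V_def using l0 a by (intro M) auto
  have U_mono: "U j \<subseteq> U k" if "j \<le> k" for j k
    using that by (induction rule: dec_induct) (auto simp: U_simps)
  have U_V: "\<exists>j<k. x \<in> V (U j) j" if "x \<in> U k" for x k
    using that by (induction k) (auto simp: U_simps less_Suc_eq)
  define X where "X = (\<Union>k. U k)"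
  have X_V: "x \<in> V (U (\<kappa> x)) (\<kappa> x)" if x: "x \<in> X" for x
  proof -
    obtain j where j: "x \<in> V (U j) j" using x U_V by (auto simp: X_def)
    then have "\<kappa> x = j" using V[of j] by (auto simp: sep_def)
    then show ?thesis using j by simp
  qed
  have X_sep: "s x / 2 < infnorm (z - x)" if "x \<in> X" "z \<in> X" "x \<noteq> z" "\<kappa> x \<le> \<kappa> z" for x z
  proof (cases "\<kappa> x = \<kappa> z")
    case True
    then show ?thesis
      using V[of "\<kappa> x"] X_V[OF that(1)] X_V[OF that(2)] that(3) unfolding sep_def s_def by auto
  next
    case False
    have "x \<in> U (Suc (\<kappa> x))" using X_V[OF that(1)] by (simp add: U_simps)
    then have "x \<in> U (\<kappa> z)" using U_mono[of "Suc (\<kappa> x)" "\<kappa> z"] False that(4) by auto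
    then have "z \<notin> cube x (s x)"
      using V[of "\<kappa> z"] X_V[OF that(2)] unfolding sep_def by auto
    then show ?thesis by (simp add: mem_cube not_le)
  qed
  have overlap: "finite {x \<in> X. y \<in> cube x (s x)} \<and> card {x \<in> X. y \<in> cube x (s x)} \<le> 2 ^ CARD('d)" for y
  proof -
    have s_mono: "s z \<le> s x" if "\<kappa> x \<le> \<kappa> z" for x z
      unfolding s_def using that a l0 by (intro divide_left_mono power_increasing) auto
    define \<phi> where "\<phi> x = {i. y $ i \<le> x $ i}" for x :: "real ^ 'd"
    \<comment> \<open>Two cubes containing \<open>y\<close> whose centers lie in the same orthant around \<open>y\<close>: the larger one
      contains the center of the smaller one.\<close>
    have close: "x = z" if "x \<in> X" "z \<in> X" "y \<in> cube x (s x)" "y \<in> cube z (s z)" "\<phi> x = \<phi> z" "\<kappa> x \<le> \<kappa> z" for x z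
    proof (rule ccontr)
      assume "x \<noteq> z"
      have "z \<in> cube x (s x)"
        unfolding cube_def
      proof safe
        fix i
        have "\<bar>y $ i - x $ i\<bar> \<le> s x / 2" "\<bar>y $ i - z $ i\<bar> \<le> s x / 2"
          using that(3,4) s_mono[OF that(6)] by (auto simp: cube_def intro: order_trans)
        moreover have "y $ i \<le> x $ i \<longleftrightarrow> y $ i \<le> z $ i" using that(5) unfolding \<phi>_def by auto
        ultimately show "\<bar>z $ i - x $ i\<bar> \<le> s x / 2" by linarith
      qed
      then show False using X_sep[of x z] that \<open>x \<noteq> z\<close> by (simp add: mem_cube)
    qed
    have inj: "inj_on \<phi> {x \<in> X. y \<in> cube x (s x)}"
    proof (rule inj_onI)
      fix x z assume "x \<in> {x \<in> X. y \<in> cube x (s x)}" "z \<in> {x \<in> X. y \<in> cube x (s x)}" "\<phi> x = \<phi> z"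
      then show "x = z" using close[of x z] close[of z x] by (cases "\<kappa> x \<le> \<kappa> z") auto
    qed
    have "card {x \<in> X. y \<in> cube x (s x)} \<le> card (UNIV :: 'd set set)"
      using inj by (rule card_inj_on_le) auto
    also have "\<dots> = 2 ^ CARD('d)" by (simp add: card_Pow flip: Pow_UNIV)
    finally show ?thesis using inj_on_finite[OF inj, of UNIV] by auto
  qed
  \<comment> \<open>Every chosen cube contains a point of a countable dense set, and each such point
    lies in finitely many chosen cubes.\<close>
  have "countable X"
  proof -
    obtain D :: "(real ^ 'd) set" where D: "countable D" "\<And>Y. open Y \<Longrightarrow> Y \<noteq> {} \<Longrightarrow> \<exists>d\<in>D. d \<in> Y"
      using countable_dense_setE by blast
    have "X \<subseteq> (\<Union>q\<in>D. {x \<in> X. q \<in> cube x (s x)})"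
    proof
      fix x assume x: "x \<in> X"
      have "0 < s x" using l0 a by (simp add: s_def)
      then obtain q where "q \<in> D" "q \<in> ball x (s x / 2)" using D(2)[of "ball x (s x / 2)"] by auto
      then show "x \<in> (\<Union>q\<in>D. {x \<in> X. q \<in> cube x (s x)})"
        using x ball_subset_cube[of x "s x / 2"] by auto
    qed
    moreover have "countable (\<Union>q\<in>D. {x \<in> X. q \<in> cube x (s x)})"
      using D overlap by (intro countable_UN) (auto intro: countable_finite)
    ultimately show ?thesis by (rule countable_subset)
  qed
  moreover have "X \<subseteq> A" using X_V V unfolding sep_def by blast
  moreover have "A \<subseteq> (\<Union>x\<in>X. cube x (s x))"
  proof
    fix x assume x: "x \<in> A"
    show "x \<in> (\<Union>x\<in>X. cube x (s x))"
    proof (cases "x \<in> (\<Union>z\<in>U (\<kappa> x). cube z (s z))")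
      case True
      then show ?thesis by (auto simp: X_def)
    next
      case False
      then obtain z where z: "z \<in> V (U (\<kappa> x)) (\<kappa> x)" "infnorm (x - z) \<le> l0 / a ^ \<kappa> x / 2"
        using V[of "\<kappa> x"] x unfolding sep_def by auto
      then have "\<kappa> z = \<kappa> x" using V[of "\<kappa> x"] unfolding sep_def by auto
      then have "x \<in> cube z (s z)" using z by (simp add: mem_cube s_def)
      moreover have "z \<in> X" using z(1) unfolding X_def by (auto intro!: exI[of _ "Suc (\<kappa> x)"] simp: U_simps)
      ultimately show ?thesis by blast
    qed
  qed
  ultimately show thesis using overlap by (intro that)
qed

text \<open>Sums over \<open>I\<close> are written as integrals over \<open>count_space I\<close>,
  so that exchanging them with the integral over \<open>M\<close> is Tonelli. It is applied to
  Besicovitch cubes with p = 2^d and to disjoint atoms with p = 1.\<close>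

lemma nn_integral_covering:
  assumes I: "countable I" and E: "\<And>i. i \<in> I \<Longrightarrow> E i \<in> sets M" "\<And>i. i \<in> I \<Longrightarrow> E i \<subseteq> U"
    and g: "g \<in> borel_measurable M" and U: "U \<in> sets M"
    and overlap: "\<And>y. finite {i \<in> I. y \<in> E i} \<and> card {i \<in> I. y \<in> E i} \<le> p"
    and bound: "\<And>i. i \<in> I \<Longrightarrow> (\<integral>\<^sup>+y\<in>E i. g y \<partial>M) \<le> K * emeasure M (E i)"
    and cover: "AE y in M. y \<in> A \<longrightarrow> y \<in> (\<Union>i\<in>I. E i)"
  shows "(\<integral>\<^sup>+y\<in>A. g y \<partial>M) \<le> K * (of_nat p * emeasure M U)"
proof -
  note [measurable] = E(1) g U
  have "(\<integral>\<^sup>+y\<in>A. g y \<partial>M) \<le> (\<integral>\<^sup>+y. (\<integral>\<^sup>+i. g y * indicator (E i) y \<partial>count_space I) \<partial>M)"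
  proof (rule nn_integral_mono_AE, use cover in eventually_elim)
    case (elim y)
    show ?case
    proof (cases "y \<in> A")
      case True
      then obtain i where i: "i \<in> I" "y \<in> E i" using elim by auto
      have "g y * indicator (E i) y \<le> (\<integral>\<^sup>+i. g y * indicator (E i) y \<partial>count_space I)"
        by (rule nn_integral_ge_point[OF i(1)])
      then show ?thesis using True i(2) by simp
    qed simp
  qed
  also have "\<dots> = (\<integral>\<^sup>+i. (\<integral>\<^sup>+y\<in>E i. g y \<partial>M) \<partial>count_space I)"
    by (rule nn_integral_count_space_nn_integral[OF I]) auto
  also have "\<dots> \<le> (\<integral>\<^sup>+i. K * (\<integral>\<^sup>+y. indicator (E i) y \<partial>M) \<partial>count_space I)"
    using bound by (intro nn_integral_mono) auto
  also have "\<dots> = K * (\<integral>\<^sup>+i. (\<integral>\<^sup>+y. indicator (E i) y \<partial>M) \<partial>count_space I)"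
    by (rule nn_integral_cmult) auto
  also have "(\<integral>\<^sup>+i. (\<integral>\<^sup>+y. indicator (E i) y \<partial>M) \<partial>count_space I)
      = (\<integral>\<^sup>+y. (\<integral>\<^sup>+i. indicator (E i) y \<partial>count_space I) \<partial>M)"
    by (rule nn_integral_count_space_nn_integral[OF I, symmetric]) auto
  also have "\<dots> \<le> (\<integral>\<^sup>+y. of_nat p * indicator U y \<partial>M)"
  proof (rule nn_integral_mono)
    fix y
    have "(\<integral>\<^sup>+i. indicator (E i) y \<partial>count_space I) = (\<integral>\<^sup>+i. indicator {i \<in> I. y \<in> E i} i \<partial>count_space I)"
      by (intro nn_integral_cong) (auto split: split_indicator)
    also have "\<dots> = of_nat (card {i \<in> I. y \<in> E i})"
      using overlap[of y] by (subst nn_integral_indicator) (auto simp: emeasure_count_space_finite)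
    finally have eq: "(\<integral>\<^sup>+i. indicator (E i) y \<partial>count_space I) = (of_nat (card {i \<in> I. y \<in> E i}) :: ennreal)" .
    show "(\<integral>\<^sup>+i. indicator (E i) y \<partial>count_space I) \<le> of_nat p * indicator U y"
    proof (cases "y \<in> U")
      case True
      then show ?thesis using overlap[of y] by (simp add: eq)
    next
      case False
      then have "{i \<in> I. y \<in> E i} = {}" using E by auto
      then show ?thesis by (simp only: eq card.empty of_nat_0 zero_le)
    qed
  qed
  also have "\<dots> = of_nat p * emeasure M U" by (simp add: nn_integral_cmult_indicator)
  finally show ?thesis by (simp add: mult_left_mono)
qed

section \<open>Averages and oscillations\<close>

context growth_measure
begin

lemma loc_integrable_on:
  assumes "loc_integrable \<mu> f" "E \<in> sets borel" "bounded E"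
  shows "set_integrable \<mu> E f"
proof (rule set_integrable_subset)
  show "set_integrable \<mu> (closure E) f"
    using assms by (simp add: loc_integrable_def compact_closure)
qed (use assms closure_subset in auto)

lemma loc_integrable_measurable:
  assumes "loc_integrable \<mu> f"
  shows "f \<in> borel_measurable \<mu>"
proof (rule borel_measurable_LIMSEQ_real[where u = "\<lambda>i x. indicator (cball 0 (real i)) x *\<^sub>R f x"])
  fix i :: nat
  have "set_integrable \<mu> (cball 0 i) f" using assms by (simp add: loc_integrable_def)
  then show "(\<lambda>x. indicator (cball 0 (real i)) x *\<^sub>R f x) \<in> borel_measurable \<mu>"
    unfolding set_integrable_def by (rule borel_measurable_integrable)
next
  fix x :: "real ^ 'd"
  obtain N where N: "norm x \<le> real N" using real_arch_simple by blast
  have "\<forall>\<^sub>F i in sequentially. indicator (cball 0 (real i)) x *\<^sub>R f x = f x"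
    using eventually_ge_at_top[of N] by eventually_elim (use N in auto)
  then show "(\<lambda>i. indicator (cball 0 (real i)) x *\<^sub>R f x) \<longlonglongrightarrow> f x" by (rule tendsto_eventually)
qed

text \<open>A bound for the integral of |f - c| with one constant \<open>c\<close> is thereby
  interchangeable, up to the factor 2, with bounds for the oscillation and for the distance of the
  average from \<open>c\<close>. The inequalities are multiplied by the mass of \<open>E\<close> to
  be ready for summation over coverings.\<close>

lemma avg_osc_bounds:
  assumes f: "loc_integrable \<mu> f" and E: "E \<in> sets borel" "bounded E" "0 < emeasure \<mu> E"
  shows avg_diff_le: "ennreal \<bar>avg \<mu> E f - c\<bar> * emeasure \<mu> E \<le> (\<integral>\<^sup>+y\<in>E. ennreal \<bar>f y - c\<bar> \<partial>\<mu>)"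
    and osc_le: "ennreal (osc \<mu> E f) * emeasure \<mu> E \<le> 2 * (\<integral>\<^sup>+y\<in>E. ennreal \<bar>f y - c\<bar> \<partial>\<mu>)"
    and nn_integral_le_osc: "(\<integral>\<^sup>+y\<in>E. ennreal \<bar>f y - c\<bar> \<partial>\<mu>)
      \<le> (ennreal (osc \<mu> E f) + ennreal \<bar>avg \<mu> E f - c\<bar>) * emeasure \<mu> E"
proof -
  define m where "m = measure \<mu> E"
  define D where "D t = (LINT x:E|\<mu>. \<bar>f x - t\<bar>)" for t
  have fin: "emeasure \<mu> E < \<infinity>" using emeasure_bounded_finite E by blast
  then have em: "emeasure \<mu> E = ennreal m" unfolding m_def by (intro emeasure_eq_ennreal_measure) auto
  have m: "0 < m" using E(3) by (simp add: em)
  have fE: "set_integrable \<mu> E f" by (rule loc_integrable_on) fact+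
  have const: "set_integrable \<mu> E (\<lambda>x. t)" for t :: real
    unfolding set_integrable_def using E fin by (simp add: integrable_mult_left_iff integrable_indicator_iff)
  have const_int: "(LINT x:E|\<mu>. t) = t * m" for t :: real
    by (simp add: set_integral_const m_def set_lebesgue_integral_def)
  have diff: "set_integrable \<mu> E (\<lambda>x. f x - t)" for t using fE const by (rule set_integral_diff)
  have adiff: "set_integrable \<mu> E (\<lambda>x. \<bar>f x - t\<bar>)" for t using diff by (rule set_integrable_abs)
  have D0: "0 \<le> D t" for t
    unfolding D_def set_lebesgue_integral_def by (intro integral_nonneg_AE) auto
  have nn: "(\<integral>\<^sup>+y\<in>E. ennreal \<bar>f y - t\<bar> \<partial>\<mu>) = ennreal (D t)" for t
  proof -
    have "(\<integral>\<^sup>+y\<in>E. ennreal \<bar>f y - t\<bar> \<partial>\<mu>) = (\<integral>\<^sup>+y. ennreal (indicator E y *\<^sub>R \<bar>f y - t\<bar>) \<partial>\<mu>)"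
      by (intro nn_integral_cong) (auto split: split_indicator)
    also have "\<dots> = ennreal (D t)"
      unfolding D_def set_lebesgue_integral_def
      using adiff[of t] unfolding set_integrable_def by (intro nn_integral_eq_integral) auto
    finally show ?thesis .
  qed
  define A where "A = avg \<mu> E f"
  have A: "(LINT x:E|\<mu>. f x) = A * m" using m by (simp add: A_def avg_def m_def)
  have osc: "osc \<mu> E f * m = D A" using m by (simp add: osc_def avg_def[of _ _ "\<lambda>x. \<bar>f x - avg \<mu> E f\<bar>"] D_def A_def m_def)
  have dev: "\<bar>A - t\<bar> * m \<le> D t" for t
  proof -
    have "(A - t) * m = (LINT x:E|\<mu>. f x - t)"
      using set_integral_diff(2)[OF fE const, of t] by (simp add: A const_int algebra_simps)
    moreover have "\<bar>LINT x:E|\<mu>. f x - t\<bar> \<le> D t"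
    proof -
      have "\<bar>LINT x:E|\<mu>. f x - t\<bar> \<le> (\<integral>x. \<bar>indicator E x *\<^sub>R (f x - t)\<bar> \<partial>\<mu>)"
        unfolding set_lebesgue_integral_def by (rule integral_abs_bound)
      also have "\<dots> = D t"
        unfolding D_def set_lebesgue_integral_def
        by (intro Bochner_Integration.integral_cong) (auto split: split_indicator)
      finally show ?thesis .
    qed
    ultimately show ?thesis using m by (metis abs_mult abs_of_pos)
  qed
  have tri: "D t \<le> D t' + \<bar>t' - t\<bar> * m" for t t'
  proof -
    have "D t \<le> (LINT x:E|\<mu>. \<bar>f x - t'\<bar> + \<bar>t' - t\<bar>)"
      unfolding D_def by (intro set_integral_mono adiff set_integral_add const) auto
    also have "\<dots> = D t' + \<bar>t' - t\<bar> * m"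
      unfolding D_def using set_integral_add(2)[OF adiff const] by (simp add: const_int)
    finally show ?thesis .
  qed
  show "ennreal \<bar>avg \<mu> E f - c\<bar> * emeasure \<mu> E \<le> (\<integral>\<^sup>+y\<in>E. ennreal \<bar>f y - c\<bar> \<partial>\<mu>)"
    using dev[of c] m by (simp add: nn em A_def ennreal_leI flip: ennreal_mult)
  have "D A \<le> 2 * D c" using tri[of A c] dev[of c] by (simp add: abs_minus_commute)
  then have "ennreal (osc \<mu> E f * m) \<le> 2 * ennreal (D c)"
    using D0[of c] by (simp add: osc ennreal_leI flip: ennreal_mult ennreal_numeral)
  moreover have o: "0 \<le> osc \<mu> E f" using osc D0[of A] m zero_le_mult_iff[of "osc \<mu> E f" m] by simp
  ultimately show "ennreal (osc \<mu> E f) * emeasure \<mu> E \<le> 2 * (\<integral>\<^sup>+y\<in>E. ennreal \<bar>f y - c\<bar> \<partial>\<mu>)"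
    using m by (simp add: nn em flip: ennreal_mult)
  have "D c \<le> (osc \<mu> E f + \<bar>A - c\<bar>) * m" using tri[of c A] osc by (simp add: algebra_simps)
  then show "(\<integral>\<^sup>+y\<in>E. ennreal \<bar>f y - c\<bar> \<partial>\<mu>)
      \<le> (ennreal (osc \<mu> E f) + ennreal \<bar>avg \<mu> E f - c\<bar>) * emeasure \<mu> E"
    using m o by (simp add: nn em A_def ennreal_leI flip: ennreal_mult ennreal_plus)
qed

end

text \<open>A quotient by \<top> is 0, so a bound for x / \<delta> says nothing about x unless
  \<delta> is finite. This is why finiteness of the coefficients has to be established before the
  norms can be used.\<close>

lemma ennreal_le_mult_of_divide_le:
  fixes x \<delta> \<Delta> s :: ennreal
  assumes "x / \<delta> \<le> s" "1 \<le> \<delta>" "\<delta> \<le> \<Delta>" "\<Delta> < \<infinity>"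
  shows "x \<le> s * \<Delta>"
proof -
  have "\<delta> \<noteq> 0" "\<delta> \<noteq> \<top>" using assms by (auto simp: top_unique)
  then have "x = x / \<delta> * \<delta>"
    by (simp add: ennreal_times_divide ennreal_divide_times mult_divide_eq_ennreal)
  also have "\<dots> \<le> s * \<Delta>" using assms by (intro mult_mono) auto
  finally show ?thesis .
qed

lemma ennreal_le_of_mult_le:
  fixes x y m :: ennreal
  assumes "x * m \<le> y * m" "0 < m" "m < \<infinity>"
  shows "x \<le> y"
  using assms by (metis ennreal_mult_strict_right_mono infinity_ennreal_def linorder_not_le)

section \<open>Doubling filtrations\<close>

locale doubling_filtration = growth_measure \<mu> n G
  for \<mu> :: "(real ^ 'd::finite) measure" and n G :: real +
  fixes \<alpha> C0 A0 Ct c :: real and L :: "'d dm_cube set" and S :: "int \<Rightarrow> 'd dm_cube set"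
  assumes filtration: "dm_filtration n \<mu> \<alpha> C0 A0 Ct c L S"
begin

lemma lattice: "dm_lattice \<mu> \<alpha> C0 A0 Ct L"
  using filtration by (simp add: dm_filtration_def)

lemma params: "1 < \<alpha>" "1 < C0" "5000 * C0 < A0" "1 \<le> Ct" "1 < A0"
proof -
  show *: "1 < \<alpha>" "1 < C0" "5000 * C0 < A0" "1 \<le> Ct" using lattice by (simp_all add: dm_lattice_def)
  then show "1 < A0" by simp
qed

lemma level_lattice: "Q \<in> S k \<Longrightarrow> Q \<in> L"
  and level_doubling: "Q \<in> S k \<Longrightarrow> doubling \<mu> C0 (dball 1 Q) (dball \<alpha> Q)"
  using filtration by (auto simp: dm_filtration_def)

lemma lattice_level:
  "Q \<in> L \<Longrightarrow> doubling \<mu> C0 (dball 1 Q) (dball \<alpha> Q) \<Longrightarrow> \<exists>k. Q \<in> S k"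
  using filtration by (auto simp: dm_filtration_def)

lemma level_eq: "Q \<in> S k \<Longrightarrow> R \<in> S k \<Longrightarrow> x \<in> pts Q \<Longrightarrow> x \<in> pts R \<Longrightarrow> Q = R"
proof -
  have disj: "\<forall>k. \<forall>Q\<in>S k. \<forall>R\<in>S k. Q \<noteq> R \<longrightarrow> pts Q \<inter> pts R = {}"
    using filtration unfolding dm_filtration_def by meson
  show "Q \<in> S k \<Longrightarrow> R \<in> S k \<Longrightarrow> x \<in> pts Q \<Longrightarrow> x \<in> pts R \<Longrightarrow> Q = R"
    using disj[rule_format, of Q k R] by blast
qed

lemma AE_level: "AE x in \<mu>. \<exists>Q\<in>S k. x \<in> pts Q"
  using filtration unfolding dm_filtration_def by meson

lemma father: "Q \<in> S k \<Longrightarrow> \<exists>P\<in>S (k - 1). gen P < gen Q \<and> pts Q \<subseteq> pts P"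
  using filtration unfolding dm_filtration_def by meson

lemma riesz_mass_father:
  "Q \<in> S k \<Longrightarrow> P \<in> S (k - 1) \<Longrightarrow> pts Q \<subseteq> pts P \<Longrightarrow>
    riesz_mass n \<mu> (ctr Q) (dball \<alpha> P - dball \<alpha> Q) \<le> ennreal c"
  using filtration unfolding dm_filtration_def by meson

lemma
  assumes "Q \<in> L"
  shows pts_borel: "pts Q \<in> sets borel" and pts_nonempty: "pts Q \<noteq> {}"
    and rad_lower: "Ct / C0 * A0 powi (- gen Q) \<le> rad Q"
    and rad_upper: "rad Q \<le> Ct * A0 powi (- gen Q)"
    and dball_subset_pts: "dball 1 Q \<inter> msupp \<mu> \<subseteq> pts Q"
    and pts_subset_dball: "pts Q \<subseteq> dball 30 Q \<inter> msupp \<mu>"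
    and dball_disjoint: "R \<in> L \<Longrightarrow> gen Q = gen R \<Longrightarrow> Q \<noteq> R \<Longrightarrow> dball 5 Q \<inter> dball 5 R = {}"
  using lattice assms unfolding dm_lattice_def by (meson)+

lemma rad_pos: "Q \<in> L \<Longrightarrow> 0 < rad Q"
  using rad_lower[of Q] params
  by (intro less_le_trans[OF _ rad_lower]) (auto intro!: mult_pos_pos zero_less_power_int)

lemma bounded_pts: "Q \<in> L \<Longrightarrow> bounded (pts Q)"
  using pts_subset_dball[of Q] by (auto simp: dball_def intro: bounded_subset[OF bounded_ball])

lemma dist_ctr: "Q \<in> L \<Longrightarrow> x \<in> pts Q \<Longrightarrow> dist (ctr Q) x < 30 * rad Q"
  using pts_subset_dball[of Q] by (auto simp: dball_def)

lemma dball_borel [measurable]: "dball t Q \<in> sets borel"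
  by (simp add: dball_def)

lemma AE_msupp: "AE x in \<mu>. x \<in> msupp \<mu>"
  using AE_level[of 0] by eventually_elim (use pts_subset_dball level_lattice in blast)

lemma emeasure_dball_le_pts:
  assumes "Q \<in> L"
  shows "emeasure \<mu> (dball 1 Q) \<le> emeasure \<mu> (pts Q)"
  using AE_msupp pts_borel[OF assms] dball_subset_pts[OF assms]
  by (intro emeasure_mono_AE) (auto elim!: eventually_mono)

lemma emeasure_pts_pos: "Q \<in> S k \<Longrightarrow> 0 < emeasure \<mu> (pts Q)"
  using level_doubling[of Q k] emeasure_dball_le_pts[OF level_lattice, of Q k]
  by (auto simp: doubling_def intro: less_le_trans)

lemma emeasure_pts_finite: "Q \<in> S k \<Longrightarrow> emeasure \<mu> (pts Q) < \<infinity>"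
  using emeasure_bounded_finite bounded_pts level_lattice by blast

lemma emeasure_dball_le:
  assumes "Q \<in> S k"
  shows "emeasure \<mu> (dball \<alpha> Q) \<le> ennreal C0 * emeasure \<mu> (pts Q)"
proof -
  have "emeasure \<mu> (dball \<alpha> Q) \<le> ennreal C0 * emeasure \<mu> (dball 1 Q)"
    using level_doubling[OF assms] by (simp add: doubling_def)
  also have "\<dots> \<le> ennreal C0 * emeasure \<mu> (pts Q)"
    using assms by (intro mult_left_mono emeasure_dball_le_pts level_lattice) auto
  finally show ?thesis .
qed

text \<open>Climbing from \<open>Q\<close> through k - k' fathers ends in an atom of level k' that
  contains \<open>x\<close>, and that can only be \<open>R\<close>. Each father has a strictly
  smaller generation, so generations drop at least as fast as levels.\<close>

lemma nested:
  assumes "Q \<in> S k" "R \<in> S k'" "x \<in> pts Q" "x \<in> pts R" "k' \<le> k"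
  shows "pts Q \<subseteq> pts R" "gen R + (k - k') \<le> gen Q"
proof -
  have "\<exists>P\<in>S (k - int j). gen P + int j \<le> gen Q \<and> pts Q \<subseteq> pts P" for j
  proof (induction j)
    case 0
    show ?case using assms(1) by auto
  next
    case (Suc j)
    then obtain P where P: "P \<in> S (k - int j)" "gen P + int j \<le> gen Q" "pts Q \<subseteq> pts P" by blast
    then obtain P' where "P' \<in> S (k - int j - 1)" "gen P' < gen P" "pts P \<subseteq> pts P'" using father by blast
    moreover have eq: "k - int (Suc j) = k - int j - 1" by simp
    ultimately show ?case using P unfolding eq by (intro bexI[of _ P']) auto
  qed
  from this[of "nat (k - k')"] obtain P where
    P: "P \<in> S k'" "gen P + (k - k') \<le> gen Q" "pts Q \<subseteq> pts P" using assms(5) by auto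
  then have "P = R" using assms level_eq[of P k' R x] by auto
  then show "pts Q \<subseteq> pts R" "gen R + (k - k') \<le> gen Q" using P by auto
qed

text \<open>Within one generation the balls 5 B_Q are disjoint, nonempty and open, hence countably
  many; the generations are indexed by integers.\<close>

lemma countable_lattice: "countable L"
proof -
  have "countable {Q \<in> L. gen Q = k}" for k
  proof -
    have inj: "inj_on (dball 5) {Q \<in> L. gen Q = k}"
    proof (rule inj_onI)
      fix Q R assume QR: "Q \<in> {Q \<in> L. gen Q = k}" "R \<in> {Q \<in> L. gen Q = k}" "dball 5 Q = dball 5 R"
      have "ctr Q \<in> dball 5 Q" using QR(1) rad_pos[of Q] by (simp add: dball_def)
      then show "Q = R" using QR dball_disjoint[of Q R] by auto
    qed
    have "countable (dball 5 ` {Q \<in> L. gen Q = k})"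
    proof (rule countable_disjoint_open_subsets)
      show "disjoint (dball 5 ` {Q \<in> L. gen Q = k})"
      proof (rule disjointI)
        fix a b assume "a \<in> dball 5 ` {Q \<in> L. gen Q = k}" "b \<in> dball 5 ` {Q \<in> L. gen Q = k}" "a \<noteq> b"
        then obtain Q R where "a = dball 5 Q" "Q \<in> L" "gen Q = k" "b = dball 5 R" "R \<in> L" "gen R = k"
          by blast
        moreover from this \<open>a \<noteq> b\<close> have "Q \<noteq> R" by auto
        ultimately show "a \<inter> b = {}" using dball_disjoint[of Q R] by simp
      qed
    qed (auto simp: dball_def)
    then show ?thesis using countable_image_inj_on[OF _ inj] by blast
  qed
  then have "countable (\<Union>k. {Q \<in> L. gen Q = k})" by (intro countable_UN) auto
  moreover have "(\<Union>k. {Q \<in> L. gen Q = k}) = L" by auto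
  ultimately show ?thesis by simp
qed

text \<open>A stopping family: the atoms at which, along a branch, the generation first reaches
  \<open>g\<close>. Levels cannot play the role of scales, because generations are skipped when
  non-doubling. Such an atom may be much smaller than scale \<open>g\<close>, but its father is not,
  and the passage to the father is controlled by \<open>c\<close>.\<close>

definition maximal_atoms :: "int \<Rightarrow> 'd dm_cube set" where
  "maximal_atoms g = {W. \<exists>k. W \<in> S k \<and> g \<le> gen W \<and> (\<exists>P\<in>S (k - 1). pts W \<subseteq> pts P \<and> gen P < g)}"

text \<open>If two of them lay at different levels of one branch, the father of the lower one would
  be at or below the upper one, and so would have generation at least \<open>g\<close>.\<close>

lemma maximal_atoms_disjoint:
  assumes "W \<in> maximal_atoms g" "W' \<in> maximal_atoms g" "x \<in> pts W" "x \<in> pts W'"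
  shows "W = W'"
proof -
  have *: "\<not> k < k'" if W: "W \<in> S k" "g \<le> gen W" and W': "W' \<in> S k'" "P \<in> S (k' - 1)" "pts W' \<subseteq> pts P" "gen P < g"
    and x: "x \<in> pts W" "x \<in> pts W'" for W W' P k k'
    using nested(2)[of P "k' - 1" W k x] that by force
  obtain k P k' P' where W: "W \<in> S k" "g \<le> gen W" "P \<in> S (k - 1)" "pts W \<subseteq> pts P" "gen P < g"
    "W' \<in> S k'" "g \<le> gen W'" "P' \<in> S (k' - 1)" "pts W' \<subseteq> pts P'" "gen P' < g"
    using assms(1,2) unfolding maximal_atoms_def by blast
  have "k = k'" using *[of W k W' k' P'] *[of W' k' W k P] W assms(3,4) by force
  then show ?thesis using level_eq[of W k W' x] W assms by blast
qed

lemma AE_maximal_atoms: "AE x in \<mu>. \<exists>W\<in>maximal_atoms g. x \<in> pts W"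
proof -
  have "AE x in \<mu>. \<forall>k. \<exists>Q\<in>S k. x \<in> pts Q"
    using AE_level by (subst AE_all_countable) auto
  then show ?thesis
  proof eventually_elim
    case (elim x)
    then obtain q where q: "\<And>k. q k \<in> S k" "\<And>k. x \<in> pts (q k)" by metis
    have gen_q: "gen (q k') + (k - k') \<le> gen (q k)" if "k' \<le> k" for k k'
      using nested(2)[OF q(1)[of k] q(1)[of k'] q(2) q(2) that] .
    \<comment> \<open>Generations change by at least one per level, so these distances from level 0
      suffice to pass below \<open>g\<close> and to reach \<open>g\<close>, respectively. The first
      crossing in between is the stopping atom.\<close>
    define k0 where "k0 = - \<bar>gen (q 0)\<bar> - \<bar>g\<bar> - 1"
    define k1 where "k1 = \<bar>gen (q 0)\<bar> + \<bar>g\<bar>"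
    have "k0 \<le> 0" "0 \<le> k1" by (auto simp: k0_def k1_def)
    from this[THEN gen_q] have k0: "gen (q k0) < g" and k1: "g \<le> gen (q k1)"
      unfolding k0_def k1_def by linarith+
    define j where "j = (LEAST j. g \<le> gen (q (k0 + int j)))"
    have "g \<le> gen (q (k0 + int (nat (k1 - k0))))" using k1 by (simp add: k0_def k1_def)
    then have j: "g \<le> gen (q (k0 + int j))" unfolding j_def by (rule LeastI)
    then obtain j' where j': "j = Suc j'" using k0 by (cases j) auto
    then have "gen (q (k0 + int j')) < g"
      using not_less_Least[of j' "\<lambda>j. g \<le> gen (q (k0 + int j))"] unfolding j_def[symmetric] by simp
    moreover have "q (k0 + int j') \<in> S (k0 + int j - 1)" using q(1)[of "k0 + int j'"] j' by simp
    moreover have "pts (q (k0 + int j)) \<subseteq> pts (q (k0 + int j'))"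
      using nested(1)[OF q(1) q(1) q(2) q(2), of "k0 + int j'" "k0 + int j"] j' by simp
    ultimately have "q (k0 + int j) \<in> maximal_atoms g"
      unfolding maximal_atoms_def using j q(1)[of "k0 + int j"]
      by (intro CollectI exI[of _ "k0 + int j"] conjI bexI[of _ "q (k0 + int j')"]) simp_all
    then show ?case using q(2) by blast
  qed
qed

lemma osc_le_star_norm:
  assumes "Q \<in> S k"
  shows "ennreal (osc \<mu> (pts Q) f) \<le> RBMO_star_norm n \<mu> \<alpha> S f"
  unfolding RBMO_star_norm_def using assms
  by (intro order_trans[OF _ add_increasing2[OF _ order_refl]] SUP_upper) auto

lemma avg_diff_le_star_norm:
  assumes "Q \<in> S k" "R \<in> S k'" "k' < k" "pts Q \<subseteq> pts R" "dm_delta n \<mu> \<alpha> Q R \<le> \<Delta>" "\<Delta> < \<infinity>"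
  shows "ennreal \<bar>avg \<mu> (pts Q) f - avg \<mu> (pts R) f\<bar> \<le> RBMO_star_norm n \<mu> \<alpha> S f * \<Delta>"
proof (rule ennreal_le_mult_of_divide_le[OF _ _ assms(5,6)])
  have k': "k' = k - int (nat (k - k'))" "0 < nat (k - k')" using assms(3) by auto
  have "ennreal \<bar>avg \<mu> (pts Q) f - avg \<mu> (pts R) f\<bar> / dm_delta n \<mu> \<alpha> Q R
    \<le> (SUP (Q, R) \<in> {(Q, R). \<exists>k. \<exists>j::nat. 0 < j \<and> Q \<in> S k \<and> R \<in> S (k - int j) \<and> pts Q \<subseteq> pts R}.
        ennreal \<bar>avg \<mu> (pts Q) f - avg \<mu> (pts R) f\<bar> / dm_delta n \<mu> \<alpha> Q R)"
    by (rule SUP_upper2[of "(Q, R)"]) (use assms k' in \<open>auto intro!: exI[of _ k] exI[of _ "nat (k - k')"]\<close>)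
  then show "ennreal \<bar>avg \<mu> (pts Q) f - avg \<mu> (pts R) f\<bar> / dm_delta n \<mu> \<alpha> Q R \<le> RBMO_star_norm n \<mu> \<alpha> S f"
    unfolding RBMO_star_norm_def by (rule add_increasing[rotated]) simp
  show "1 \<le> dm_delta n \<mu> \<alpha> Q R" by (simp add: dm_delta_def)
qed

section \<open>The martingale norm\<close>

lemma subalgebra_level: "subalgebra \<mu> (level_algebra S k)"
proof -
  have "sigma_sets (space borel) (pts ` S k) \<subseteq> sets borel"
    using pts_borel level_lattice by (intro sets.sigma_sets_subset) auto
  then show ?thesis by (simp add: subalgebra_def level_algebra_def)
qed

lemma pts_in_level_algebra: "Q \<in> S k \<Longrightarrow> pts Q \<in> sets (level_algebra S k)"
  by (simp add: level_algebra_def)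

text \<open>The atoms of a level have finite measure and leave out only a null set. That set must be
  added to the cover, and it belongs to the generated algebra because the atoms are countably
  many.\<close>

lemma sigma_finite_subalgebra_level: "sigma_finite_subalgebra \<mu> (level_algebra S k)"
proof -
  let ?F = "level_algebra S k" and ?N = "UNIV - (\<Union>Q\<in>S k. pts Q)"
  have cS: "countable (S k)" using countable_lattice level_lattice by (auto intro: countable_subset)
  have N: "?N \<in> sets ?F"
    using cS pts_in_level_algebra sets.top[of ?F]
    by (intro sets.Diff sets.countable_UN') (auto simp: level_algebra_def)
  have N0: "emeasure \<mu> ?N = 0"
  proof -
    have "?N \<in> null_sets \<mu>"
      using AE_level[of k] N subalgebra_level[of k]
      by (subst AE_iff_null_sets) (auto simp: subalgebra_def elim!: eventually_mono)
    then show ?thesis by auto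
  qed
  have "sigma_finite_measure (restr_to_subalg \<mu> ?F)"
  proof
    show "\<exists>A. countable A \<and> A \<subseteq> sets (restr_to_subalg \<mu> ?F) \<and> \<Union>A = space (restr_to_subalg \<mu> ?F) \<and>
        (\<forall>a\<in>A. emeasure (restr_to_subalg \<mu> ?F) a \<noteq> \<infinity>)"
    proof (intro exI[of _ "insert ?N (pts ` S k)"] conjI ballI)
      show "insert ?N (pts ` S k) \<subseteq> sets (restr_to_subalg \<mu> ?F)"
        using N pts_in_level_algebra by (auto simp: sets_restr_to_subalg[OF subalgebra_level])
      fix A assume "A \<in> insert ?N (pts ` S k)"
      then show "emeasure (restr_to_subalg \<mu> ?F) A \<noteq> \<infinity>"
        using N N0 pts_in_level_algebra emeasure_pts_finite
        by (auto simp: emeasure_restr_to_subalg[OF subalgebra_level] less_top)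
    qed (use cS in \<open>auto simp: space_restr_to_subalg\<close>)
  qed
  then show ?thesis using subalgebra_level by (simp add: sigma_finite_subalgebra_def)
qed

text \<open>No set of the level algebra splits an atom. Conditional expectations are therefore
  determined at every point of an atom and not merely almost everywhere.\<close>

lemma level_measurable_constant:
  fixes h :: "real ^ 'd \<Rightarrow> ennreal"
  assumes "h \<in> borel_measurable (level_algebra S k)" "Q \<in> S k" "x \<in> pts Q" "y \<in> pts Q"
  shows "h x = h y"
proof -
  have dich: "pts Q \<subseteq> A \<or> pts Q \<inter> A = {}" if "A \<in> sigma_sets UNIV (pts ` S k)" for A
    using that
  proof induction
    case (Basic A)
    then show ?case using level_eq[OF assms(2)] by blast
  qed blast+
  have "h -` {h x} \<inter> space (level_algebra S k) \<in> sets (level_algebra S k)"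
    using assms(1) by (rule measurable_sets) simp
  then have "h -` {h x} \<in> sigma_sets UNIV (pts ` S k)"
    by (simp add: level_algebra_def)
  from dich[OF this] show ?thesis using assms(3,4) by auto
qed

lemma nn_cond_exp_atom:
  assumes h: "h \<in> borel_measurable \<mu>" and Q: "Q \<in> S k" "x \<in> pts Q"
  shows "nn_cond_exp \<mu> (level_algebra S k) h x = (\<integral>\<^sup>+y\<in>pts Q. h y \<partial>\<mu>) / emeasure \<mu> (pts Q)"
proof -
  interpret sigma_finite_subalgebra \<mu> "level_algebra S k" by (rule sigma_finite_subalgebra_level)
  let ?e = "nn_cond_exp \<mu> (level_algebra S k) h"
  have [measurable]: "pts Q \<in> sets borel" using pts_borel level_lattice Q by blast
  have "(\<integral>\<^sup>+y\<in>pts Q. h y \<partial>\<mu>) = (\<integral>\<^sup>+y. indicator (pts Q) y * h y \<partial>\<mu>)"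
    by (simp add: mult.commute)
  also have "\<dots> = (\<integral>\<^sup>+y. indicator (pts Q) y * ?e y \<partial>\<mu>)"
    using h pts_in_level_algebra[OF Q(1)] by (intro nn_cond_exp_intg[symmetric]) auto
  also have "\<dots> = (\<integral>\<^sup>+y. ?e x * indicator (pts Q) y \<partial>\<mu>)"
    using level_measurable_constant[OF borel_measurable_nn_cond_exp Q(1) _ Q(2)]
    by (intro nn_integral_cong) (auto split: split_indicator)
  also have "\<dots> = ?e x * emeasure \<mu> (pts Q)" by (simp add: nn_integral_cmult_indicator)
  finally show ?thesis
    using emeasure_pts_pos[OF Q(1)] emeasure_pts_finite[OF Q(1)]
    by (simp add: mult_divide_eq_ennreal)
qed

text \<open>Since \<open>f\<close> is only locally integrable, the formula is taken from the
  positive and negative parts separately; both have finite integral over the bounded atom.\<close>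

lemma real_cond_exp_atom:
  assumes f: "loc_integrable \<mu> f" and Q: "Q \<in> S k" "x \<in> pts Q"
  shows "real_cond_exp \<mu> (level_algebra S k) f x = avg \<mu> (pts Q) f"
proof -
  have [measurable]: "f \<in> borel_measurable \<mu>" using f by (rule loc_integrable_measurable)
  have [measurable]: "pts Q \<in> sets borel" using pts_borel level_lattice Q by blast
  define m where "m = measure \<mu> (pts Q)"
  have em: "emeasure \<mu> (pts Q) = ennreal m"
    unfolding m_def using emeasure_pts_finite[OF Q(1)] by (intro emeasure_eq_ennreal_measure) auto
  have m: "0 < m" using emeasure_pts_pos[OF Q(1)] by (simp add: em)
  have int: "integrable \<mu> (\<lambda>x. indicator (pts Q) x *\<^sub>R f x)"
    using loc_integrable_on[OF f, of "pts Q"] bounded_pts level_lattice Q by (simp add: set_integrable_def)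
  have div: "enn2real (t / ennreal m) = enn2real t / m" if "t \<noteq> \<infinity>" for t
    using that m by (cases t) (auto simp: divide_ennreal)
  have pos: "(\<integral>\<^sup>+y\<in>pts Q. ennreal (f y) \<partial>\<mu>) = (\<integral>\<^sup>+y. ennreal (indicator (pts Q) y *\<^sub>R f y) \<partial>\<mu>)"
    and neg: "(\<integral>\<^sup>+y\<in>pts Q. ennreal (- f y) \<partial>\<mu>) = (\<integral>\<^sup>+y. ennreal (- (indicator (pts Q) y *\<^sub>R f y)) \<partial>\<mu>)"
    by (intro nn_integral_cong; auto split: split_indicator)+
  have fin: "(\<integral>\<^sup>+y. ennreal (indicator (pts Q) y *\<^sub>R f y) \<partial>\<mu>) \<noteq> \<infinity>"
    "(\<integral>\<^sup>+y. ennreal (- (indicator (pts Q) y *\<^sub>R f y)) \<partial>\<mu>) \<noteq> \<infinity>"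
    using int by (auto simp: real_integrable_def)
  have "real_cond_exp \<mu> (level_algebra S k) f x
      = enn2real (\<integral>\<^sup>+y\<in>pts Q. ennreal (f y) \<partial>\<mu>) / m - enn2real (\<integral>\<^sup>+y\<in>pts Q. ennreal (- f y) \<partial>\<mu>) / m"
    unfolding real_cond_exp_def
    by (subst (1 2) nn_cond_exp_atom[OF _ Q]) (use fin in \<open>auto simp: em div pos neg\<close>)
  also have "\<dots> = (enn2real (\<integral>\<^sup>+y\<in>pts Q. ennreal (f y) \<partial>\<mu>) - enn2real (\<integral>\<^sup>+y\<in>pts Q. ennreal (- f y) \<partial>\<mu>)) / m"
    by (simp add: diff_divide_distrib)
  also have "enn2real (\<integral>\<^sup>+y\<in>pts Q. ennreal (f y) \<partial>\<mu>) - enn2real (\<integral>\<^sup>+y\<in>pts Q. ennreal (- f y) \<partial>\<mu>)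
      = (LINT y:pts Q|\<mu>. f y)"
    unfolding set_lebesgue_integral_def real_lebesgue_integral_def[OF int] pos neg ..
  finally show ?thesis by (simp add: avg_def m_def)
qed

text \<open>On an atom \<open>Q\<close> with father \<open>P\<close> the conditional expectation is
  the mean over \<open>Q\<close> of |f - f_P|. It is at most the oscillation on \<open>Q\<close>
  plus |f_Q - f_P|; these contribute 1 and 1 + c.\<close>

lemma mart_norm_le:
  assumes f: "loc_integrable \<mu> f"
  shows "RBMO_mart_norm \<mu> S f \<le> RBMO_star_norm n \<mu> \<alpha> S f * (2 + ennreal c)"
  unfolding RBMO_mart_norm_def
proof (rule SUP_least)
  fix k
  let ?s = "RBMO_star_norm n \<mu> \<alpha> S f" and ?E = "real_cond_exp \<mu> (level_algebra S (k - 1)) f"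
  have [measurable]: "f \<in> borel_measurable \<mu>" using f by (rule loc_integrable_measurable)
  interpret sub: sigma_finite_subalgebra \<mu> "level_algebra S k" by (rule sigma_finite_subalgebra_level)
  interpret sub1: sigma_finite_subalgebra \<mu> "level_algebra S (k - 1)" by (rule sigma_finite_subalgebra_level)
  have "AE x in \<mu>. nn_cond_exp \<mu> (level_algebra S k) (\<lambda>x. ennreal \<bar>f x - ?E x\<bar>) x \<le> ?s * (2 + ennreal c)"
    using AE_level[of k]
  proof eventually_elim
    case (elim x)
    then obtain Q where Q: "Q \<in> S k" "x \<in> pts Q" by blast
    then obtain P where P: "P \<in> S (k - 1)" "pts Q \<subseteq> pts P" using father by blast
    note pos = emeasure_pts_pos[OF Q(1)] and fin = emeasure_pts_finite[OF Q(1)]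
    have "(\<integral>\<^sup>+y\<in>pts Q. ennreal \<bar>f y - ?E y\<bar> \<partial>\<mu>) = (\<integral>\<^sup>+y\<in>pts Q. ennreal \<bar>f y - avg \<mu> (pts P) f\<bar> \<partial>\<mu>)"
      using real_cond_exp_atom[OF f P(1)] P(2) by (intro nn_integral_cong) (auto split: split_indicator)
    also have "\<dots> \<le> (ennreal (osc \<mu> (pts Q) f) + ennreal \<bar>avg \<mu> (pts Q) f - avg \<mu> (pts P) f\<bar>) * emeasure \<mu> (pts Q)"
      using f pts_borel bounded_pts level_lattice[OF Q(1)] pos by (intro nn_integral_le_osc) auto
    also have "\<dots> \<le> (?s + ?s * (1 + ennreal c)) * emeasure \<mu> (pts Q)"
    proof (intro mult_right_mono add_mono)
      show "ennreal (osc \<mu> (pts Q) f) \<le> ?s" by (rule osc_le_star_norm[OF Q(1)])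
      show "ennreal \<bar>avg \<mu> (pts Q) f - avg \<mu> (pts P) f\<bar> \<le> ?s * (1 + ennreal c)"
        by (rule avg_diff_le_star_norm[OF Q(1) P(1)])
          (use P riesz_mass_father[OF Q(1) P] in \<open>auto simp: dm_delta_def\<close>)
    qed simp
    also have "?s + ?s * (1 + ennreal c) = ?s * (2 + ennreal c)"
      by (simp add: distrib_left flip: add.assoc mult_2_right)
    finally have "(\<integral>\<^sup>+y\<in>pts Q. ennreal \<bar>f y - ?E y\<bar> \<partial>\<mu>) \<le> ?s * (2 + ennreal c) * emeasure \<mu> (pts Q)" .
    then have "(\<integral>\<^sup>+y\<in>pts Q. ennreal \<bar>f y - ?E y\<bar> \<partial>\<mu>) / emeasure \<mu> (pts Q)
        \<le> ?s * (2 + ennreal c) * emeasure \<mu> (pts Q) / emeasure \<mu> (pts Q)"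
      by (rule divide_right_mono_ennreal)
    also have "\<dots> = ?s * (2 + ennreal c)" using pos fin by (intro mult_divide_eq_ennreal) auto
    finally show ?case by (subst nn_cond_exp_atom[OF _ Q]) auto
  qed
  then show "esssup \<mu> (nn_cond_exp \<mu> (level_algebra S k) (\<lambda>x. ennreal \<bar>f x - ?E x\<bar>)) \<le> ?s * (2 + ennreal c)"
    by (subst esssup_eq_AE) (auto intro: Inf_lower)
qed

lemma RBMO_star_subset_mart: "RBMO_star n \<mu> \<alpha> S \<subseteq> RBMO_mart \<mu> S"
proof
  fix f assume f: "f \<in> RBMO_star n \<mu> \<alpha> S"
  then have "RBMO_star_norm n \<mu> \<alpha> S f * (2 + ennreal c) < \<infinity>"
    by (auto simp: RBMO_star_def ennreal_mult_less_top)
  then show "f \<in> RBMO_mart \<mu> S"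
    using mart_norm_le[of f] f by (auto simp: RBMO_star_def RBMO_mart_def intro: le_less_trans)
qed

end

section \<open>Comparison with RBMO\<close>

lemma osc_le_RBMO_norm:
  assumes "doubling_cube \<mu> a b x l"
  shows "ennreal (osc \<mu> (cube x l) f) \<le> RBMO_norm n a b \<mu> f"
  unfolding RBMO_norm_def by (rule max.coboundedI1, rule SUP_upper2[of "(x, l)"]) (use assms in auto)

lemma avg_diff_le_RBMO_norm:
  assumes "doubling_cube \<mu> a b x l" "doubling_cube \<mu> a b y m" "cube x l \<subseteq> cube y m"
    and "cube_delta n \<mu> x l y m \<le> \<Delta>" "\<Delta> < \<infinity>"
  shows "ennreal \<bar>avg \<mu> (cube x l) f - avg \<mu> (cube y m) f\<bar> \<le> RBMO_norm n a b \<mu> f * \<Delta>"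
proof (rule ennreal_le_mult_of_divide_le[OF _ _ assms(4,5)])
  show "ennreal \<bar>avg \<mu> (cube x l) f - avg \<mu> (cube y m) f\<bar> / cube_delta n \<mu> x l y m \<le> RBMO_norm n a b \<mu> f"
    unfolding RBMO_norm_def
    by (rule max.coboundedI2, rule SUP_upper2[of "(x, l, y, m)"]) (use assms in auto)
  show "1 \<le> cube_delta n \<mu> x l y m" by (simp add: cube_delta_def)
qed

lemma ennreal_divide_le_of_le_mult:
  fixes x y \<delta> :: ennreal
  assumes "x \<le> y * \<delta>" "1 \<le> \<delta>"
  shows "x / \<delta> \<le> y"
proof (cases "\<delta> = \<top>")
  case False
  then have "x / \<delta> \<le> y * \<delta> / \<delta>" using assms(1) by (intro divide_right_mono_ennreal)
  also have "\<dots> = y" using False assms(2) by (intro mult_divide_eq_ennreal) auto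
  finally show ?thesis .
qed simp

lemma riesz_mass_empty [simp]: "riesz_mass n \<mu> z {} = 0"
  by (simp add: riesz_mass_def)

text \<open>Besides the leading 1, there is one summand for each of the regions \<open>E1\<close> to
  \<open>E6\<close> in \<open>cube_delta_le_dm_delta\<close>, in that order.\<close>

definition atom_const :: "real \<Rightarrow> real \<Rightarrow> real \<Rightarrow> real \<Rightarrow> real \<Rightarrow> real" where
  "atom_const n G \<alpha> a b = 1 + chain_const n G 1 a b + G * (4 * \<alpha>) powr n + 2 powr n + G * 4 powr n
    + chain_const n G (1 / 2) a b + G * 8 powr n"

section \<open>The starred norm bounded by the RBMO norm\<close>

context doubling_filtration
begin

lemma scale_less_imp_gen_less:
  assumes "Ct * A0 powi (- g) < Ct * A0 powi (- h)"
  shows "h < g"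
proof (rule ccontr)
  assume "\<not> h < g"
  then have "A0 powi (- h) \<le> A0 powi (- g)" using params by (intro power_int_increasing) auto
  then show False using assms params by (simp add: mult_less_cancel_left)
qed

text \<open>Radii within one generation vary by a factor of at most C0, and this is less than the
  ratio A0 of consecutive scales.\<close>

lemma rad_le_of_gen_less:
  assumes "Q \<in> L" "P \<in> L" "gen P < gen Q"
  shows "rad Q \<le> rad P"
proof -
  have "rad Q \<le> Ct * A0 powi (- gen Q)" by (rule rad_upper) fact
  also have "\<dots> \<le> Ct * A0 powi (- gen P - 1)"
    using params assms(3) by (intro mult_left_mono power_int_increasing) auto
  also have "\<dots> = Ct * A0 powi (- gen P) / A0"
    using params by (simp add: power_int_diff)
  also have "\<dots> \<le> Ct * A0 powi (- gen P) / C0"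
    using params by (intro divide_left_mono mult_nonneg_nonneg mult_pos_pos) auto
  also have "\<dots> \<le> rad P" using rad_lower[OF assms(2)] by simp
  finally show ?thesis .
qed

lemma rad_le_of_descendant:
  assumes "Q \<in> S k" "P \<in> S k'" "k' \<le> k" "pts Q \<subseteq> pts P"
  shows "rad Q \<le> rad P"
proof -
  obtain x where x: "x \<in> pts Q" using pts_nonempty[OF level_lattice[OF assms(1)]] by blast
  show ?thesis
  proof (cases "k' = k")
    case True
    then show ?thesis using level_eq[of Q k P x] assms x by auto
  next
    case False
    then have "gen P < gen Q" using nested(2)[OF assms(1,2) x _ assms(3)] x assms by auto
    then show ?thesis using rad_le_of_gen_less assms level_lattice by blast
  qed
qed

lemma dm_delta_finite:
  assumes "Q \<in> S k"
  shows "dm_delta n \<mu> \<alpha> Q R < \<infinity>"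
proof -
  let ?l = "2 * max 1 (\<alpha> * rad R)"
  have "dball \<alpha> R \<subseteq> ball (ctr R) (max 1 (\<alpha> * rad R))" by (auto simp: dball_def)
  then have "dball \<alpha> R - dball \<alpha> Q \<subseteq> cube (ctr R) ?l" using ball_subset_cube by blast
  then have "riesz_mass n \<mu> (ctr Q) (dball \<alpha> R - dball \<alpha> Q) \<le> ennreal (G * (?l / (\<alpha> * rad Q)) powr n)"
    using params rad_pos[OF level_lattice[OF assms]]
    by (intro riesz_mass_le_cube[where y = "ctr R"]) (auto simp: dball_def)
  then show ?thesis unfolding dm_delta_def by (auto simp: le_less_trans)
qed

lemma chain_const_nonneg: "0 < t \<Longrightarrow> t powr n < B \<Longrightarrow> 0 \<le> chain_const n G \<eta> t B"
proof -
  assume t: "0 < t" "t powr n < B"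
  then have "0 < B" using powr_gt_zero[of t n] by linarith
  then have "t powr n / B \<le> 1" using t by simp
  then show ?thesis using G_pos by (simp add: chain_const_def)
qed

text \<open>The region between the cubes is cut at the atoms' own scales. \<open>E1\<close> holds
  the non-doubling scales below \<open>T\<close>, \<open>E3\<close> is the region of the atoms' own
  coefficient, and \<open>E5\<close> holds the non-doubling scales above \<open>T'\<close>. In
  \<open>E2\<close>, \<open>E4\<close> and \<open>E6\<close> the distance to \<open>x\<close> is
  comparable with one fixed scale, so the growth bound suffices.\<close>

lemma cube_delta_le_dm_delta:
  assumes \<alpha>: "480 * sqrt CARD('d) \<le> \<alpha>" and a: "1 < a" "a powr n < b"
    and T: "T \<in> S k" "T' \<in> S k'" "k' \<le> k" "pts T \<subseteq> pts T'" and x: "x \<in> pts T"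
    and low: "\<And>i. i < \<kappa> \<Longrightarrow> \<not> doubling_cube \<mu> a b x (rad T / a ^ i)"
    and high: "\<And>i. i < q \<Longrightarrow> ennreal b * emeasure \<mu> (cube (ctr T') (a ^ i * (2 * \<alpha> * rad T')))
      \<le> emeasure \<mu> (cube (ctr T') (a ^ (i + 1) * (2 * \<alpha> * rad T')))"
  shows "cube_delta n \<mu> x (rad T / a ^ \<kappa>) (ctr T') (a ^ q * (2 * \<alpha> * rad T'))
    \<le> ennreal (atom_const n G \<alpha> a b) * dm_delta n \<mu> \<alpha> T T'"
proof -
  define r r' z' where "r = rad T" and "r' = rad T'" and "z' = ctr T'"
  define s where "s = r / a ^ \<kappa>"
  \<comment> \<open>The side of the cube circumscribed about the ball \<alpha> B of
    \<open>T'\<close>.\<close>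
  define L0 where "L0 = 2 * \<alpha> * r'"
  define l where "l = a ^ q * L0"
  define E where "E = cube z' (2 * l) - cube x (2 * s)"
  have lat: "T \<in> L" "T' \<in> L" using T level_lattice by auto
  have r: "0 < r" "0 < r'" "r \<le> r'"
    using rad_pos[OF lat(1)] rad_pos[OF lat(2)] rad_le_of_descendant[OF T] by (auto simp: r_def r'_def)
  have sqrt: "1 \<le> sqrt CARD('d)" by simp
  have \<alpha>480: "480 \<le> \<alpha>" using \<alpha> sqrt by linarith
  have apow: "0 < a ^ i" "1 \<le> a ^ i" for i using a by auto
  have s: "0 < s" using r apow by (simp add: s_def)
  have L0: "0 < L0" using r \<alpha>480 by (simp add: L0_def)
  have l: "0 < l" "L0 \<le> l" using L0 apow by (auto simp: l_def)
  have xT: "dist (ctr T) x < 30 * r" "dist z' x < 30 * r'"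
    using dist_ctr[OF lat(1) x] dist_ctr[OF lat(2), of x] T(4) x by (auto simp: r_def r'_def z'_def)
  have E[measurable]: "E \<in> sets borel" by (simp add: E_def)
  define E1 where "E1 = E \<inter> cube x (a * r)"
  define E2 where "E2 = E \<inter> dball \<alpha> T - cube x (a * r)"
  define E3 where "E3 = dball \<alpha> T' - dball \<alpha> T"
  define E4 where "E4 = E \<inter> cube z' L0 - dball \<alpha> T'"
  define E5 where "E5 = E \<inter> cube z' (a ^ (q + 1) * L0) - cube z' L0"
  define E6 where "E6 = E - cube z' (a ^ (q + 1) * L0)"
  have meas: "E1 \<in> sets borel" "E2 \<in> sets borel" "E3 \<in> sets borel"
    "E4 \<in> sets borel" "E5 \<in> sets borel" "E6 \<in> sets borel"
    by (simp_all add: E1_def E2_def E3_def E4_def E5_def E6_def)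
  let ?m = "riesz_mass n \<mu> x"
  have far: "w \<notin> cube z' t \<Longrightarrow> t / 2 < dist z' w" for w t
    using infnorm_le_dist[of w z'] by (simp add: mem_cube dist_commute)
  have far': "dist z' w / 2 \<le> dist x w" if "\<alpha> * r' \<le> dist z' w" for w
  proof -
    have "480 * r' \<le> \<alpha> * r'" using \<alpha>480 r by simp
    then show ?thesis using that r xT(2) dist_triangle[of z' w x] by linarith
  qed
  note [measurable] = meas
  have m1: "?m E1 \<le> ennreal (chain_const n G 1 a b)"
  proof (rule riesz_mass_chain[OF a s, where y = x and k = \<kappa>])
    show "E1 \<subseteq> cube x (a ^ (\<kappa> + 1) * s) - cube x s"
      using apow[of \<kappa>] cube_mono[of s "2 * s" x] s by (auto simp: E1_def E_def s_def)
    show "1 * infnorm (w - x) \<le> dist x w" for w using infnorm_le_dist[of w x] by (simp add: dist_commute)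
    \<comment> \<open>The chain counts upwards from the small cube, whereas \<open>low\<close>
      counts downwards from \<open>rad T\<close>: step i is the side r/a^(\<kappa> - i).\<close>
    fix i assume i: "1 \<le> i" "i < \<kappa>"
    have eq: "a ^ i * s = r / a ^ (\<kappa> - i)" using i a unfolding s_def by (simp add: power_diff)
    have "\<not> doubling_cube \<mu> a b x (a ^ i * s)" using low[of "\<kappa> - i"] i unfolding eq r_def by simp
    moreover have "x \<in> msupp \<mu>" using pts_subset_dball[OF lat(1)] x by auto
    then have "0 < emeasure \<mu> (cube x (a ^ i * s))" using s apow by (intro emeasure_cube_pos) auto
    ultimately show "ennreal b * emeasure \<mu> (cube x (a ^ i * s)) \<le> emeasure \<mu> (cube x (a ^ (i + 1) * s))"
      using s apow by (auto simp: doubling_cube_def doubling_def mult.assoc)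
  qed auto
  have m2: "?m E2 \<le> ennreal (G * (4 * \<alpha>) powr n)"
  proof -
    have "?m E2 \<le> ennreal (G * (2 * (\<alpha> * r) / (r / 2)) powr n)"
    proof (rule riesz_mass_le_cube)
      show "E2 \<subseteq> cube (ctr T) (2 * (\<alpha> * r))"
        using ball_subset_cube unfolding E2_def dball_def r_def by blast
      fix w assume "w \<in> E2"
      then have "a * r / 2 < infnorm (w - x)" by (simp add: E2_def mem_cube)
      moreover have "r \<le> a * r" using a r by simp
      ultimately show "r / 2 \<le> dist x w" using infnorm_le_dist[of w x] unfolding dist_commute[of x] by linarith
    qed (use r \<alpha>480 in auto)
    also have "2 * (\<alpha> * r) / (r / 2) = 4 * \<alpha>" using r by simp
    finally show ?thesis .
  qed
  have m3: "?m E3 \<le> ennreal (2 powr n) * riesz_mass n \<mu> (ctr T) E3"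
  proof (rule riesz_mass_center_change)
    fix w assume "w \<in> E3"
    then have w: "\<alpha> * r \<le> dist (ctr T) w" by (simp add: E3_def dball_def r_def)
    have "480 * r \<le> \<alpha> * r" using \<alpha>480 r by simp
    then show "0 < dist (ctr T) w" "dist (ctr T) w \<le> 2 * dist x w"
      using w r xT(1) dist_triangle[of "ctr T" w x] by linarith+
  qed auto
  have m4: "?m E4 \<le> ennreal (G * 4 powr n)"
  proof -
    have "?m E4 \<le> ennreal (G * (L0 / (\<alpha> * r' / 2)) powr n)"
    proof (rule riesz_mass_le_cube)
      show "E4 \<subseteq> cube z' L0" by (auto simp: E4_def)
      fix w assume "w \<in> E4"
      then have w: "\<alpha> * r' \<le> dist z' w" by (simp add: E4_def dball_def r'_def z'_def)
      then show "\<alpha> * r' / 2 \<le> dist x w" using far'[OF w] by simp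
    qed (use L0 r \<alpha>480 in auto)
    also have "L0 / (\<alpha> * r' / 2) = 4" using r \<alpha>480 by (simp add: L0_def)
    finally show ?thesis .
  qed
  have m5: "?m E5 \<le> ennreal (chain_const n G (1 / 2) a b)"
  proof (rule riesz_mass_chain[OF a L0, where y = z' and k = q])
    show "E5 \<subseteq> cube z' (a ^ (q + 1) * L0) - cube z' L0" by (auto simp: E5_def)
    show "1 / 2 * infnorm (w - z') \<le> dist x w" if "w \<in> E5" for w
    proof -
      have "L0 / 2 < dist z' w" using that far by (auto simp: E5_def)
      then have "dist z' w / 2 \<le> dist x w" by (intro far') (simp add: L0_def)
      then show ?thesis using infnorm_le_dist[of w z'] by (simp add: dist_commute)
    qed
    show "ennreal b * emeasure \<mu> (cube z' (a ^ i * L0)) \<le> emeasure \<mu> (cube z' (a ^ (i + 1) * L0))"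
      if "i < q" for i
      using high[OF that] by (simp add: L0_def z'_def r'_def)
  qed auto
  have m6: "?m E6 \<le> ennreal (G * 8 powr n)"
  proof -
    have "?m E6 \<le> ennreal (G * (2 * l / (l / 4)) powr n)"
    proof (rule riesz_mass_le_cube)
      show "E6 \<subseteq> cube z' (2 * l)" by (auto simp: E6_def E_def)
      fix w assume "w \<in> E6"
      then have "w \<notin> cube z' (a * l)" by (simp add: E6_def l_def mult.assoc)
      then have "a * l / 2 < dist z' w" by (rule far)
      moreover have "l \<le> a * l" using a l by simp
      ultimately have w: "l / 2 < dist z' w" by linarith
      then have "\<alpha> * r' \<le> dist z' w" using l(2) by (simp add: L0_def)
      then show "l / 4 \<le> dist x w" using far' w by fastforce
    qed (use l in auto)
    also have "2 * l / (l / 4) = 8" using l by simp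
    finally show ?thesis .
  qed
  have cover: "E \<subseteq> E1 \<union> (E2 \<union> (E3 \<union> (E4 \<union> (E5 \<union> E6))))"
    by (auto simp: E1_def E2_def E3_def E4_def E5_def E6_def)
  have "?m E \<le> ?m E1 + ?m (E2 \<union> (E3 \<union> (E4 \<union> (E5 \<union> E6))))"
    by (rule riesz_mass_Un[OF cover]) (simp_all add: meas E)
  also have "\<dots> \<le> ?m E1 + (?m E2 + ?m (E3 \<union> (E4 \<union> (E5 \<union> E6))))"
    by (intro add_left_mono riesz_mass_Un order_refl) (simp_all add: meas)
  also have "\<dots> \<le> ?m E1 + (?m E2 + (?m E3 + ?m (E4 \<union> (E5 \<union> E6))))"
    by (intro add_left_mono riesz_mass_Un order_refl) (simp_all add: meas)
  also have "\<dots> \<le> ?m E1 + (?m E2 + (?m E3 + (?m E4 + ?m (E5 \<union> E6))))"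
    by (intro add_left_mono riesz_mass_Un order_refl) (simp_all add: meas)
  also have "\<dots> \<le> ?m E1 + (?m E2 + (?m E3 + (?m E4 + (?m E5 + ?m E6))))"
    by (intro add_left_mono riesz_mass_Un order_refl) (simp_all add: meas)
  also have "\<dots> \<le> ennreal (chain_const n G 1 a b) + (ennreal (G * (4 * \<alpha>) powr n) +
      (ennreal (2 powr n) * riesz_mass n \<mu> (ctr T) E3 + (ennreal (G * 4 powr n) +
      (ennreal (chain_const n G (1 / 2) a b) + ennreal (G * 8 powr n)))))"
    by (intro add_mono m1 m2 m3 m4 m5 m6)
  finally have mE: "?m E \<le> ennreal (chain_const n G 1 a b) + (ennreal (G * (4 * \<alpha>) powr n) +
      (ennreal (2 powr n) * riesz_mass n \<mu> (ctr T) E3 + (ennreal (G * 4 powr n) +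
      (ennreal (chain_const n G (1 / 2) a b) + ennreal (G * 8 powr n)))))" .
  have sum_eq: "1 + (ennreal c1 + (ennreal c2 + (t + (ennreal c3 + (ennreal c4 + ennreal c5)))))
      = ennreal (1 + c1 + c2 + c3 + c4 + c5) + t"
    if "0 \<le> c1" "0 \<le> c2" "0 \<le> c3" "0 \<le> c4" "0 \<le> c5" for c1 c2 c3 c4 c5 t
    using that by (simp add: add_ac)
  have "1 + ?m E \<le> ennreal (1 + chain_const n G 1 a b + G * (4 * \<alpha>) powr n + G * 4 powr n
      + chain_const n G (1 / 2) a b + G * 8 powr n) + ennreal (2 powr n) * riesz_mass n \<mu> (ctr T) E3"
    using add_left_mono[OF mE, of 1] G_pos a chain_const_nonneg[of a b]
    by (subst (asm) sum_eq) auto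
  also have "\<dots> \<le> ennreal (atom_const n G \<alpha> a b) * 1 + ennreal (atom_const n G \<alpha> a b) * riesz_mass n \<mu> (ctr T) E3"
    using G_pos a chain_const_nonneg[of a b]
    by (intro add_mono mult_right_mono) (auto simp: atom_const_def intro!: ennreal_leI)
  also have "\<dots> = ennreal (atom_const n G \<alpha> a b) * dm_delta n \<mu> \<alpha> T T'"
    by (simp add: dm_delta_def E3_def distrib_left)
  finally show ?thesis
    unfolding cube_delta_def E_def s_def r_def z'_def l_def L0_def r'_def .
qed

text \<open>Almost every point of \<open>T\<close> is the center of a doubling cube of side at most
  \<open>rad T\<close>. A Besicovitch subfamily of such cubes stays in the ball \<alpha> B of
  \<open>T\<close>, of mass at most C0 times that of \<open>T\<close>, and each average is compared
  with \<open>F\<close>. The quantifier order makes one \<open>F\<close> serve all descendants of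
  \<open>T'\<close>.\<close>

lemma nn_integral_atom_le:
  assumes \<alpha>: "480 * sqrt CARD('d) \<le> \<alpha>" and a: "1 < a" "a ^ CARD('d) < b"
    and T': "T' \<in> S k'" and f: "loc_integrable \<mu> f"
  shows "\<exists>F. \<forall>k. \<forall>T\<in>S k. k' \<le> k \<longrightarrow> pts T \<subseteq> pts T' \<longrightarrow>
    (\<integral>\<^sup>+y\<in>pts T. ennreal \<bar>f y - F\<bar> \<partial>\<mu>)
      \<le> ennreal ((1 + atom_const n G \<alpha> a b) * 2 ^ CARD('d) * C0) * RBMO_norm n a b \<mu> f
          * dm_delta n \<mu> \<alpha> T T' * emeasure \<mu> (pts T)"
proof -
  define L0 z' where "L0 = 2 * \<alpha> * rad T'" and "z' = ctr T'"
  have lat': "T' \<in> L" using T' level_lattice by auto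
  have sqrt: "1 \<le> sqrt CARD('d)" by simp
  have \<alpha>480: "480 \<le> \<alpha>" using \<alpha> sqrt by linarith
  have r': "0 < rad T'" by (rule rad_pos[OF lat'])
  have L0: "0 < L0" using r' \<alpha>480 by (simp add: L0_def)
  have "0 < emeasure \<mu> (dball 1 T')" using level_doubling[OF T'] by (simp add: doubling_def)
  also have "\<dots> \<le> emeasure \<mu> (cube z' L0)"
  proof (intro emeasure_mono)
    have "2 * rad T' \<le> L0" using \<alpha>480 r' by (simp add: L0_def)
    then show "dball 1 T' \<subseteq> cube z' L0"
      using ball_subset_cube[of z' "rad T'"] cube_mono[of "2 * rad T'" L0 z'] by (auto simp: dball_def z'_def)
  qed simp
  finally have pos: "0 < emeasure \<mu> (cube z' L0)" .
  have an: "a powr n < b" by (rule power_lt_imp_powr_lt[OF a pos L0])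
  obtain q where q: "doubling_cube \<mu> a b z' (a ^ q * L0)"
    "\<And>i. i < q \<Longrightarrow> ennreal b * emeasure \<mu> (cube z' (a ^ i * L0)) \<le> emeasure \<mu> (cube z' (a ^ (i + 1) * L0))"
    using ex_doubling_cube_above[OF a(1) an L0 pos] by blast
  \<comment> \<open>The average over the first doubling dilate of the cube circumscribed about
    \<alpha> B of \<open>T'\<close>; it does not refer to \<open>T\<close>.\<close>
  define F where "F = avg \<mu> (cube z' (a ^ q * L0)) f"
  define N where "N = RBMO_norm n a b \<mu> f"
  have "(\<integral>\<^sup>+y\<in>pts T. ennreal \<bar>f y - F\<bar> \<partial>\<mu>)
      \<le> ennreal ((1 + atom_const n G \<alpha> a b) * 2 ^ CARD('d) * C0) * N * dm_delta n \<mu> \<alpha> T T' * emeasure \<mu> (pts T)"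
    if T: "T \<in> S k" "k' \<le> k" "pts T \<subseteq> pts T'" for T k
  proof -
    have lat: "T \<in> L" using T level_lattice by auto
    define r where "r = rad T"
    have r: "0 < r" "r \<le> rad T'" using rad_pos[OF lat] rad_le_of_descendant[OF T(1) T' T(2,3)] by (auto simp: r_def)
    \<comment> \<open>The first doubling scale going down from \<open>r\<close>. Its doubling
      property holds only on the set \<open>A\<close> defined next, where such a scale
      exists.\<close>
    define \<kappa> where "\<kappa> x = (LEAST k. doubling_cube \<mu> a b x (r / a ^ k))" for x
    define A where "A = {x \<in> pts T. \<exists>k. doubling_cube \<mu> a b x (r / a ^ k)}"
    define s where "s x = r / a ^ \<kappa> x" for x
    have s: "0 < s x" "s x \<le> r" for x using r a by (auto simp: s_def field_simps)
    have \<kappa>: "doubling_cube \<mu> a b x (s x)" if "x \<in> A" for x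
      using that unfolding A_def s_def \<kappa>_def by (auto intro: LeastI)
    have \<kappa>': "\<not> doubling_cube \<mu> a b x (r / a ^ i)" if "i < \<kappa> x" for x i
      using that unfolding \<kappa>_def by (rule not_less_Least)
    obtain X where X: "X \<subseteq> A" "countable X" "A \<subseteq> (\<Union>x\<in>X. cube x (s x))"
      "\<And>y. finite {x \<in> X. y \<in> cube x (s x)} \<and> card {x \<in> X. y \<in> cube x (s x)} \<le> 2 ^ CARD('d)"
      using besicovitch_cubes[OF r(1) a(1), of A \<kappa>] unfolding s_def by blast
    define \<delta> where "\<delta> = dm_delta n \<mu> \<alpha> T T'"
    define \<Delta> where "\<Delta> = ennreal (atom_const n G \<alpha> a b) * \<delta>"
    have "\<delta> < \<infinity>" unfolding \<delta>_def by (rule dm_delta_finite[OF T(1)])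
    then have \<Delta>: "\<Delta> < \<infinity>" by (simp add: \<Delta>_def ennreal_mult_less_top)
    have [measurable]: "f \<in> borel_measurable \<mu>" using f by (rule loc_integrable_measurable)
    have "(\<integral>\<^sup>+y\<in>pts T. ennreal \<bar>f y - F\<bar> \<partial>\<mu>) \<le> (N + N * \<Delta>) * (of_nat (2 ^ CARD('d)) * emeasure \<mu> (dball \<alpha> T))"
    proof (rule nn_integral_covering[OF X(2) _ _ _ _ X(4)])
      fix x assume "x \<in> X"
      then have x: "x \<in> A" "x \<in> pts T" using X(1) by (auto simp: A_def)
      \<comment> \<open>The centers are within 30 r of \<open>ctr T\<close>, and the cubes reach at
        most sqrt(d) r further. The size of \<alpha> leaves room for both.\<close>
      show "cube x (s x) \<subseteq> dball \<alpha> T"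
      proof
        fix w assume "w \<in> cube x (s x)"
        then have "w \<in> cball x (sqrt CARD('d) * s x / 2)" using cube_subset_cball[of x "s x"] by blast
        moreover have "sqrt CARD('d) * s x \<le> sqrt CARD('d) * r" "0 \<le> sqrt CARD('d) * s x"
          using s[of x] by (auto intro: mult_left_mono)
        ultimately have "dist x w \<le> sqrt CARD('d) * r" unfolding mem_cball by linarith
        then have "dist (ctr T) w < 30 * r + sqrt CARD('d) * r"
          using dist_ctr[OF lat x(2)] dist_triangle[of "ctr T" w x] by (simp add: r_def)
        also have "\<dots> \<le> 480 * sqrt CARD('d) * r"
        proof -
          have "1 * r \<le> sqrt CARD('d) * r" using sqrt r by (intro mult_right_mono) auto
          then have "30 * r + sqrt CARD('d) * r \<le> 480 * (sqrt CARD('d) * r)" using r by linarith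
          then show ?thesis by (simp only: mult.assoc)
        qed
        also have "\<dots> \<le> \<alpha> * r" using \<alpha> r by (intro mult_right_mono) auto
        finally show "w \<in> dball \<alpha> T" by (simp add: dball_def r_def)
      qed
      have sub: "cube x (s x) \<subseteq> cube z' (a ^ q * L0)"
      proof -
        have "infnorm (x - z') < 30 * rad T'"
          using dist_ctr[OF lat', of x] x(2) T(3) infnorm_le_dist[of x z'] by (auto simp: z'_def dist_commute)
        moreover have "480 * rad T' \<le> \<alpha> * rad T'" using \<alpha>480 r' by simp
        ultimately have "cube x (s x) \<subseteq> cube z' L0"
          using s[of x] r by (intro cube_subset, unfold L0_def, linarith)
        also have "\<dots> \<subseteq> cube z' (a ^ q * L0)" using a L0 by (intro cube_mono) simp
        finally show ?thesis .
      qed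
      have delta: "cube_delta n \<mu> x (s x) z' (a ^ q * L0) \<le> \<Delta>"
        unfolding s_def r_def z'_def L0_def \<Delta>_def \<delta>_def
        by (rule cube_delta_le_dm_delta[OF \<alpha> a(1) an T(1) T' T(2,3) x(2)])
          (use \<kappa>' q(2) in \<open>auto simp: r_def z'_def L0_def\<close>)
      have "0 < emeasure \<mu> (cube x (s x))" using \<kappa>[OF x(1)] by (simp add: doubling_cube_def doubling_def)
      then have "(\<integral>\<^sup>+y\<in>cube x (s x). ennreal \<bar>f y - F\<bar> \<partial>\<mu>)
          \<le> (ennreal (osc \<mu> (cube x (s x)) f) + ennreal \<bar>avg \<mu> (cube x (s x)) f - F\<bar>) * emeasure \<mu> (cube x (s x))"
        by (intro nn_integral_le_osc f compact_imp_bounded compact_cube) auto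
      also have "\<dots> \<le> (N + N * \<Delta>) * emeasure \<mu> (cube x (s x))"
        unfolding N_def F_def
        by (intro mult_right_mono add_mono osc_le_RBMO_norm avg_diff_le_RBMO_norm \<kappa> x q(1) sub delta \<Delta>) simp
      finally show "(\<integral>\<^sup>+y\<in>cube x (s x). ennreal \<bar>f y - F\<bar> \<partial>\<mu>) \<le> (N + N * \<Delta>) * emeasure \<mu> (cube x (s x))" .
    next
      have "AE x in \<mu>. \<exists>k. doubling_cube \<mu> a b x (r / a ^ k)"
        by (rule AE_ex_doubling_cube_below[OF a r(1) AE_msupp])
      then show "AE y in \<mu>. y \<in> pts T \<longrightarrow> y \<in> (\<Union>x\<in>X. cube x (s x))"
        by eventually_elim (use X(3) in \<open>auto simp: A_def\<close>)
    qed auto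
    also have "\<dots> \<le> (N * \<delta> + N * \<Delta>) * (of_nat (2 ^ CARD('d)) * (ennreal C0 * emeasure \<mu> (pts T)))"
    proof (intro mult_mono add_mono emeasure_dball_le[OF T(1)] order_refl)
      have "N * 1 \<le> N * \<delta>" by (intro mult_left_mono) (auto simp: \<delta>_def dm_delta_def)
      then show "N \<le> N * \<delta>" by simp
    qed auto
    also have "\<dots> = ennreal ((1 + atom_const n G \<alpha> a b) * 2 ^ CARD('d) * C0) * N * \<delta> * emeasure \<mu> (pts T)"
    proof -
      have "0 \<le> atom_const n G \<alpha> a b"
        using G_pos a an chain_const_nonneg[of a b] by (simp add: atom_const_def)
      then have "ennreal ((1 + atom_const n G \<alpha> a b) * 2 ^ CARD('d) * C0)
          = (1 + ennreal (atom_const n G \<alpha> a b)) * of_nat (2 ^ CARD('d)) * ennreal C0"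
        using params by (simp add: ennreal_mult ennreal_power[symmetric])
      then show ?thesis by (simp add: \<Delta>_def distrib_left distrib_right ac_simps)
    qed
    finally show ?thesis by (simp add: \<delta>_def)
  qed
  then show ?thesis unfolding N_def by blast
qed

text \<open>The factor 4 is 2 + 2. For the oscillation, 2 is the price of replacing the mean by
  \<open>F\<close>; for the differences there is one \<open>N\<close> for each of the two
  averages.\<close>

lemma star_norm_le_RBMO_norm:
  assumes \<alpha>: "480 * sqrt CARD('d) \<le> \<alpha>" and a: "1 < a" "a ^ CARD('d) < b" and f: "loc_integrable \<mu> f"
  shows "RBMO_star_norm n \<mu> \<alpha> S f
    \<le> ennreal (4 * ((1 + atom_const n G \<alpha> a b) * 2 ^ CARD('d) * C0)) * RBMO_norm n a b \<mu> f"
proof -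
  define N where "N = ennreal ((1 + atom_const n G \<alpha> a b) * 2 ^ CARD('d) * C0) * RBMO_norm n a b \<mu> f"
  have self: "dm_delta n \<mu> \<alpha> T T = 1" for T by (simp add: dm_delta_def)
  have bounds: "ennreal (osc \<mu> (pts Q) f) \<le> 2 * (N * dm_delta n \<mu> \<alpha> Q R)"
      "ennreal \<bar>avg \<mu> (pts Q) f - F\<bar> \<le> N * dm_delta n \<mu> \<alpha> Q R"
    if Q: "Q \<in> S k" and F: "(\<integral>\<^sup>+y\<in>pts Q. ennreal \<bar>f y - F\<bar> \<partial>\<mu>) \<le> N * dm_delta n \<mu> \<alpha> Q R * emeasure \<mu> (pts Q)" for Q R F k
  proof -
    note Q' = f pts_borel[OF level_lattice[OF Q]] bounded_pts[OF level_lattice[OF Q]] emeasure_pts_pos[OF Q]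
    note pos = emeasure_pts_pos[OF Q] emeasure_pts_finite[OF Q]
    have "ennreal (osc \<mu> (pts Q) f) * emeasure \<mu> (pts Q) \<le> 2 * (N * dm_delta n \<mu> \<alpha> Q R * emeasure \<mu> (pts Q))"
      by (rule order_trans[OF osc_le[OF Q', where c = F]]) (intro mult_left_mono F, simp)
    then have "ennreal (osc \<mu> (pts Q) f) * emeasure \<mu> (pts Q) \<le> 2 * (N * dm_delta n \<mu> \<alpha> Q R) * emeasure \<mu> (pts Q)"
      by (simp only: mult.assoc)
    then show "ennreal (osc \<mu> (pts Q) f) \<le> 2 * (N * dm_delta n \<mu> \<alpha> Q R)"
      by (rule ennreal_le_of_mult_le[OF _ pos])
    show "ennreal \<bar>avg \<mu> (pts Q) f - F\<bar> \<le> N * dm_delta n \<mu> \<alpha> Q R"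
      by (rule ennreal_le_of_mult_le[OF order_trans[OF avg_diff_le[OF Q'] F] pos])
  qed
  have "ennreal (osc \<mu> (pts Q) f) \<le> 2 * N" if Q: "Q \<in> S k" for Q k
  proof -
    obtain F where F: "\<forall>k'. \<forall>T\<in>S k'. k \<le> k' \<longrightarrow> pts T \<subseteq> pts Q \<longrightarrow>
        (\<integral>\<^sup>+y\<in>pts T. ennreal \<bar>f y - F\<bar> \<partial>\<mu>) \<le> N * dm_delta n \<mu> \<alpha> T Q * emeasure \<mu> (pts T)"
      using nn_integral_atom_le[OF \<alpha> a Q f] unfolding N_def by (rule exE)
    show ?thesis using bounds(1)[OF Q F[rule_format, OF Q]] by (simp add: self)
  qed
  then have 1: "(SUP Q\<in>(\<Union>k. S k). ennreal (osc \<mu> (pts Q) f)) \<le> 2 * N" by (intro SUP_least) auto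
  have "ennreal \<bar>avg \<mu> (pts Q) f - avg \<mu> (pts R) f\<bar> / dm_delta n \<mu> \<alpha> Q R \<le> 2 * N"
    if Q: "Q \<in> S k" and R: "R \<in> S (k - int j)" and sub: "pts Q \<subseteq> pts R" for Q R k j
  proof (rule ennreal_divide_le_of_le_mult)
    obtain F where F: "\<forall>k'. \<forall>T\<in>S k'. k - int j \<le> k' \<longrightarrow> pts T \<subseteq> pts R \<longrightarrow>
        (\<integral>\<^sup>+y\<in>pts T. ennreal \<bar>f y - F\<bar> \<partial>\<mu>) \<le> N * dm_delta n \<mu> \<alpha> T R * emeasure \<mu> (pts T)"
      using nn_integral_atom_le[OF \<alpha> a R f] unfolding N_def by (rule exE)
    have "ennreal \<bar>avg \<mu> (pts Q) f - avg \<mu> (pts R) f\<bar> \<le> ennreal (\<bar>avg \<mu> (pts Q) f - F\<bar> + \<bar>avg \<mu> (pts R) f - F\<bar>)"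
      by (intro ennreal_leI) linarith
    also have "\<dots> = ennreal \<bar>avg \<mu> (pts Q) f - F\<bar> + ennreal \<bar>avg \<mu> (pts R) f - F\<bar>" by simp
    also have "\<dots> \<le> N * dm_delta n \<mu> \<alpha> Q R + N * dm_delta n \<mu> \<alpha> R R"
      using bounds(2)[OF Q F[rule_format, OF Q _ sub]] bounds(2)[OF R F[rule_format, OF R]] by (intro add_mono) auto
    also have "\<dots> \<le> N * dm_delta n \<mu> \<alpha> Q R + N * dm_delta n \<mu> \<alpha> Q R"
      unfolding self by (intro add_mono mult_left_mono) (auto simp: dm_delta_def)
    also have "\<dots> = 2 * N * dm_delta n \<mu> \<alpha> Q R" by (simp add: mult.assoc flip: mult_2)
    finally show "ennreal \<bar>avg \<mu> (pts Q) f - avg \<mu> (pts R) f\<bar> \<le> 2 * N * dm_delta n \<mu> \<alpha> Q R" .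
    show "1 \<le> dm_delta n \<mu> \<alpha> Q R" by (simp add: dm_delta_def)
  qed
  then have 2: "(SUP (Q, R) \<in> {(Q, R). \<exists>k. \<exists>j::nat. 0 < j \<and> Q \<in> S k \<and> R \<in> S (k - int j) \<and> pts Q \<subseteq> pts R}.
        ennreal \<bar>avg \<mu> (pts Q) f - avg \<mu> (pts R) f\<bar> / dm_delta n \<mu> \<alpha> Q R) \<le> 2 * N"
    by (intro SUP_least) auto
  have "RBMO_star_norm n \<mu> \<alpha> S f \<le> 2 * N + 2 * N"
    unfolding RBMO_star_norm_def using 1 2 by (rule add_mono)
  also have "\<dots> = ennreal 4 * N" by (simp flip: distrib_right)
  also have "\<dots> = ennreal (4 * ((1 + atom_const n G \<alpha> a b) * 2 ^ CARD('d) * C0)) * RBMO_norm n a b \<mu> f"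
    unfolding N_def by (simp add: ennreal_mult' mult.assoc)
  finally show ?thesis .
qed

end

section \<open>The mean over a cube bounded by the starred norm of one filtration\<close>

lemma ex_scale:
  fixes A C \<sigma> :: real
  assumes "1 < A" "0 < C" "0 < \<sigma>"
  obtains g :: int where "C * A powi (- g) \<le> \<sigma>" "\<sigma> < C * A powi (- (g - 1))"
proof -
  define g where "g = \<lceil>log A (C / \<sigma>)\<rceil>"
  have g: "log A (C / \<sigma>) \<le> g" "g - 1 < log A (C / \<sigma>)" unfolding g_def by linarith+
  have "C / \<sigma> \<le> A powr g" using g(1) assms by (subst (asm) log_le_iff) auto
  then have "C * A powi (- g) \<le> \<sigma>"
    using assms by (simp add: powr_real_of_int' power_int_minus field_simps)
  moreover have "A powr (g - 1) < C / \<sigma>" using g(2) assms by (subst powr_less_iff) auto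
  then have "A powi (g - 1) < C / \<sigma>" using assms powr_real_of_int'[of A "g - 1"] by simp
  then have "\<sigma> < C * A powi (- (g - 1))"
    using assms unfolding power_int_minus by (simp add: field_simps)
  ultimately show thesis by (rule that)
qed

text \<open>The terms after 1 bound the Riesz mass between a small atom and its father, and on
  \<open>E1\<close>, \<open>E2\<close> and \<open>E3\<close> in \<open>nn_integral_cube_le\<close>.
  \<open>D\<close> stands for sqrt(d), and 4 / 7 is 2 * 120 / 420 with the constants of
  \<open>\<sigma>\<close> and \<open>\<rho>\<close> there.\<close>

definition cube_const :: "real \<Rightarrow> real \<Rightarrow> real \<Rightarrow> real \<Rightarrow> real \<Rightarrow> real \<Rightarrow> real \<Rightarrow> real" where
  "cube_const n G D c C0 a t = 1 + max c 0 + G * (4 / 7 * C0 / min 1 (a - 1)) powr n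
    + (4 * D) powr n + chain_const n G (1 / 4) t C0"

context doubling_filtration
begin

text \<open>The cube is covered by the disjoint stopping atoms of a scale slightly below
  \<open>l\<close>; they stay in the dilate by \<open>a\<close>, whose mass is at most b times as
  large. Each stopping atom \<open>W\<close> is compared with \<open>T\<close> by way of its father
  \<open>P\<close>: from \<open>W\<close> to \<open>P\<close> at cost \<open>c\<close>, and outside
  the ball \<alpha> B of \<open>P\<close> by the distance estimate \<open>far\<close>.\<close>

lemma nn_integral_cube_le:
  assumes \<alpha>: "480 \<le> \<alpha>" and a: "1 < a" and t: "1 < t" "t powr n < C0" and f: "loc_integrable \<mu> f"
    and T: "T \<in> S kT" and T_scale: "sqrt CARD('d) * m / 2 \<le> Ct * A0 powi (- gen T)"
    and T_ball: "dball \<alpha> T \<subseteq> cube y0 (t ^ (q + 1) * m)"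
    and T_cover: "AE y in \<mu>. y \<in> cube y0 m \<longrightarrow> y \<in> pts T"
    and grow: "\<And>i. i < q \<Longrightarrow> ennreal C0 * emeasure \<mu> (cube y0 (t ^ i * m)) \<le> emeasure \<mu> (cube y0 (t ^ (i + 1) * m))"
    and Q: "doubling_cube \<mu> a b x l" "cube x l \<subseteq> cube y0 m"
  shows "(\<integral>\<^sup>+y\<in>cube x l. ennreal \<bar>f y - avg \<mu> (pts T) f\<bar> \<partial>\<mu>)
    \<le> ennreal ((1 + cube_const n G (sqrt CARD('d)) c C0 a t) * b) * RBMO_star_norm n \<mu> \<alpha> S f
        * cube_delta n \<mu> x l y0 m * emeasure \<mu> (cube x l)"
proof -
  define s where "s = RBMO_star_norm n \<mu> \<alpha> S f"
  define F where "F = avg \<mu> (pts T) f"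
  define e where "e = min 1 (a - 1)"
  have e: "0 < e" "e \<le> 1" "e \<le> a - 1" using a by (auto simp: e_def)
  \<comment> \<open>Atoms of radius at most \<open>\<sigma>\<close> have diameter at most 60
    \<sigma>, hence at most half of l and of l (a - 1). The latter keeps them inside
    \<open>cube x (a * l)\<close>.\<close>
  define \<sigma> where "\<sigma> = l * e / 120"
  have l: "0 < l" using Q(1) by (simp add: doubling_cube_def)
  have lm: "l \<le> m" using cube_subset_side[OF Q(2)] l by simp
  have m: "0 < m" using l lm by simp
  have "l * e \<le> l * 1" "l * e \<le> l * (a - 1)" using l e by (auto intro: mult_left_mono)
  then have \<sigma>: "0 < \<sigma>" "120 * \<sigma> \<le> l" "120 * \<sigma> \<le> l * (a - 1)" using l e by (auto simp: \<sigma>_def)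
  obtain g where g: "Ct * A0 powi (- g) \<le> \<sigma>" "\<sigma> < Ct * A0 powi (- (g - 1))"
    using ex_scale[of A0 Ct \<sigma>] params \<sigma>(1) by auto
  have sqrt: "1 \<le> sqrt CARD('d)" by simp
  \<comment> \<open>Hence \<open>T\<close> lies above every stopping atom that it meets, and
    contains it.\<close>
  have gT: "gen T < g"
  proof (rule scale_less_imp_gen_less)
    have "1 * m \<le> sqrt CARD('d) * m" using m sqrt by (intro mult_right_mono) auto
    then show "Ct * A0 powi (- g) < Ct * A0 powi (- gen T)"
      using g(1) \<sigma> lm l T_scale by linarith
  qed
  define I where "I = {W \<in> maximal_atoms g. pts W \<inter> cube x l \<inter> pts T \<noteq> {}}"
  define \<delta> where "\<delta> = cube_delta n \<mu> x l y0 m"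
  define \<Delta> where "\<Delta> = ennreal (cube_const n G (sqrt CARD('d)) c C0 a t) * \<delta>"
  have \<delta>: "1 \<le> \<delta>" by (simp add: \<delta>_def cube_delta_def)
  have "riesz_mass n \<mu> x (cube y0 (2 * m) - cube x (2 * l)) \<le> ennreal (G * (2 * m / l) powr n)"
  proof (rule riesz_mass_le_cube)
    show "cube y0 (2 * m) - cube x (2 * l) \<subseteq> cube y0 (2 * m)" by blast
    fix w assume "w \<in> cube y0 (2 * m) - cube x (2 * l)"
    then show "l \<le> dist x w" using infnorm_le_dist[of w x] by (simp add: mem_cube dist_commute)
  qed (use l m in auto)
  then have "\<delta> < \<infinity>" unfolding \<delta>_def cube_delta_def by (auto simp: le_less_trans)
  then have \<Delta>: "\<Delta> < \<infinity>" by (simp add: \<Delta>_def ennreal_mult_less_top)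
  have chain0: "0 \<le> chain_const n G (1 / 4) t C0" using t by (intro chain_const_nonneg) auto
  have cc0: "0 \<le> cube_const n G (sqrt CARD('d)) c C0 a t" using G_pos chain0 by (simp add: cube_const_def)
  have [measurable]: "f \<in> borel_measurable \<mu>" using f by (rule loc_integrable_measurable)
  have geometry: "pts W \<subseteq> cube x (a * l)"
      "(\<integral>\<^sup>+y\<in>pts W. ennreal \<bar>f y - F\<bar> \<partial>\<mu>) \<le> (s + s * \<Delta>) * emeasure \<mu> (pts W)"
    if W: "W \<in> I" for W
  proof -
    obtain k P where k: "W \<in> S k" "g \<le> gen W" "P \<in> S (k - 1)" "pts W \<subseteq> pts P" "gen P < g"
      using W unfolding I_def maximal_atoms_def by blast
    obtain p where p: "p \<in> pts W" "p \<in> cube x l" "p \<in> pts T" using W unfolding I_def by blast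
    have lat: "W \<in> L" "P \<in> L" using k level_lattice by auto
    have "kT < k"
    proof (rule ccontr)
      assume "\<not> kT < k"
      then show False using nested(2)[OF T k(1) p(3,1)] gT k(2) by simp
    qed
    then have sub: "pts W \<subseteq> pts T" using nested(1)[OF k(1) T p(1,3)] by simp
    have "rad W \<le> Ct * A0 powi (- gen W)" by (rule rad_upper) fact
    also have "\<dots> \<le> Ct * A0 powi (- g)"
      using params k(2) by (intro mult_left_mono power_int_increasing) auto
    finally have radW: "rad W \<le> \<sigma>" using g(1) by linarith
    \<comment> \<open>The father has generation below \<open>g\<close>, so its radius is bounded
      below in terms of \<open>l\<close>, however small \<open>W\<close> may be.\<close>
    have "\<sigma> / C0 \<le> Ct * A0 powi (- (g - 1)) / C0"
      using g(2) params by (intro divide_right_mono) auto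
    also have "\<dots> \<le> Ct / C0 * A0 powi (- gen P)"
      using params k(5) by (auto intro!: divide_right_mono mult_left_mono power_int_increasing)
    also have "\<dots> \<le> rad P" by (rule rad_lower) fact
    finally have radP: "\<sigma> / C0 \<le> rad P" .
    have WP: "rad W \<le> rad P" using rad_le_of_gen_less[OF lat] k by simp
    have dp: "dist (ctr W) p < 30 * rad W" "dist (ctr P) p < 30 * rad P"
      using dist_ctr[OF lat(1) p(1)] dist_ctr[OF lat(2)] p(1) k(4) by auto
    have ip: "infnorm (p - x) \<le> l / 2" using p(2) by (simp add: mem_cube)
    show "pts W \<subseteq> cube x (a * l)"
    proof
      fix w assume "w \<in> pts W"
      then have "dist (ctr W) w < 30 * rad W" by (rule dist_ctr[OF lat(1)])
      then have "dist w p \<le> 60 * \<sigma>" using dp(1) radW dist_triangle2[of w p "ctr W"] by (simp add: dist_commute)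
      then have "infnorm (w - p) \<le> l * (a - 1) / 2" using infnorm_le_dist[of w p] \<sigma> by linarith
      then show "w \<in> cube x (a * l)"
        using ip infnorm_diff_triangle[of w x p] by (simp add: mem_cube algebra_simps)
    qed
    define z where "z = ctr W"
    have zp: "infnorm (z - p) \<le> l / 4"
      using infnorm_le_dist[of z p] dp(1) radW \<sigma> by (simp add: z_def)
    have zx: "infnorm (z - x) \<le> 3 / 4 * l" using zp ip infnorm_diff_triangle[of z x p] by simp
    have zy: "infnorm (z - y0) \<le> 3 / 4 * m"
      using zp p(2) Q(2) lm infnorm_diff_triangle[of z y0 p] by (auto simp: mem_cube)
    define E where "E = dball \<alpha> T - dball \<alpha> P"
    \<comment> \<open>Here 420 = 480 - 60: points outside \<alpha> B of \<open>P\<close> are at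
      least 480 \<open>rad P\<close> from its center, and \<open>z\<close> is within 60
      \<open>rad P\<close> of it.\<close>
    define \<rho> where "\<rho> = 420 * (\<sigma> / C0)"
    have \<rho>: "0 < \<rho>" using \<sigma> params by (simp add: \<rho>_def)
    have far: "\<rho> \<le> dist z w" if "w \<in> E" for w
    proof -
      have "\<alpha> * rad P \<le> dist (ctr P) w" using that by (simp add: E_def dball_def)
      moreover have "480 * rad P \<le> \<alpha> * rad P" using \<alpha> rad_pos[OF lat(2)] by simp
      moreover have "dist (ctr P) z < 60 * rad P"
        using dp WP dist_triangle2[of "ctr P" z p] by (simp add: z_def)
      ultimately show ?thesis
        using dist_triangle[of "ctr P" w z] radP unfolding \<rho>_def by linarith
    qed
    define E1 where "E1 = E \<inter> cube x (2 * l)"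
    define E2 where "E2 = cube y0 (2 * m) - cube x (2 * l)"
    define E3 where "E3 = E - cube y0 (2 * m)"
    have meas: "E1 \<in> sets borel" "E2 \<in> sets borel" "E3 \<in> sets borel" "E \<in> sets borel"
      by (simp_all add: E1_def E2_def E3_def E_def)
    let ?m = "riesz_mass n \<mu> z"
    have m0: "?m (dball \<alpha> P - dball \<alpha> W) \<le> ennreal (max c 0)"
      unfolding z_def by (rule order_trans[OF riesz_mass_father[OF k(1,3,4)] ennreal_leI]) simp
    have m1: "?m E1 \<le> ennreal (G * (4 / 7 * C0 / e) powr n)"
    proof -
      have "?m E1 \<le> ennreal (G * (2 * l / \<rho>) powr n)"
        by (rule riesz_mass_le_cube[where y = x]) (use l \<rho> far in \<open>auto simp: E1_def\<close>)
      also have "2 * l / \<rho> = 4 / 7 * C0 / e" using l e params by (simp add: \<rho>_def \<sigma>_def)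
      finally show ?thesis .
    qed
    \<comment> \<open>As \<open>z\<close> is within 3/4 l of \<open>x\<close> in the maximum norm,
      passing from \<open>x\<close> to \<open>z\<close> loses a factor 4 there; sqrt(d) is lost in
      returning to the Euclidean norm.\<close>
    have m2: "?m E2 \<le> ennreal ((4 * sqrt CARD('d)) powr n) * riesz_mass n \<mu> x E2"
    proof (rule riesz_mass_center_change)
      fix w assume "w \<in> E2"
      then have w: "l < infnorm (w - x)" by (simp add: E2_def mem_cube)
      then show "0 < dist x w" using l infnorm_le_dist[of w x] unfolding dist_commute[of x] by linarith
      have "infnorm (w - x) \<le> 4 * infnorm (w - z)"
        using infnorm_diff_triangle[of w x z] zx w by linarith
      also have "\<dots> \<le> 4 * dist z w" using infnorm_le_dist[of w z] by (simp add: dist_commute)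
      finally have "infnorm (w - x) \<le> 4 * dist z w" .
      then have "sqrt CARD('d) * infnorm (w - x) \<le> sqrt CARD('d) * (4 * dist z w)"
        by (intro mult_left_mono) auto
      moreover have "sqrt CARD('d) * (4 * dist z w) = 4 * sqrt CARD('d) * dist z w" by simp
      ultimately show "dist x w \<le> 4 * sqrt CARD('d) * dist z w"
        using dist_le_infnorm[of w x] unfolding dist_commute[of x] by linarith
    qed (use meas in auto)
    \<comment> \<open>The part of \<alpha> B of \<open>T\<close> beyond \<open>y0\<close> at scale m
      consists of the non-doubling scales recorded by \<open>grow\<close>, followed by one
      more.\<close>
    have m3: "?m E3 \<le> ennreal (chain_const n G (1 / 4) t C0)"
    proof (rule riesz_mass_chain[OF t m, where y = y0 and k = q])
      show "E3 \<subseteq> cube y0 (t ^ (q + 1) * m) - cube y0 m"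
        using T_ball cube_mono[of m "2 * m" y0] m by (auto simp: E3_def E_def)
      fix w assume "w \<in> E3"
      then have "m < infnorm (w - y0)" by (simp add: E3_def mem_cube)
      then have "infnorm (w - y0) \<le> 4 * infnorm (w - z)"
        using infnorm_diff_triangle[of w y0 z] zy by linarith
      then show "1 / 4 * infnorm (w - y0) \<le> dist z w"
        using infnorm_le_dist[of w z] unfolding dist_commute[of z] by linarith
    qed (use meas grow in auto)
    have "?m (dball \<alpha> T - dball \<alpha> W) \<le> ?m (dball \<alpha> P - dball \<alpha> W) + ?m E"
      by (rule riesz_mass_Un) (use meas in \<open>auto simp: E_def\<close>)
    also have "\<dots> \<le> ?m (dball \<alpha> P - dball \<alpha> W) + (?m E1 + ?m (E2 \<union> E3))"
      by (intro add_left_mono riesz_mass_Un) (use meas in \<open>auto simp: E1_def E2_def E3_def\<close>)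
    also have "\<dots> \<le> ?m (dball \<alpha> P - dball \<alpha> W) + (?m E1 + (?m E2 + ?m E3))"
      by (intro add_left_mono riesz_mass_Un order_refl) (use meas in auto)
    also have "\<dots> \<le> ennreal (max c 0) + (ennreal (G * (4 / 7 * C0 / e) powr n)
        + (ennreal ((4 * sqrt CARD('d)) powr n) * riesz_mass n \<mu> x E2 + ennreal (chain_const n G (1 / 4) t C0)))"
      by (intro add_mono m0 m1 m2 m3)
    finally have mW: "?m (dball \<alpha> T - dball \<alpha> W) \<le> ennreal (max c 0) + (ennreal (G * (4 / 7 * C0 / e) powr n)
        + (ennreal ((4 * sqrt CARD('d)) powr n) * riesz_mass n \<mu> x E2 + ennreal (chain_const n G (1 / 4) t C0)))" .
    have sum_eq: "1 + (ennreal c1 + (ennreal c2 + (u + ennreal c3))) = ennreal (1 + c1 + c2 + c3) + u"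
      if "0 \<le> c1" "0 \<le> c2" "0 \<le> c3" for c1 c2 c3 u
      using that by (simp add: add_ac)
    have "1 + ?m (dball \<alpha> T - dball \<alpha> W)
        \<le> ennreal (1 + max c 0 + G * (4 / 7 * C0 / e) powr n + chain_const n G (1 / 4) t C0)
          + ennreal ((4 * sqrt CARD('d)) powr n) * riesz_mass n \<mu> x E2"
      using add_left_mono[OF mW, of 1] G_pos chain0 by (subst (asm) sum_eq) auto
    also have "\<dots> \<le> ennreal (cube_const n G (sqrt CARD('d)) c C0 a t) * 1 + ennreal (cube_const n G (sqrt CARD('d)) c C0 a t) * riesz_mass n \<mu> x E2"
      using G_pos chain0
      by (intro add_mono mult_right_mono) (auto simp: cube_const_def e_def intro!: ennreal_leI)
    also have "\<dots> = \<Delta>"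
      by (simp add: \<Delta>_def \<delta>_def cube_delta_def E2_def distrib_left)
    finally have delta: "dm_delta n \<mu> \<alpha> W T \<le> \<Delta>" by (simp add: dm_delta_def z_def)
    have "(\<integral>\<^sup>+y\<in>pts W. ennreal \<bar>f y - F\<bar> \<partial>\<mu>)
        \<le> (ennreal (osc \<mu> (pts W) f) + ennreal \<bar>avg \<mu> (pts W) f - F\<bar>) * emeasure \<mu> (pts W)"
      using lat k(1) by (intro nn_integral_le_osc f pts_borel bounded_pts emeasure_pts_pos)
    also have "\<dots> \<le> (s + s * \<Delta>) * emeasure \<mu> (pts W)"
      unfolding F_def s_def
      by (intro mult_right_mono add_mono osc_le_star_norm[OF k(1)]
          avg_diff_le_star_norm[OF k(1) T \<open>kT < k\<close> sub delta \<Delta>]) simp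
    finally show "(\<integral>\<^sup>+y\<in>pts W. ennreal \<bar>f y - F\<bar> \<partial>\<mu>) \<le> (s + s * \<Delta>) * emeasure \<mu> (pts W)" .
  qed
  have I_lat: "W \<in> L" if "W \<in> I" for W
    using that level_lattice unfolding I_def maximal_atoms_def by blast
  have "(\<integral>\<^sup>+y\<in>cube x l. ennreal \<bar>f y - F\<bar> \<partial>\<mu>) \<le> (s + s * \<Delta>) * (of_nat 1 * emeasure \<mu> (cube x (a * l)))"
  proof (rule nn_integral_covering[where E = pts and I = I])
    show "countable I" using countable_lattice I_lat by (auto intro: countable_subset)
    show "AE y in \<mu>. y \<in> cube x l \<longrightarrow> y \<in> (\<Union>W\<in>I. pts W)"
      using AE_maximal_atoms[of g] T_cover
      by eventually_elim (use Q(2) in \<open>auto simp: I_def\<close>)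
    fix y
    have "W = W'" if "W \<in> {W \<in> I. y \<in> pts W}" "W' \<in> {W \<in> I. y \<in> pts W}" for W W'
      using that maximal_atoms_disjoint[of W g W' y] by (auto simp: I_def)
    then have "\<exists>V. {W \<in> I. y \<in> pts W} \<subseteq> {V}" by blast
    then obtain V where "{W \<in> I. y \<in> pts W} \<subseteq> {V}" by blast
    then show "finite {W \<in> I. y \<in> pts W} \<and> card {W \<in> I. y \<in> pts W} \<le> 1"
      using finite_subset[of _ "{V}"] card_mono[of "{V}"] by simp
  qed (use geometry I_lat pts_borel in auto)
  also have "\<dots> \<le> (s * \<delta> + s * \<Delta>) * (ennreal b * emeasure \<mu> (cube x l))"
  proof (rule mult_mono[OF add_mono[OF _ order_refl]])
    show "s \<le> s * \<delta>" using mult_left_mono[OF \<delta>, of s] by simp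
    show "of_nat 1 * emeasure \<mu> (cube x (a * l)) \<le> ennreal b * emeasure \<mu> (cube x l)"
      using Q(1) by (simp add: doubling_cube_def doubling_def)
  qed auto
  also have "\<dots> = ennreal ((1 + cube_const n G (sqrt CARD('d)) c C0 a t) * b) * s * \<delta> * emeasure \<mu> (cube x l)"
  proof -
    let ?k = "cube_const n G (sqrt CARD('d)) c C0 a t"
    have "ennreal ((1 + ?k) * b) = ennreal (1 + ?k) * ennreal b" using cc0 by (intro ennreal_mult') simp
    also have "ennreal (1 + ?k) = 1 + ennreal ?k" using cc0 by simp
    finally show ?thesis by (simp add: \<Delta>_def distrib_left distrib_right ac_simps)
  qed
  finally show ?thesis by (simp add: F_def s_def \<delta>_def)
qed

end

section \<open>Half-open dyadic cubes and the atom around a given cube\<close>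

lemma hcube_subset_ball:
  fixes x :: "real ^ 'd::finite"
  assumes "0 < t"
  shows "hcube x t - {x - (\<chi> i. t / 2)} \<subseteq> ball x (sqrt CARD('d) * t / 2)"
proof
  fix y assume y: "y \<in> hcube x t - {x - (\<chi> i. t / 2)}"
  have comp: "x $ i - t / 2 \<le> y $ i" "y $ i < x $ i + t / 2" for i using y by (auto simp: hcube_def)
  \<comment> \<open>Only the lower corner of the half-open cube lies at the full half diameter from
    the center. Away from it one coordinate gives a strict inequality, which the open ball
    needs.\<close>
  obtain j where j: "y $ j \<noteq> x $ j - t / 2" using y by (auto simp: vec_eq_iff)
  have "(\<Sum>i\<in>UNIV. ((x - y) $ i)\<^sup>2) < (\<Sum>i\<in>(UNIV :: 'd set). (t / 2)\<^sup>2)"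
  proof (rule sum_strict_mono_ex1)
    have "\<bar>(x - y) $ i\<bar> \<le> \<bar>t / 2\<bar>" for i
      using comp[of i] assms unfolding vector_minus_component by linarith
    then show "\<forall>i\<in>UNIV. ((x - y) $ i)\<^sup>2 \<le> (t / 2)\<^sup>2" by (simp only: abs_le_square_iff) simp
    have "\<bar>(x - y) $ j\<bar> < \<bar>t / 2\<bar>"
      using comp[of j] j assms unfolding vector_minus_component by linarith
    then have "((x - y) $ j)\<^sup>2 < (t / 2)\<^sup>2" by (metis abs_ge_zero power2_abs power_strict_mono zero_less_numeral)
    then show "\<exists>i\<in>UNIV. ((x - y) $ i)\<^sup>2 < (t / 2)\<^sup>2" by blast
  qed simp
  then have "dist x y < sqrt (CARD('d) * (t / 2)\<^sup>2)"
    unfolding dist_norm norm_vec_def L2_set_def by (simp add: power_divide)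
  also have "\<dots> = sqrt CARD('d) * t / 2" using assms by (simp add: real_sqrt_mult)
  finally show "y \<in> ball x (sqrt CARD('d) * t / 2)" by simp
qed

lemma ball_subset_hcube: "ball x (t / 2) \<subseteq> hcube x t"
proof
  fix y assume "y \<in> ball x (t / 2)"
  then have "\<bar>(y - x) $ i\<bar> < t / 2" for i
    using component_le_norm_cart[of "y - x" i] by (simp add: dist_norm norm_minus_commute)
  then have "x $ i - t / 2 \<le> y $ i \<and> y $ i < x $ i + t / 2" for i
    unfolding vector_minus_component abs_less_iff by (smt (verit))
  then show "y \<in> hcube x t" by (simp add: hcube_def)
qed

lemma hcube_subset_cube: "hcube x t \<subseteq> cube x t"
proof
  fix y assume "y \<in> hcube x t"
  then have "x $ i - t / 2 \<le> y $ i" "y $ i < x $ i + t / 2" for i by (auto simp: hcube_def)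
  then have "\<bar>y $ i - x $ i\<bar> \<le> t / 2" for i by (smt (verit))
  then show "y \<in> cube x t" by (simp add: cube_def)
qed

lemma hcube_borel [measurable]: "hcube x t \<in> sets borel"
proof -
  have "hcube x t = (\<Inter>i. {y. x $ i - t / 2 \<le> y $ i}) \<inter> (\<Inter>i. {y. y $ i < x $ i + t / 2})"
    by (auto simp: hcube_def)
  moreover have "{y. x $ i - t / 2 \<le> y $ i} \<in> sets borel" "{y. y $ i < x $ i + t / 2} \<in> sets borel" for i
    by measurable
  ultimately show ?thesis by (simp add: sets.Int sets.finite_INT)
qed

lemma hcube_subset_cube_bounds:
  fixes x y :: "real ^ 'd::finite"
  assumes "hcube x t \<subseteq> cube y m" "0 < t"
  shows "infnorm (x - y) \<le> m / 2 - t / 2"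
proof -
  have "\<bar>(x - y) $ i\<bar> \<le> m / 2 - t / 2" for i
  proof (rule field_le_epsilon)
    fix e :: real assume e: "0 < e"
    \<comment> \<open>The upper corner does not belong to the half-open cube and has to be
      approached; the cap at \<open>t\<close> keeps the approaching point inside.\<close>
    define e' where "e' = min e t"
    have e': "0 < e'" "e' \<le> e" "e' \<le> t" using e assms(2) by (auto simp: e'_def)
    have "x + (\<chi> i. t / 2 - e') \<in> hcube x t" "x - (\<chi> i. t / 2) \<in> hcube x t"
      using e' assms(2) by (auto simp: hcube_def)
    then have "x + (\<chi> i. t / 2 - e') \<in> cube y m" "x - (\<chi> i. t / 2) \<in> cube y m" using assms(1) by auto
    then have "\<bar>x $ i + (t / 2 - e') - y $ i\<bar> \<le> m / 2" "\<bar>x $ i - t / 2 - y $ i\<bar> \<le> m / 2"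
      by (auto simp: cube_def)
    then show "\<bar>(x - y) $ i\<bar> \<le> m / 2 - t / 2 + e" using e' unfolding vector_minus_component by linarith
  qed
  then show ?thesis unfolding infnorm_cart by (intro cSup_least) auto
qed

lemma cube_subset_hcube_side:
  fixes x y :: "real ^ 'd::finite"
  assumes "cube x l \<subseteq> hcube y t" "0 \<le> l"
  shows "l \<le> t"
  using cube_subset_side[of x l y t] assms hcube_subset_cube by blast

context growth_measure
begin

text \<open>The first (\<alpha>0,C0)-doubling dilate, of side \<open>l\<close>, lies in a dyadic
  cube \<open>hcube x t\<close> of one of the systems. Doubling passes to the dyadic cube with
  factor \<alpha>0/6, so it belongs to some family \<open>F i j\<close>, and its circumscribed ball
  is the ball of a lattice cube \<open>T\<close>. That ball is doubling in turn, hence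
  \<open>T\<close> is an atom of the filtration.\<close>

lemma ex_covering_atom:
  assumes pos: "0 < emeasure \<mu> (cube y0 m)" "0 < m"
    and \<alpha>: "1 < \<alpha>" and \<alpha>0: "\<alpha>0 = 6 * sqrt CARD('d) * \<alpha>" and C0: "\<alpha>0 ^ CARD('d) < C0"
    and fam: "covering_family n \<mu> \<alpha> \<alpha>0 C0 A0 c M N S"
  obtains i j Ct L T k q where "i < M" "j < N" "dm_filtration n \<mu> \<alpha> C0 A0 Ct c L (S i j)" "T \<in> S i j k"
    "sqrt CARD('d) * m / 2 \<le> Ct * A0 powi (- gen T)"
    "dball \<alpha> T \<subseteq> cube y0 (\<alpha>0 ^ (q + 1) * m)"
    "AE y in \<mu>. y \<in> cube y0 m \<longrightarrow> y \<in> pts T"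
    "\<And>i. i < q \<Longrightarrow> ennreal C0 * emeasure \<mu> (cube y0 (\<alpha>0 ^ i * m)) \<le> emeasure \<mu> (cube y0 (\<alpha>0 ^ (i + 1) * m))"
proof -
  have sqrt: "1 \<le> sqrt CARD('d)" by simp
  have "1 * 1 \<le> sqrt CARD('d) * \<alpha>" using sqrt \<alpha> by (intro mult_mono) auto
  then have \<alpha>0_6: "6 \<le> \<alpha>0" by (simp add: \<alpha>0)
  then have \<alpha>0_1: "1 < \<alpha>0" by simp
  have \<alpha>0n: "\<alpha>0 powr n < C0" by (rule power_lt_imp_powr_lt[OF \<alpha>0_1 C0 pos])
  obtain q where q: "doubling_cube \<mu> \<alpha>0 C0 y0 (\<alpha>0 ^ q * m)"
    "\<And>i. i < q \<Longrightarrow> ennreal C0 * emeasure \<mu> (cube y0 (\<alpha>0 ^ i * m)) \<le> emeasure \<mu> (cube y0 (\<alpha>0 ^ (i + 1) * m))"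
    using ex_doubling_cube_above[OF \<alpha>0_1 \<alpha>0n pos(2,1)] by blast
  define l where "l = \<alpha>0 ^ q * m"
  have "1 \<le> \<alpha>0 ^ q" using \<alpha>0_1 by simp
  then have l: "0 < l" "m \<le> l" using pos(2) by (auto simp: l_def)
  obtain D F where D: "covering_systems M D" and
    F: "\<And>m. m < M \<Longrightarrow> splitting \<mu> (\<alpha>0 / 6) C0 A0 (D m) N (F m)" and
    filt: "\<And>m j. m < M \<Longrightarrow> j < N \<Longrightarrow> \<exists>Ct L. dm_filtration n \<mu> \<alpha> C0 A0 Ct c L (S m j) \<and>
            (\<forall>l \<in> snd ` F m j. \<exists>g.
               Ct * A0 powi (- g) = sqrt (CARD('d)) * l / 2 \<and>
               generation_balls \<mu> \<alpha> C0 {x. (x, l) \<in> F m j} (sqrt (CARD('d)) * l / 2)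
                 {(ctr Q, rad Q) | Q. Q \<in> L \<and> gen Q = g})"
    using fam unfolding covering_family_def by blast
  obtain i x t where i: "i < M" and xt: "(x, t) \<in> D i" "cube y0 l \<subseteq> hcube x t" "hcube x t \<subseteq> cube y0 (6 * l)"
    using D l(1) unfolding covering_systems_def by blast
  have t: "l \<le> t" "0 < t" using cube_subset_hcube_side[OF xt(2)] l by auto
  have xy: "infnorm (x - y0) \<le> 3 * l - t / 2" using hcube_subset_cube_bounds[OF xt(3) t(2)] by simp
  then have t6: "t \<le> 6 * l" using infnorm_pos_le[of "x - y0"] by linarith
  \<comment> \<open>Dilating both cubes by \<alpha>0/6, at least 1, preserves the inclusion although
    the centers differ: \<open>xy\<close> leaves a margin t/2, which scales along.\<close>
  have sub: "hcube x (\<alpha>0 / 6 * t) \<subseteq> cube y0 (\<alpha>0 * l)"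
  proof -
    have "(\<alpha>0 / 12 - 1 / 2) * t \<le> (\<alpha>0 / 12 - 1 / 2) * (6 * l)"
      using t6 \<alpha>0_6 by (intro mult_left_mono) auto
    then have "cube x (\<alpha>0 / 6 * t) \<subseteq> cube y0 (\<alpha>0 * l)"
      using xy by (intro cube_subset) (simp add: algebra_simps)
    then show ?thesis using hcube_subset_cube by blast
  qed
  have pos_h: "0 < emeasure \<mu> (hcube x t)"
  proof -
    have "0 < emeasure \<mu> (cube y0 l)" using q(1) by (simp add: doubling_cube_def doubling_def l_def)
    also have "\<dots> \<le> emeasure \<mu> (hcube x t)" by (intro emeasure_mono xt) simp
    finally show ?thesis .
  qed
  have doub: "emeasure \<mu> (hcube x (\<alpha>0 / 6 * t)) \<le> ennreal C0 * emeasure \<mu> (hcube x t)"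
  proof -
    have "emeasure \<mu> (hcube x (\<alpha>0 / 6 * t)) \<le> emeasure \<mu> (cube y0 (\<alpha>0 * l))"
      by (intro emeasure_mono sub) simp
    also have "\<dots> \<le> ennreal C0 * emeasure \<mu> (cube y0 l)"
      using q(1) by (simp add: doubling_cube_def doubling_def l_def)
    also have "\<dots> \<le> ennreal C0 * emeasure \<mu> (hcube x t)"
      by (intro mult_left_mono emeasure_mono xt) auto
    finally show ?thesis .
  qed
  have "(x, t) \<in> (\<Union>j<N. F i j)"
    using F[OF i] xt(1) pos_h doub unfolding splitting_def doubling_def by auto
  then obtain j where j: "j < N" "(x, t) \<in> F i j" by blast
  obtain Ct L g where L: "dm_filtration n \<mu> \<alpha> C0 A0 Ct c L (S i j)" and
    g: "Ct * A0 powi (- g) = sqrt CARD('d) * t / 2" and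
    balls: "generation_balls \<mu> \<alpha> C0 {x. (x, t) \<in> F i j} (sqrt CARD('d) * t / 2)
      {(ctr Q, rad Q) | Q. Q \<in> L \<and> gen Q = g}"
    using filt[OF i j(1)] j(2) by force
  interpret doubling_filtration \<mu> n G \<alpha> C0 A0 Ct c L "S i j"
    by unfold_locales (rule L)
  have "(x, sqrt CARD('d) * t / 2) \<in> {(ctr Q, rad Q) | Q. Q \<in> L \<and> gen Q = g}"
  proof -
    obtain Y r where eq: "{(ctr Q, rad Q) | Q. Q \<in> L \<and> gen Q = g}
        = (\<lambda>x. (x, sqrt CARD('d) * t / 2)) ` {x. (x, t) \<in> F i j} \<union> (\<lambda>y. (y, r y)) ` Y"
      using balls unfolding generation_balls_def by (elim conjE exE) (rule that)
    show ?thesis unfolding eq using j(2) by blast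
  qed
  then obtain T where T: "T \<in> L" "gen T = g" "ctr T = x" "rad T = sqrt CARD('d) * t / 2" by auto
  define v where "v = x - (\<chi> i. t / 2)"
  have b1: "hcube x t - {v} \<subseteq> dball 1 T"
    using hcube_subset_ball[OF t(2), of x] unfolding v_def dball_def T by simp
  \<comment> \<open>The cube circumscribed about \<alpha> B of \<open>T\<close> has side \<alpha>
    sqrt(d) t, which is \<alpha>0/6 * t. This is the origin of \<alpha>0 = 6 sqrt(d)
    \<alpha>.\<close>
  have b2: "dball \<alpha> T \<subseteq> hcube x (\<alpha>0 / 6 * t)"
    using ball_subset_hcube[of x "\<alpha>0 / 6 * t"] unfolding dball_def T \<alpha>0 by (simp add: mult_ac)
  have v0: "emeasure \<mu> (hcube x t) \<le> emeasure \<mu> (dball 1 T)"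
  proof -
    have "emeasure \<mu> (hcube x t) \<le> emeasure \<mu> ((hcube x t - {v}) \<union> {v})" by (intro emeasure_mono) auto
    also have "\<dots> \<le> emeasure \<mu> (hcube x t - {v}) + emeasure \<mu> {v}" by (intro emeasure_subadditive) auto
    also have "\<dots> \<le> emeasure \<mu> (dball 1 T)" using b1 by (simp add: emeasure_singleton emeasure_mono)
    finally show ?thesis .
  qed
  have "doubling \<mu> C0 (dball 1 T) (dball \<alpha> T)"
    unfolding doubling_def
  proof
    show "0 < emeasure \<mu> (dball 1 T)" using pos_h v0 by simp
    have "emeasure \<mu> (dball \<alpha> T) \<le> emeasure \<mu> (hcube x (\<alpha>0 / 6 * t))" by (intro emeasure_mono b2) simp
    also have "\<dots> \<le> ennreal C0 * emeasure \<mu> (hcube x t)" by (rule doub)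
    also have "\<dots> \<le> ennreal C0 * emeasure \<mu> (dball 1 T)" by (intro mult_left_mono v0) simp
    finally show "emeasure \<mu> (dball \<alpha> T) \<le> ennreal C0 * emeasure \<mu> (dball 1 T)" .
  qed
  then obtain k where k: "T \<in> S i j k" using lattice_level[OF T(1)] by blast
  show thesis
  proof (rule that[OF i j(1) L k])
    show "sqrt CARD('d) * m / 2 \<le> Ct * A0 powi (- gen T)"
      unfolding T g using l t by (simp add: mult_left_mono)
    show "dball \<alpha> T \<subseteq> cube y0 (\<alpha>0 ^ (q + 1) * m)"
      using b2 sub by (simp add: l_def mult.assoc)
    have "AE y in \<mu>. y \<noteq> v" using emeasure_singleton[of v] by (intro AE_I[of _ _ "{v}"]) auto
    then show "AE y in \<mu>. y \<in> cube y0 m \<longrightarrow> y \<in> pts T"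
      using AE_msupp
    proof eventually_elim
      case (elim y)
      show ?case
      proof
        assume "y \<in> cube y0 m"
        then have "y \<in> hcube x t" using cube_mono[OF l(2), of y0] xt(2) by blast
        then show "y \<in> pts T" using b1 elim dball_subset_pts[OF T(1)] by blast
      qed
    qed
  qed (rule q(2))
qed

text \<open>The bound \<open>s\<close> is assumed for all filtrations at once, because the
  filtration that supplies the atom depends on the outer cube.\<close>

lemma RBMO_norm_le_star_norm:
  assumes a: "1 < a"
    and \<alpha>: "480 \<le> \<alpha>" and \<alpha>0: "\<alpha>0 = 6 * sqrt CARD('d) * \<alpha>" and C0: "\<alpha>0 ^ CARD('d) < C0"
    and fam: "covering_family n \<mu> \<alpha> \<alpha>0 C0 A0 c M N S" and f: "loc_integrable \<mu> f"
    and star: "\<And>i j. i < M \<Longrightarrow> j < N \<Longrightarrow> RBMO_star_norm n \<mu> \<alpha> (S i j) f \<le> s"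
  shows "RBMO_norm n a b \<mu> f \<le> ennreal (2 * ((1 + cube_const n G (sqrt CARD('d)) c C0 a \<alpha>0) * b)) * s"
proof -
  define K where "K = ennreal ((1 + cube_const n G (sqrt CARD('d)) c C0 a \<alpha>0) * b) * s"
  have main: "\<exists>F. \<forall>x l. doubling_cube \<mu> a b x l \<longrightarrow> cube x l \<subseteq> cube y0 m \<longrightarrow>
      (\<integral>\<^sup>+y\<in>cube x l. ennreal \<bar>f y - F\<bar> \<partial>\<mu>) \<le> K * cube_delta n \<mu> x l y0 m * emeasure \<mu> (cube x l)"
    if R: "doubling_cube \<mu> a b y0 m" for y0 m
  proof -
    have pos: "0 < emeasure \<mu> (cube y0 m)" "0 < m" using R by (auto simp: doubling_cube_def doubling_def)
    have \<alpha>1: "1 < \<alpha>" using \<alpha> by simp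
    obtain i j Ct L T k q where ij: "i < M" "j < N" and L: "dm_filtration n \<mu> \<alpha> C0 A0 Ct c L (S i j)"
      and T: "T \<in> S i j k" "sqrt CARD('d) * m / 2 \<le> Ct * A0 powi (- gen T)"
        "dball \<alpha> T \<subseteq> cube y0 (\<alpha>0 ^ (q + 1) * m)" "AE y in \<mu>. y \<in> cube y0 m \<longrightarrow> y \<in> pts T"
        "\<And>i. i < q \<Longrightarrow> ennreal C0 * emeasure \<mu> (cube y0 (\<alpha>0 ^ i * m)) \<le> emeasure \<mu> (cube y0 (\<alpha>0 ^ (i + 1) * m))"
      by (rule ex_covering_atom[OF pos \<alpha>1 \<alpha>0 C0 fam]) (rule that; assumption | blast)
    interpret doubling_filtration \<mu> n G \<alpha> C0 A0 Ct c L "S i j"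
      by unfold_locales (rule L)
    have "1 * 1 \<le> sqrt CARD('d) * \<alpha>" using \<alpha>1 by (intro mult_mono) auto
    then have t: "1 < \<alpha>0" by (simp add: \<alpha>0)
    have tn: "\<alpha>0 powr n < C0" by (rule power_lt_imp_powr_lt[OF t C0 pos])
    have "(\<integral>\<^sup>+y\<in>cube x l. ennreal \<bar>f y - avg \<mu> (pts T) f\<bar> \<partial>\<mu>)
        \<le> K * cube_delta n \<mu> x l y0 m * emeasure \<mu> (cube x l)"
      if Q: "doubling_cube \<mu> a b x l" "cube x l \<subseteq> cube y0 m" for x l
      unfolding K_def
      by (rule order_trans[OF nn_integral_cube_le[OF \<alpha> a t tn f T(1-4) _ Q]], erule T(5))
        (intro mult_right_mono mult_left_mono star ij; simp)
    then show ?thesis by blast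
  qed
  have self: "cube_delta n \<mu> x l x l = 1" for x l by (simp add: cube_delta_def)
  have bounds: "ennreal (osc \<mu> (cube x l) f) \<le> 2 * (K * \<delta>)"
      "ennreal \<bar>avg \<mu> (cube x l) f - F\<bar> \<le> K * \<delta>"
    if Q: "doubling_cube \<mu> a b x l"
      and F: "(\<integral>\<^sup>+y\<in>cube x l. ennreal \<bar>f y - F\<bar> \<partial>\<mu>) \<le> K * \<delta> * emeasure \<mu> (cube x l)" for x l F \<delta>
  proof -
    have pos: "0 < emeasure \<mu> (cube x l)" "emeasure \<mu> (cube x l) < \<infinity>"
      using Q emeasure_cube_finite by (auto simp: doubling_cube_def doubling_def)
    note Q' = f cube_borel compact_imp_bounded[OF compact_cube] pos(1)
    have "ennreal (osc \<mu> (cube x l) f) * emeasure \<mu> (cube x l) \<le> 2 * (K * \<delta> * emeasure \<mu> (cube x l))"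
      by (rule order_trans[OF osc_le[OF Q', where c = F]]) (intro mult_left_mono F, simp)
    then have "ennreal (osc \<mu> (cube x l) f) * emeasure \<mu> (cube x l) \<le> 2 * (K * \<delta>) * emeasure \<mu> (cube x l)"
      by (simp only: mult.assoc)
    then show "ennreal (osc \<mu> (cube x l) f) \<le> 2 * (K * \<delta>)"
      by (rule ennreal_le_of_mult_le[OF _ pos])
    show "ennreal \<bar>avg \<mu> (cube x l) f - F\<bar> \<le> K * \<delta>"
      by (rule ennreal_le_of_mult_le[OF order_trans[OF avg_diff_le[OF Q'] F] pos])
  qed
  have "RBMO_norm n a b \<mu> f \<le> 2 * K"
    unfolding RBMO_norm_def
  proof (rule max.boundedI; rule SUP_least; clarsimp)
    fix x l assume Q: "doubling_cube \<mu> a b x l"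
    obtain F where "(\<integral>\<^sup>+y\<in>cube x l. ennreal \<bar>f y - F\<bar> \<partial>\<mu>) \<le> K * cube_delta n \<mu> x l x l * emeasure \<mu> (cube x l)"
      using main[OF Q] Q by blast
    from bounds(1)[OF Q this] show "ennreal (osc \<mu> (cube x l) f) \<le> 2 * K" by (simp add: self)
  next
    fix x l y m assume Q: "doubling_cube \<mu> a b x l" and R: "doubling_cube \<mu> a b y m" and sub: "cube x l \<subseteq> cube y m"
    obtain F where F: "\<forall>x l. doubling_cube \<mu> a b x l \<longrightarrow> cube x l \<subseteq> cube y m \<longrightarrow>
      (\<integral>\<^sup>+z\<in>cube x l. ennreal \<bar>f z - F\<bar> \<partial>\<mu>) \<le> K * cube_delta n \<mu> x l y m * emeasure \<mu> (cube x l)"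
      using main[OF R] by (rule exE)
    let ?\<delta> = "cube_delta n \<mu> x l y m"
    show "ennreal \<bar>avg \<mu> (cube x l) f - avg \<mu> (cube y m) f\<bar> / ?\<delta> \<le> 2 * K"
    proof (rule ennreal_divide_le_of_le_mult)
      have "ennreal \<bar>avg \<mu> (cube x l) f - avg \<mu> (cube y m) f\<bar>
          \<le> ennreal (\<bar>avg \<mu> (cube x l) f - F\<bar> + \<bar>avg \<mu> (cube y m) f - F\<bar>)"
        by (intro ennreal_leI) linarith
      also have "\<dots> = ennreal \<bar>avg \<mu> (cube x l) f - F\<bar> + ennreal \<bar>avg \<mu> (cube y m) f - F\<bar>" by simp
      also have "\<dots> \<le> K * ?\<delta> + K * cube_delta n \<mu> y m y m"
        using bounds(2)[OF Q F[rule_format, OF Q sub]] bounds(2)[OF R F[rule_format, OF R order_refl]]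
        by (rule add_mono)
      also have "\<dots> \<le> K * ?\<delta> + K * ?\<delta>"
        unfolding self by (intro add_mono mult_left_mono) (auto simp: cube_delta_def)
      also have "\<dots> = 2 * K * ?\<delta>" by (simp add: mult.assoc flip: mult_2)
      finally show "ennreal \<bar>avg \<mu> (cube x l) f - avg \<mu> (cube y m) f\<bar> \<le> 2 * K * ?\<delta>" .
      show "1 \<le> ?\<delta>" by (simp add: cube_delta_def)
    qed
  qed
  also have "\<dots> = ennreal (2 * ((1 + cube_const n G (sqrt CARD('d)) c C0 a \<alpha>0) * b)) * s"
    unfolding K_def by (simp add: ennreal_mult' mult.assoc)
  finally show ?thesis .
qed

end

section \<open>Equivalence of the norms and the inclusion in the martingale spaces\<close>

theorem theorem2:
  fixes n C\<mu> a b \<alpha> \<alpha>0 C0 A0 c :: real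
  assumes "0 < n" and "0 < C\<mu>"
    and "1 < a" and "a ^ CARD('d::finite) < b"
    and "\<alpha> = 480 * sqrt (CARD('d::finite))"
    and "\<alpha>0 = 6 * sqrt (CARD('d::finite)) * \<alpha>"
    and "(6 * sqrt (CARD('d::finite)) * \<alpha>) ^ CARD('d::finite) < C0"
    and "5000 * C0 < A0"
    and "\<exists>i::nat. 0 < i \<and> C0 = 2 ^ i" and "\<exists>i::nat. 0 < i \<and> A0 = 2 ^ i"
  shows "(\<exists>K>0. \<forall>(\<mu> :: (real ^ 'd::finite) measure) M N S.
            poly_growth n C\<mu> \<mu> \<longrightarrow> covering_family n \<mu> \<alpha> \<alpha>0 C0 A0 c M N S \<longrightarrow>
              RBMO n a b \<mu> = (\<Inter>(m, j) \<in> {..<M} \<times> {..<N}. RBMO_star n \<mu> \<alpha> (S m j)) \<and>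
              (\<forall>f. loc_integrable \<mu> f \<longrightarrow>
                 RBMO_norm n a b \<mu> f
                   \<le> ennreal K * Max ((\<lambda>(m, j). RBMO_star_norm n \<mu> \<alpha> (S m j) f) ` ({..<M} \<times> {..<N})) \<and>
                 Max ((\<lambda>(m, j). RBMO_star_norm n \<mu> \<alpha> (S m j) f) ` ({..<M} \<times> {..<N}))
                   \<le> ennreal K * RBMO_norm n a b \<mu> f))
       \<and> (\<forall>(\<mu> :: (real ^ 'd::finite) measure) \<alpha>' C0' A0' Ct' c' L S.
            poly_growth n C\<mu> \<mu> \<longrightarrow> dm_filtration n \<mu> \<alpha>' C0' A0' Ct' c' L S \<longrightarrow>
              RBMO_star n \<mu> \<alpha>' S \<subseteq> RBMO_mart \<mu> S)"
proof -
  define G where "G = C\<mu> * (2 * sqrt CARD('d)) powr n"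
  \<comment> \<open>Only the fixed parameters enter, so the same \<open>K\<close> serves every
    measure and family. The maximum with 1 guarantees positivity.\<close>
  define K where "K = max 1 (max (4 * ((1 + atom_const n G \<alpha> a b) * 2 ^ CARD('d) * C0))
    (2 * ((1 + cube_const n G (sqrt CARD('d)) c C0 a \<alpha>0) * b)))"
  have growth: "growth_measure \<mu> n G" if "poly_growth n C\<mu> \<mu>" for \<mu> :: "(real ^ 'd) measure"
    unfolding G_def using that assms(1,2) by (rule poly_growth_imp_growth_measure)
  have "1 \<le> sqrt CARD('d)" by simp
  then have \<alpha>: "480 \<le> \<alpha>" unfolding assms(5) by linarith
  have norms: "RBMO_norm n a b \<mu> f \<le> ennreal K * Max ((\<lambda>(m, j). RBMO_star_norm n \<mu> \<alpha> (S m j) f) ` ({..<M} \<times> {..<N}))"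
      "Max ((\<lambda>(m, j). RBMO_star_norm n \<mu> \<alpha> (S m j) f) ` ({..<M} \<times> {..<N})) \<le> ennreal K * RBMO_norm n a b \<mu> f"
      "0 < M" "0 < N"
    if \<mu>: "poly_growth n C\<mu> \<mu>" and fam: "covering_family n \<mu> \<alpha> \<alpha>0 C0 A0 c M N S" and f: "loc_integrable \<mu> f"
    for \<mu> :: "(real ^ 'd) measure" and M N S f
  proof -
    interpret growth_measure \<mu> n G by (rule growth[OF \<mu>])
    let ?X = "(\<lambda>(m, j). RBMO_star_norm n \<mu> \<alpha> (S m j) f) ` ({..<M} \<times> {..<N})"
    show N: "0 < N" using fam by (simp add: covering_family_def)
    obtain D where "covering_systems M (D :: nat \<Rightarrow> ((real ^ 'd) \<times> real) set)"
      using fam unfolding covering_family_def by blast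
    \<comment> \<open>The covering property, applied to cubes of side 1, produces a system. The
      index set is thus nonempty, as \<open>Max\<close> requires and as the intersection of the
      spaces does in order to be meaningful.\<close>
    then have "\<exists>m<M. True" unfolding covering_systems_def using zero_less_one by blast
    then show M: "0 < M" by auto
    have "RBMO_star_norm n \<mu> \<alpha> (S i j) f \<le> Max ?X" if "i < M" "j < N" for i j
      using that by (intro Max_ge) auto
    then have "RBMO_norm n a b \<mu> f \<le> ennreal (2 * ((1 + cube_const n G (sqrt CARD('d)) c C0 a \<alpha>0) * b)) * Max ?X"
      using assms(7) unfolding assms(6)[symmetric]
      by (intro RBMO_norm_le_star_norm[OF assms(3) \<alpha> assms(6) _ fam f]) auto
    also have "\<dots> \<le> ennreal K * Max ?X"
      by (intro mult_right_mono ennreal_leI) (auto simp: K_def)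
    finally show "RBMO_norm n a b \<mu> f \<le> ennreal K * Max ?X" .
    have "RBMO_star_norm n \<mu> \<alpha> (S i j) f \<le> ennreal K * RBMO_norm n a b \<mu> f" if ij: "i < M" "j < N" for i j
    proof -
      obtain Ct L where L: "dm_filtration n \<mu> \<alpha> C0 A0 Ct c L (S i j)"
        using fam ij unfolding covering_family_def by blast
      interpret doubling_filtration \<mu> n G \<alpha> C0 A0 Ct c L "S i j"
        by unfold_locales (rule L)
      have "RBMO_star_norm n \<mu> \<alpha> (S i j) f
          \<le> ennreal (4 * ((1 + atom_const n G \<alpha> a b) * 2 ^ CARD('d) * C0)) * RBMO_norm n a b \<mu> f"
        by (rule star_norm_le_RBMO_norm[OF _ assms(3,4) f]) (simp add: assms(5))
      also have "\<dots> \<le> ennreal K * RBMO_norm n a b \<mu> f"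
        by (intro mult_right_mono ennreal_leI) (auto simp: K_def)
      finally show ?thesis .
    qed
    then show "Max ?X \<le> ennreal K * RBMO_norm n a b \<mu> f"
      using M N by (intro Max.boundedI) auto
  qed
  have sets_eq: "RBMO n a b \<mu> = (\<Inter>(m, j) \<in> {..<M} \<times> {..<N}. RBMO_star n \<mu> \<alpha> (S m j))"
    if \<mu>: "poly_growth n C\<mu> \<mu>" and fam: "covering_family n \<mu> \<alpha> \<alpha>0 C0 A0 c M N S"
    for \<mu> :: "(real ^ 'd) measure" and M N S
  proof -
    \<comment> \<open>The zero function serves only as some locally integrable function from which
      the two positivity facts can be read off.\<close>
    have MN: "0 < M" "0 < N"
      using norms(3,4)[OF \<mu> fam, of "\<lambda>_. 0"] by (auto simp: loc_integrable_def set_integrable_def)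
    let ?X = "\<lambda>f. (\<lambda>(m, j). RBMO_star_norm n \<mu> \<alpha> (S m j) f) ` ({..<M} \<times> {..<N})"
    have "f \<in> RBMO n a b \<mu> \<longleftrightarrow> (\<forall>m<M. \<forall>j<N. f \<in> RBMO_star n \<mu> \<alpha> (S m j))" for f
    proof (cases "loc_integrable \<mu> f")
      case True
      have "RBMO_norm n a b \<mu> f < \<infinity> \<longleftrightarrow> Max (?X f) < \<infinity>"
        using norms(1,2)[OF \<mu> fam True]
        by (auto simp: ennreal_mult_less_top intro: le_less_trans)
      also have "\<dots> \<longleftrightarrow> (\<forall>m<M. \<forall>j<N. RBMO_star_norm n \<mu> \<alpha> (S m j) f < \<infinity>)"
        using MN by (subst Max_less_iff) auto
      finally show ?thesis using True by (simp add: RBMO_def RBMO_star_def)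
    next
      case False
      then show ?thesis using MN by (auto simp: RBMO_def RBMO_star_def)
    qed
    then show ?thesis by (auto simp: set_eq_iff)
  qed
  have mart: "RBMO_star n \<mu> \<alpha>' S \<subseteq> RBMO_mart \<mu> S"
    if "poly_growth n C\<mu> \<mu>" "dm_filtration n \<mu> \<alpha>' C0' A0' Ct' c' L S"
    for \<mu> :: "(real ^ 'd) measure" and \<alpha>' C0' A0' Ct' c' L S
  proof -
    interpret growth_measure \<mu> n G by (rule growth) fact
    interpret doubling_filtration \<mu> n G \<alpha>' C0' A0' Ct' c' L S
      by unfold_locales fact
    show ?thesis by (rule RBMO_star_subset_mart)
  qed
  have "0 < K" by (simp add: K_def)
  show ?thesis
    by (intro conjI exI[of _ K] allI impI)
      (fact | (rule sets_eq norms(1) norms(2) mart; assumption))+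
qed

end
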